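(* Fix $d\ge2$ and $t\ge2$. There exist constants $\varepsilon_0,C,c_*>0$, depending only on $d$ and $t$, such that the following holds. Let $X=\{x_1,\ldots,x_N\}\subset\mathbb S^{d-1}$ be any node-transitive spherical $t$-design whose Steiner-normalized Minkowski polytope satisfies $P_X^\circ=cUP_X$ for some $c>0$, $U\in O(d)$, let $r,R$ be the centered inradius and circumradius of $P_X$, put $\alpha=r/R$, $b_{ij}:=\langle Ux_i,x_j\rangle$, $A_{ij}:=\alpha-b_{ij}$, and suppose $$0\le\delta:=\frac rR-\eta_{t,d}\le\varepsilon_0.$$ Then for every $i\in\{1,\ldots,N\}$: (i) The measure $\nu_i:=\frac1N\sum_{j=1}^N\delta_{b_{ij}}$ satisfies $$W_1(\nu_i,\nu^*_{t,d})\le C\sqrt\delta\qquad\text{and}\qquad\frac1N\sum_{j=1}^N\operatorname{dist}(b_{ij},\Xi_{t,d})^2\le C\delta.$$ (ii) With $E_k(\alpha)$ the moving Voronoi cells and $m_{ik}:=\#\{j:b_{ij}\in E_k(\alpha)\}$, $$\left|\frac{m_{ik}}N-\lambda_k\right|\le C\sqrt\delta\qquad(0\le k\le n).$$ (iii) If $\lambda_+=\lambda_n$ is the weight of the largest quadrature node, then $$\left|\frac1N\#\{j:A_{ij}\le C\sqrt\delta\}-\lambda_+\right|\le C\sqrt\delta.$$ Finally, $$\delta\ge\frac{c_*}{N^2}\max_{0\le k\le n}\operatorname{dist}(N\lambda_k,\mathbb Z)^2.$$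
   Context: $\sigma$ is the normalized (probability) surface measure on the unit sphere $\mathbb S^{d-1}\subset\mathbb R^d$, and $\omega_{d-1}$ is the total $(d-1)$-area of $\mathbb S^{d-1}$. A finite set $X=\{x_1,\ldots,x_N\}\subset\mathbb S^{d-1}$ of $N$ distinct points is a spherical $t$-design if $\frac1N\sum_i p(x_i)=\int p\,d\sigma$ for every polynomial $p$ of total degree at most $t$. It is node-transitive if some subgroup $G\le O(d)$ preserves $X$ and acts transitively on it. For $t\ge2$, the Minkowski polytope $P_X\subset\mathbb R^d$ is the full-dimensional convex polytope, unique up to translation, whose surface area measure is $\frac{\omega_{d-1}}N\sum_i\delta_{x_i}$: it has exactly $N$ facets, with outer unit normals $x_1,\ldots,x_N$, each of $(d-1)$-area $\omega_{d-1}/N$. It is Steiner-normalized: the translate is chosen so that the Steiner point $d\int_{\mathbb S^{d-1}}h_{P_X}(u)u\,d\sigma(u)$ is $0$, which implies $0\in\operatorname{int}P_X$. Here $h_P(u)=\max_{y\in P}\langle u,y\rangle$ and $P^\circ=\{z:\langle z,y\rangle\le1\ \forall y\in P\}$. For node-transitive $X$ all $h_{P_X}(x_i)$ are equal, to $h$ say. The centered inradius $r$ (largest origin-centered ball contained in $P_X$) and centered circumradius $R$ (smallest origin-centered ball containing $P_X$) are here $r=h$, $R=1/(ch)$, so $\alpha=r/R=ch^2$. The matrix $A$ is the dimensionless scaled slack matrix of $P_X$ ($A=ch\,S$ with $S_{ij}=h-\langle x_i,y_j\rangle$, $y_j=\frac1{ch}U^Tx_j$ the vertices of $P_X$). Quadrature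 data. Let $\mu_d$ be the distribution of the first coordinate of a uniform random point of $\mathbb S^{d-1}$, i.e. $d\mu_d(s)=c_d(1-s^2)^{(d-3)/2}ds$ on $[-1,1]$ with $c_d$ normalizing. Let $p_k$ be the degree-$k$ orthogonal polynomial for $\mu_d$, and $p_k^+$ the degree-$k$ orthogonal polynomial for $(1+s)\,d\mu_d(s)$. If $t=2n+1$, $\eta_{t,d}$ is the largest zero of $p_{n+1}$, the nodes $\xi_0<\cdots<\xi_n=\eta_{t,d}$ are the zeros of $p_{n+1}$, and $\lambda_0,\ldots,\lambda_n>0$ are the Gaussian quadrature weights. If $t=2n$, $\eta_{t,d}$ is the largest zero of $p_n^+$, the nodes are $-1=\xi_0<\xi_1<\cdots<\xi_n=\eta_{t,d}$ with $\xi_1,\ldots,\xi_n$ the zeros of $p_n^+$, and $\lambda_0,\ldots,\lambda_n>0$ are the Gauss--Radau weights with prescribed node $-1$. In both cases the weights are the unique ones with $\sum_k\lambda_kq(\xi_k)=\int q\,d\mu_d$ for all polynomials $q$ of degree $\le t$. Put $\Xi_{t,d}=\{\xi_0,\ldots,\xi_n\}$ and $\nu^*_{t,d}=\sum_k\lambda_k\delta_{\xi_k}$. Moving Voronoi cells: let $\Xi_\alpha=\{\xi_0,\ldots,\xi_{n-1},\alpha\}$ and choose a (measurable) nearest-node projection $[-1,\alpha]\to\Xi_\alpha$; $E_k(\alpha)$ is the set of points projected to $\xi_k$ for $k<n$, and $E_n(\alpha)$ the set of points projected to $\alpha$. $W_1$ is the Wasserstein distance on $[-1,1]$ with cost $|s-r|$.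 *)

theory Defs
  imports "HOL-Analysis.Analysis" "HOL-Computational_Algebra.Polynomial"
begin

section \<open>Measures on the sphere and spherical designs\<close>

text \<open>
  The normalized surface measure of the unit sphere, as the image of the uniform distribution on
  the unit ball under \<open>x \<mapsto> x / norm x\<close> (which is \<^const>\<open>sgn\<close>; the origin is a null set). It is a
  Borel measure on the whole space, concentrated on the sphere.
\<close>
definition sphere_measure :: "(real ^ 'd::finite) measure" where
  "sphere_measure = distr (uniform_measure lborel (ball 0 1)) borel sgn"

text \<open>
  Total area of the unit sphere in dimension \<open>d\<close>, that is
  \<open>2 * pi powr (d / 2) / Gamma (d / 2)\<close>, written as \<open>d\<close> times the volume of the unit ball.
\<close>
definition sphere_area :: "nat \<Rightarrow> real" where
  "sphere_area d = real d * unit_ball_vol (real d)"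

definition poly_total_degree_le :: "nat \<Rightarrow> (real ^ 'd::finite \<Rightarrow> real) \<Rightarrow> bool" where
  "poly_total_degree_le t p \<longleftrightarrow>
     (\<exists>c :: ('d \<Rightarrow> nat) \<Rightarrow> real.
        p = (\<lambda>x. \<Sum>a | (\<Sum>i\<in>UNIV. a i) \<le> t. c a * (\<Prod>i\<in>UNIV. (x $ i) ^ a i)))"

definition spherical_design :: "nat \<Rightarrow> (real ^ 'd::finite) set \<Rightarrow> bool" where
  "spherical_design t X \<longleftrightarrow>
     finite X \<and> X \<noteq> {} \<and> X \<subseteq> sphere 0 1 \<and>
     (\<forall>p. poly_total_degree_le t p \<longrightarrow>
        (1 / real (card X)) * (\<Sum>x\<in>X. p x) = (LINT x|sphere_measure. p x))"

definition orthogonal_subgroup :: "(real ^ 'd::finite \<Rightarrow> real ^ 'd) set \<Rightarrow> bool" where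
  "orthogonal_subgroup G \<longleftrightarrow>
     (\<forall>g\<in>G. orthogonal_transformation g) \<and> id \<in> G \<and>
     (\<forall>g\<in>G. \<forall>h\<in>G. g \<circ> h \<in> G) \<and> (\<forall>g\<in>G. inv g \<in> G)"

definition node_transitive :: "(real ^ 'd::finite) set \<Rightarrow> bool" where
  "node_transitive X \<longleftrightarrow>
     (\<exists>G. orthogonal_subgroup G \<and> (\<forall>g\<in>G. g ` X = X) \<and>
          (\<forall>x\<in>X. \<forall>y\<in>X. \<exists>g\<in>G. g x = y))"

section \<open>Convex bodies and the Minkowski polytope\<close>

definition support_fun :: "(real ^ 'd::finite) set \<Rightarrow> real ^ 'd \<Rightarrow> real" where
  "support_fun P u = (SUP y\<in>P. u \<bullet> y)"

definition polar :: "(real ^ 'd::finite) set \<Rightarrow> (real ^ 'd) set" where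
  "polar P = {z. \<forall>y\<in>P. z \<bullet> y \<le> 1}"

definition face_in_direction :: "(real ^ 'd::finite) set \<Rightarrow> real ^ 'd \<Rightarrow> (real ^ 'd) set" where
  "face_in_direction P u = {y \<in> P. u \<bullet> y = support_fun P u}"

text \<open>
  The area (Lebesgue measure in codimension one) of a subset \<open>F\<close> of a hyperplane with unit normal
  \<open>u\<close>: it equals the volume of the right prism of height \<open>1\<close> over \<open>F\<close>.
\<close>
definition hyperplane_area :: "(real ^ 'd::finite) set \<Rightarrow> real ^ 'd \<Rightarrow> real" where
  "hyperplane_area F u = measure lborel {y + s *\<^sub>R u | y s. y \<in> F \<and> 0 \<le> s \<and> s \<le> 1}"

definition steiner_point :: "(real ^ 'd::finite) set \<Rightarrow> real ^ 'd" where
  "steiner_point P = real CARD('d) *\<^sub>R (LINT u|sphere_measure. support_fun P u *\<^sub>R u)"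

text \<open>
  \<open>minkowski_polytope X P\<close>: the surface area measure of the full-dimensional polytope \<open>P\<close> consists
  of atoms of equal mass \<open>sphere_area d / N\<close> at the \<open>N\<close> points of \<open>X\<close>, i.e. mapping a unit normal
  to the face with that outer normal is a bijection from \<open>X\<close> onto the set of facets, and all
  facets have that area. This determines \<open>P\<close> up to translation only.
\<close>
definition minkowski_polytope :: "(real ^ 'd::finite) set \<Rightarrow> (real ^ 'd) set \<Rightarrow> bool" where
  "minkowski_polytope X P \<longleftrightarrow>
     polytope P \<and> interior P \<noteq> {} \<and>
     bij_betw (face_in_direction P) X {F. F facet_of P} \<and>
     (\<forall>x\<in>X. hyperplane_area (face_in_direction P x) x = sphere_area CARD('d) / real (card X))"

definition steiner_minkowski_polytope ::
    "(real ^ 'd::finite) set \<Rightarrow> (real ^ 'd) set \<Rightarrow> bool" where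
  "steiner_minkowski_polytope X P \<longleftrightarrow> minkowski_polytope X P \<and> steiner_point P = 0"

definition centered_inradius :: "(real ^ 'd::finite) set \<Rightarrow> real" where
  "centered_inradius P = Sup {\<rho>. 0 \<le> \<rho> \<and> cball 0 \<rho> \<subseteq> P}"

definition centered_circumradius :: "(real ^ 'd::finite) set \<Rightarrow> real" where
  "centered_circumradius P = Inf {\<rho>. 0 \<le> \<rho> \<and> P \<subseteq> cball 0 \<rho>}"

section \<open>Quadrature data\<close>

text \<open>The distribution of the first coordinate of a uniform random point of the unit sphere.\<close>
definition coord_measure :: "nat \<Rightarrow> real measure" where
  "coord_measure d = density lborel (\<lambda>s. ennreal
     (indicator {-1..1} s * (1 - s\<^sup>2) powr ((real d - 3) / 2) /
      (LINT s:{-1..1}|lborel. (1 - s\<^sup>2) powr ((real d - 3) / 2))))"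

text \<open>Monic normalization; only the zeros matter below.\<close>
definition orth_poly :: "real measure \<Rightarrow> nat \<Rightarrow> real poly" where
  "orth_poly M k = (THE p. degree p = k \<and> lead_coeff p = 1 \<and>
     (\<forall>q. degree q < k \<longrightarrow> (LINT s|M. poly p s * poly q s) = 0))"

text \<open>
  With \<open>n = t div 2\<close>, the parameter \<open>t\<close> is \<open>2 * n + 1\<close> (Gauss quadrature) or \<open>2 * n\<close> (Gauss-Radau
  quadrature with prescribed node \<open>-1\<close>).
\<close>
definition quad_poly :: "nat \<Rightarrow> nat \<Rightarrow> real poly" where
  "quad_poly t d =
     (if odd t then orth_poly (coord_measure d) (t div 2 + 1)
      else orth_poly (density (coord_measure d) (\<lambda>s. ennreal (1 + s))) (t div 2))"

definition quad_eta :: "nat \<Rightarrow> nat \<Rightarrow> real" where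
  "quad_eta t d = Max {s. poly (quad_poly t d) s = 0}"

definition quad_nodes :: "nat \<Rightarrow> nat \<Rightarrow> real set" where
  "quad_nodes t d =
     (if odd t then {s. poly (quad_poly t d) s = 0}
      else insert (-1) {s. poly (quad_poly t d) s = 0})"

text \<open>The nodes in increasing order, indexed by \<open>k \<le> t div 2\<close>.\<close>
definition quad_node :: "nat \<Rightarrow> nat \<Rightarrow> nat \<Rightarrow> real" where
  "quad_node t d k = sorted_list_of_set (quad_nodes t d) ! k"

text \<open>The value \<open>0\<close> beyond the index range is there to make the weights unique as a function.\<close>
definition quad_weight :: "nat \<Rightarrow> nat \<Rightarrow> nat \<Rightarrow> real" where
  "quad_weight t d = (THE w. (\<forall>k > t div 2. w k = 0) \<and>
     (\<forall>q :: real poly. degree q \<le> t \<longrightarrow>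
        (\<Sum>k\<le>t div 2. w k * poly q (quad_node t d k)) = (LINT s|coord_measure d. poly q s)))"

section \<open>Discrete measures, Wasserstein distance, Voronoi cells\<close>

text \<open>The Borel measure giving mass \<open>w i\<close> to \<open>x i\<close> for every \<open>i \<in> I\<close> (with multiplicity).\<close>
definition sum_dirac :: "'i set \<Rightarrow> ('i \<Rightarrow> real) \<Rightarrow> ('i \<Rightarrow> real) \<Rightarrow> real measure" where
  "sum_dirac I w x = distr (point_measure I (\<lambda>i. ennreal (w i))) borel x"

definition quad_measure :: "nat \<Rightarrow> nat \<Rightarrow> real measure" where
  "quad_measure t d = sum_dirac {..t div 2} (quad_weight t d) (quad_node t d)"

definition couplings :: "real measure \<Rightarrow> real measure \<Rightarrow> (real \<times> real) measure set" where
  "couplings M N = {K. sets K = sets borel \<and> distr K borel fst = M \<and> distr K borel snd = N}"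

text \<open>
  Couplings of measures concentrated on \<open>{-1..1}\<close> are concentrated on its square, so working with
  Borel measures on the line does not change the distance.
\<close>
definition wasserstein1 :: "real measure \<Rightarrow> real measure \<Rightarrow> ennreal" where
  "wasserstein1 M N = (INF K\<in>couplings M N. \<integral>\<^sup>+ z. ennreal \<bar>fst z - snd z\<bar> \<partial>K)"

definition moving_node :: "nat \<Rightarrow> nat \<Rightarrow> real \<Rightarrow> nat \<Rightarrow> real" where
  "moving_node t d \<alpha> k = (if k < t div 2 then quad_node t d k else \<alpha>)"

definition nearest_node_projection :: "nat \<Rightarrow> nat \<Rightarrow> real \<Rightarrow> (real \<Rightarrow> real) \<Rightarrow> bool" where
  "nearest_node_projection t d \<alpha> \<pi> \<longleftrightarrow>
     \<pi> \<in> borel_measurable (restrict_space borel {-1..\<alpha>}) \<and>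
     (\<forall>s\<in>{-1..\<alpha>}. \<pi> s \<in> moving_node t d \<alpha> ` {..t div 2} \<and>
        (\<forall>k\<le>t div 2. \<bar>s - \<pi> s\<bar> \<le> \<bar>s - moving_node t d \<alpha> k\<bar>))"

definition moving_cell :: "nat \<Rightarrow> nat \<Rightarrow> real \<Rightarrow> (real \<Rightarrow> real) \<Rightarrow> nat \<Rightarrow> real set" where
  "moving_cell t d \<alpha> \<pi> k = {s \<in> {-1..\<alpha>}. \<pi> s = moving_node t d \<alpha> k}"

end

theory Submission
  imports Defs
begin

text \<open>
  Fix \<open>x \<in> X\<close>, let \<open>N\<close> be the number of points of \<open>X\<close> and write \<open>b y = U x \<bullet> y\<close> for \<open>y \<in> X\<close>. The proof
  rests on two facts about the numbers \<open>b y\<close>.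

  \<^item> They satisfy the one-sided bound \<open>b y \<le> \<alpha>\<close> (lemma \<open>self_polar_inner_le\<close>). If the support function
  of \<open>P\<close> has a single value \<open>\<eta>\<close> on \<open>X\<close>, self-polarity writes \<open>y\<close> as \<open>c \<eta> U p\<close> with \<open>p \<in> P\<close>, so that
  \<open>b y = c \<eta> (x \<bullet> p) \<le> c \<eta>\<^sup>2\<close>, and the latter is at most the ratio of the radii.

  \<^item> Averages of polynomials of degree at most \<open>t\<close> in \<open>b y\<close> agree with the quadrature rule, since \<open>X\<close> is a
  design, zonal polynomials integrate against the coordinate distribution (\<open>sphere_measure_zonal\<close>) and the
  rule is exact in degree \<open>t\<close> (\<open>quad_weight\<close>).

  That the support function is constant on \<open>X\<close> is the uniqueness in Minkowski's theorem: an isometry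
  permuting \<open>X\<close> maps \<open>P\<close> to a polytope with the same facet normals and areas, hence to a translate of \<open>P\<close>,
  and as the Steiner point is \<open>0\<close>, to \<open>P\<close> itself (\<open>support_fun_invariant\<close>). Uniqueness is derived from the
  Brunn-Minkowski inequality for midpoints. The volume of the polytope with given facet normals is a
  log-concave function of the support numbers, whose partial derivatives are the areas of the facets
  (\<open>wulff_volume_derivative\<close>). As all areas are equal, \<open>P\<close> has maximal volume among the shapes with the
  same sum of support numbers (\<open>wulff_volume_max\<close>), which leaves only the equality case of
  Brunn-Minkowski for \<open>P\<close> and its image (\<open>brunn_minkowski_midpoint_equality\<close>).

  The rest is one-dimensional (locale \<open>near_quadrature\<close>). Let \<open>Q(s) = (\<alpha> - s) \<Prod>\<^sub>k (s - \<xi>\<^sub>k)\<^sup>2\<close>, with the product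
  over the nodes other than the largest, except that for even \<open>t\<close> the node \<open>-1\<close> contributes only the
  factor \<open>s + 1\<close>. This polynomial has degree \<open>t\<close>, is nonnegative on \<open>{-1..\<alpha>}\<close>, where all \<open>b y\<close> lie, vanishes
  at all nodes but the largest and is \<open>O(\<delta>)\<close> there. So the average of \<open>Q (b y)\<close> is \<open>O(\<delta>)\<close>. On
  \<open>{-1..\<alpha>}\<close> the polynomial dominates, up to a constant, the squared distance to the nodes with the largest replaced by \<open>\<alpha>\<close>,
  and near \<open>\<alpha>\<close> the distance itself. Hence the mean squared distance of \<open>b y\<close> to the nodes is \<open>O(\<delta>)\<close> and the
  mean distance \<open>O(sqrt \<delta>)\<close>. Averages of the Lagrange polynomials then determine the masses of the cells
  up to \<open>O(sqrt \<delta>)\<close> (\<open>mass\<close>), a coupling that keeps as much mass as possible in its cell bounds the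
  Wasserstein distance (\<open>wasserstein\<close>), and Markov's inequality in the top cell gives the count of small
  slacks (\<open>top_count\<close>). Finally, as the sizes of the cells are integers, \<open>N \<lambda>\<^sub>k\<close> is within
  \<open>O(N sqrt \<delta>)\<close> of an integer.
\<close>

section \<open>Midpoint forms of the Prekopa-Leindler and Brunn-Minkowski inequalities\<close>

lemma nn_integral_layer_cake:
  fixes F :: "'a \<Rightarrow> ennreal"
  assumes "sigma_finite_measure M" and [measurable]: "F \<in> borel_measurable M"
  shows "(\<integral>\<^sup>+x. F x \<partial>M) = (\<integral>\<^sup>+r\<in>{0..}. emeasure M {x \<in> space M. ennreal r < F x} \<partial>lborel)"
proof -
  interpret sigma_finite_measure M by fact
  interpret P: pair_sigma_finite M lborel by standard
  have len: "(\<integral>\<^sup>+r. indicator {0..} r * indicator {r. ennreal r < v} r \<partial>lborel) = v" (is "?L = _") for v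
  proof (cases v)
    case (real c)
    have "?L = (\<integral>\<^sup>+r. indicator {0..<c} r \<partial>lborel)"
      using real by (intro nn_integral_cong) (auto simp: indicator_def ennreal_less_iff)
    then show ?thesis using real by simp
  next
    case top
    have "?L = (\<integral>\<^sup>+r. indicator {0::real..} r \<partial>lborel)"
      using top by (intro nn_integral_cong) (auto simp: indicator_def)
    also have "\<dots> = emeasure lborel {0::real..}" by simp
    also have "\<dots> = \<infinity>"
    proof -
      have "emeasure lborel {0::real..} \<ge> ennreal (real n)" for n
        using emeasure_mono[of "{0..real n}" "{0..}" lborel] by simp
      then show ?thesis
        by (metis ennreal_top_neq_one ennreal_Ex_less_of_nat ennreal_of_nat_eq_real_of_nat infinity_ennreal_def leD less_top)
    qed
    finally show ?thesis using top by simp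
  qed
  have "(\<integral>\<^sup>+x. F x \<partial>M) = (\<integral>\<^sup>+x. \<integral>\<^sup>+r. indicator {0..} r * indicator {r. ennreal r < F x} r \<partial>lborel \<partial>M)"
    by (simp only: len)
  also have "\<dots> = (\<integral>\<^sup>+r. \<integral>\<^sup>+x. indicator {0..} r * indicator {r. ennreal r < F x} r \<partial>M \<partial>lborel)"
    by (rule P.Fubini'[symmetric]) (simp add: split_beta' indicator_def)
  also have "\<dots> = (\<integral>\<^sup>+r\<in>{0..}. emeasure M {x \<in> space M. ennreal r < F x} \<partial>lborel)"
  proof (intro nn_integral_cong)
    fix r :: real
    have "(\<integral>\<^sup>+x. indicator {0..} r * indicator {r. ennreal r < F x} r \<partial>M) =
        indicator {0..} r * (\<integral>\<^sup>+x. indicator {x \<in> space M. ennreal r < F x} x \<partial>M)"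
      by (subst nn_integral_cmult[symmetric]) (auto intro!: nn_integral_cong simp: indicator_def)
    also have "\<dots> = emeasure M {x \<in> space M. ennreal r < F x} * indicator {0..} r"
      by (subst nn_integral_indicator) (auto simp: mult.commute)
    finally show "(\<integral>\<^sup>+x. indicator {0..} r * indicator {r. ennreal r < F x} r \<partial>M) =
      emeasure M {x \<in> space M. ennreal r < F x} * indicator {0..} r" .
  qed
  finally show ?thesis .
qed

text \<open>
  Brunn-Minkowski on the line, for midpoints. If \<open>b\<close> is the least point of \<open>B\<close> and \<open>a\<close> the greatest
  point of \<open>A\<close>, then \<open>(A + b) / 2\<close> and \<open>(a + B) / 2\<close> lie in \<open>C\<close> on the two sides of \<open>(a + b) / 2\<close>, so
  their lengths add up. Extremal points need not exist, hence the \<open>e\<close> below.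
\<close>
lemma emeasure_midpoints_real:
  fixes A B C :: "real set"
  assumes [measurable]: "A \<in> sets borel" "B \<in> sets borel" "C \<in> sets borel"
    and ne: "A \<noteq> {}" "B \<noteq> {}" and bd: "bounded A" "bounded B"
    and sub: "\<And>x y. x \<in> A \<Longrightarrow> y \<in> B \<Longrightarrow> (x + y) / 2 \<in> C"
  shows "(emeasure lborel A + emeasure lborel B) / 2 \<le> emeasure lborel C"
proof -
  have fA: "emeasure lborel A < \<infinity>" and fB: "emeasure lborel B < \<infinity>"
    using bd emeasure_bounded_finite by blast+
  have half: "emeasure lborel ((\<lambda>x. (x + c) / 2) ` S) = emeasure lborel S / 2"
    and half_meas: "(\<lambda>x. (x + c) / 2) ` S \<in> sets borel"
    if [measurable]: "S \<in> sets borel" for S and c :: real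
  proof -
    have eq: "(\<lambda>x. (x + c) / 2) ` S = (\<lambda>z. 2 * z - c) -` S \<inter> space borel"
    proof (intro set_eqI iffI)
      fix z assume "z \<in> (\<lambda>z. 2 * z - c) -` S \<inter> space borel"
      then show "z \<in> (\<lambda>x. (x + c) / 2) ` S" by (intro image_eqI[of _ _ "2 * z - c"]) auto
    qed (auto simp: add_divide_distrib)
    moreover have "(\<lambda>z. 2 * z - c) -` S \<inter> space borel \<in> sets borel"
      by (rule measurable_sets[OF _ that]) measurable
    ultimately show *: "(\<lambda>x. (x + c) / 2) ` S \<in> sets borel" by simp
    have "emeasure lborel S = (\<integral>\<^sup>+z. indicator S z \<partial>lborel)" by simp
    also have "\<dots> = 2 * (\<integral>\<^sup>+z. indicator S (- c + 2 * z) \<partial>lborel)"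
      by (subst nn_integral_real_affine[where c = 2 and t = "-c"]) auto
    also have "(\<integral>\<^sup>+z. indicator S (- c + 2 * z) \<partial>lborel) = (\<integral>\<^sup>+z. indicator ((\<lambda>x. (x + c) / 2) ` S) z \<partial>lborel)"
      unfolding eq by (intro nn_integral_cong) (auto simp: indicator_def)
    also have "\<dots> = emeasure lborel ((\<lambda>x. (x + c) / 2) ` S)"
      using * by (subst nn_integral_indicator) auto
    finally show "emeasure lborel ((\<lambda>x. (x + c) / 2) ` S) = emeasure lborel S / 2"
      by (simp add: ennreal_mult_divide_eq mult.commute[of 2])
  qed
  have key: "measure lborel A + measure lborel B - 2 * e \<le> 2 * c"
    if "e > 0" and c: "emeasure lborel C = ennreal c" "c \<ge> 0" for e c
  proof -
    have "bdd_above A" "bdd_below B"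
      using bd bounded_imp_bdd_above bounded_imp_bdd_below by auto
    from less_cSupE[of "Sup A - e" A] \<open>e > 0\<close> ne obtain a where a: "a \<in> A" "Sup A - e < a" by auto
    from cInf_lessD[of B "Inf B + e"] \<open>e > 0\<close> ne obtain b where b: "b \<in> B" "b < Inf B + e" by auto
    define A1 where "A1 = A \<inter> {..a}"
    define B1 where "B1 = B \<inter> {b<..}"
    have [measurable]: "A1 \<in> sets borel" "B1 \<in> sets borel" by (auto simp: A1_def B1_def)
    have A1: "measure lborel A \<le> measure lborel A1 + e"
    proof -
      have "A \<subseteq> A1 \<union> {Sup A - e<..Sup A}"
        using a \<open>bdd_above A\<close> by (auto simp: A1_def intro: cSup_upper)
      then have "emeasure lborel A \<le> emeasure lborel (A1 \<union> {Sup A - e<..Sup A})"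
        by (intro emeasure_mono) auto
      also have "\<dots> \<le> emeasure lborel A1 + emeasure lborel {Sup A - e<..Sup A}"
        by (intro emeasure_subadditive) auto
      also have "\<dots> = ennreal (measure lborel A1 + e)"
        using fA emeasure_mono[of A1 A lborel] \<open>e > 0\<close>
        by (subst emeasure_eq_ennreal_measure) (auto simp: A1_def less_top[symmetric] top_unique)
      finally show ?thesis
        using fA \<open>e > 0\<close> by (subst (asm) emeasure_eq_ennreal_measure) (auto simp: less_top[symmetric] measure_nonneg simp del: ennreal_plus)
    qed
    have B1: "measure lborel B \<le> measure lborel B1 + e"
    proof -
      have "B \<subseteq> B1 \<union> {Inf B..Inf B + e}"
        using b \<open>bdd_below B\<close> by (auto simp: B1_def intro: cInf_lower)
      then have "emeasure lborel B \<le> emeasure lborel (B1 \<union> {Inf B..Inf B + e})"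
        by (intro emeasure_mono) auto
      also have "\<dots> \<le> emeasure lborel B1 + emeasure lborel {Inf B..Inf B + e}"
        by (intro emeasure_subadditive) auto
      also have "\<dots> = ennreal (measure lborel B1 + e)"
        using fB emeasure_mono[of B1 B lborel] \<open>e > 0\<close>
        by (subst emeasure_eq_ennreal_measure) (auto simp: B1_def less_top[symmetric] top_unique)
      finally show ?thesis
        using fB \<open>e > 0\<close> by (subst (asm) emeasure_eq_ennreal_measure) (auto simp: less_top[symmetric] measure_nonneg simp del: ennreal_plus)
    qed
    have "emeasure lborel A1 / 2 + emeasure lborel B1 / 2 =
        emeasure lborel ((\<lambda>x. (x + b) / 2) ` A1 \<union> (\<lambda>x. (x + a) / 2) ` B1)"
      by (subst plus_emeasure[symmetric]) (auto simp: half half_meas A1_def B1_def)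
    also have "\<dots> \<le> emeasure lborel C"
    proof (intro emeasure_mono)
      show "(\<lambda>x. (x + b) / 2) ` A1 \<union> (\<lambda>x. (x + a) / 2) ` B1 \<subseteq> C"
        using a b sub by (auto simp: A1_def B1_def add.commute[of _ a])
    qed simp
    finally have "emeasure lborel A1 / 2 + emeasure lborel B1 / 2 \<le> ennreal c" using c by simp
    moreover have "emeasure lborel A1 = measure lborel A1" "emeasure lborel B1 = measure lborel B1"
      using emeasure_bounded_finite[OF bounded_subset[OF bd(1), of A1]] emeasure_bounded_finite[OF bounded_subset[OF bd(2), of B1]]
      by (auto simp: A1_def B1_def less_top[symmetric] emeasure_eq_ennreal_measure)
    ultimately have "measure lborel A1 / 2 + measure lborel B1 / 2 \<le> c"
      using c divide_ennreal[of "measure lborel A1" 2] divide_ennreal[of "measure lborel B1" 2]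
      by (simp add: ennreal_plus[symmetric] del: ennreal_plus)
    then show ?thesis using A1 B1 by simp
  qed
  show ?thesis
  proof (cases "emeasure lborel C")
    case top
    then show ?thesis by simp
  next
    case (real c)
    have "measure lborel A + measure lborel B \<le> 2 * c"
    proof (rule field_le_epsilon)
      fix e :: real assume "e > 0"
      then show "measure lborel A + measure lborel B \<le> 2 * c + e"
        using key[of "e / 2" c] real by simp
    qed
    moreover have "emeasure lborel A = measure lborel A" "emeasure lborel B = measure lborel B"
      using fA fB by (auto simp: emeasure_eq_ennreal_measure less_top[symmetric])
    ultimately show ?thesis using real
      by (simp add: divide_ennreal measure_nonneg ennreal_plus[symmetric]
          ennreal_numeral[symmetric] del: ennreal_plus ennreal_numeral)
  qed
qed


text \<open>
  The layer-cake formula reduces this to the previous lemma applied to superlevel sets. Both suprema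
  have to equal \<open>1\<close>: otherwise, at some levels, one superlevel set is empty and the other is not.
\<close>
lemma prekopa_leindler_midpoint_unit:
  fixes f g h :: "real \<Rightarrow> ennreal"
  assumes [measurable]: "f \<in> borel_measurable borel" "g \<in> borel_measurable borel" "h \<in> borel_measurable borel"
    and sup: "\<And>r. ennreal r < 1 \<Longrightarrow> \<exists>x. ennreal r < f x" "\<And>r. ennreal r < 1 \<Longrightarrow> \<exists>x. ennreal r < g x"
      "\<And>x. f x \<le> 1" "\<And>x. g x \<le> 1"
    and bd: "bounded {x. f x \<noteq> 0}" "bounded {x. g x \<noteq> 0}"
    and h: "\<And>x y. min (f x) (g y) \<le> h ((x + y) / 2)"
  shows "((\<integral>\<^sup>+x. f x \<partial>lborel) + (\<integral>\<^sup>+x. g x \<partial>lborel)) / 2 \<le> (\<integral>\<^sup>+x. h x \<partial>lborel)"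
proof -
  let ?L = "\<lambda>F r. emeasure lborel {x :: real. ennreal r < F x}"
  have lc: "(\<integral>\<^sup>+x. F x \<partial>lborel) = (\<integral>\<^sup>+r\<in>{0..}. ?L F r \<partial>lborel)"
    if [measurable]: "F \<in> borel_measurable borel" for F :: "real \<Rightarrow> ennreal"
    using nn_integral_layer_cake[of lborel F] lborel.sigma_finite_measure_axioms by simp
  have [measurable]: "?L F \<in> borel_measurable borel"
    if [measurable]: "F \<in> borel_measurable borel" for F :: "real \<Rightarrow> ennreal"
  proof -
    have "(\<lambda>r. \<integral>\<^sup>+x. indicator {z. ennreal (fst z) < F (snd z)} (r, x) \<partial>lborel) \<in> borel_measurable borel"
      by measurable
    also have "(\<lambda>r. \<integral>\<^sup>+x. indicator {z. ennreal (fst z) < F (snd z)} (r, x) \<partial>lborel) = ?L F"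
      by (auto simp: indicator_def nn_integral_indicator[symmetric] intro!: ext nn_integral_cong)
    finally show ?thesis .
  qed
  have pt: "(?L f r + ?L g r) / 2 \<le> ?L h r" if "r \<ge> 0" for r
  proof (cases "ennreal r < 1")
    case True
    show ?thesis
    proof (intro emeasure_midpoints_real)
      show "bounded {x. ennreal r < f x}" "bounded {x. ennreal r < g x}"
        by (rule bounded_subset[OF bd(1)] bounded_subset[OF bd(2)]; auto)+
      show "{x. ennreal r < f x} \<noteq> {}" "{x. ennreal r < g x} \<noteq> {}"
        using sup(1,2)[OF True] by auto
      fix x y assume "x \<in> {x. ennreal r < f x}" "y \<in> {x. ennreal r < g x}"
      then show "(x + y) / 2 \<in> {x. ennreal r < h x}"
        using h[of x y] by (auto simp: min_def split: if_splits)
    qed auto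
  next
    case False
    then have r: "1 \<le> ennreal r" by (simp only: not_less)
    have "f x \<le> ennreal r" for x by (rule order_trans[OF sup(3) r])
    moreover have "g x \<le> ennreal r" for x by (rule order_trans[OF sup(4) r])
    ultimately have "{x. ennreal r < f x} = {}" "{x. ennreal r < g x} = {}"
      by (simp_all add: not_less)
    then show ?thesis by simp
  qed
  have "((\<integral>\<^sup>+x. f x \<partial>lborel) + (\<integral>\<^sup>+x. g x \<partial>lborel)) / 2 =
      (\<integral>\<^sup>+r. (?L f r * indicator {0..} r + ?L g r * indicator {0..} r) / 2 \<partial>lborel)"
    unfolding lc[OF assms(1)] lc[OF assms(2)]
    by (simp add: nn_integral_divide nn_integral_add)
  also have "\<dots> \<le> (\<integral>\<^sup>+r\<in>{0..}. ?L h r \<partial>lborel)"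
    using pt by (intro nn_integral_mono) (auto simp: indicator_def)
  also have "\<dots> = (\<integral>\<^sup>+x. h x \<partial>lborel)" by (rule lc[OF assms(3), symmetric])
  finally show ?thesis .
qed

lemma ennreal_AM_GM:
  fixes a b c :: ennreal
  assumes "(a + b) / 2 \<le> c"
  shows "a * b \<le> c\<^sup>2"
proof (cases "c = top")
  case False
  then have "a \<noteq> top" "b \<noteq> top"
    using assms by (auto simp: top_unique ennreal_top_divide)
  with False obtain x y z where [simp]: "a = ennreal x" "b = ennreal y" "c = ennreal z" and nn: "0 \<le> x" "0 \<le> y" "0 \<le> z"
    by (cases a; cases b; cases c) auto
  have "(x + y) / 2 \<le> z"
    using assms nn by (simp add: ennreal_plus[symmetric] divide_ennreal
          ennreal_numeral[symmetric] del: ennreal_plus ennreal_numeral)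
  then have "((x + y) / 2)\<^sup>2 \<le> z\<^sup>2" using nn by (intro power_mono) auto
  moreover have "x * y \<le> ((x + y) / 2)\<^sup>2"
    using zero_le_power2[of "x - y"] by (simp add: power2_eq_square field_simps)
  ultimately have "x * y \<le> z\<^sup>2" by simp
  then show ?thesis
    using nn by (simp add: ennreal_mult[symmetric] ennreal_power)
qed (simp add: power2_eq_square ennreal_top_mult)

text \<open>
  Dividing \<open>f\<close> and \<open>g\<close> by their suprema, and \<open>h\<close> by the geometric mean of the two, leads to the
  additive form above; the inequality of the arithmetic and the geometric mean then turns it into the
  multiplicative form, in which the normalizing factors cancel.
\<close>
lemma prekopa_leindler_midpoint_real_bounded:
  fixes f g h :: "real \<Rightarrow> ennreal"
  assumes [measurable]: "f \<in> borel_measurable borel" "g \<in> borel_measurable borel" "h \<in> borel_measurable borel"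
    and fin: "\<And>x. f x \<le> ennreal B" "\<And>x. g x \<le> ennreal B"
    and bd: "bounded {x. f x \<noteq> 0}" "bounded {x. g x \<noteq> 0}"
    and h: "\<And>x y. f x * g y \<le> (h ((x + y) / 2))\<^sup>2"
  shows "(\<integral>\<^sup>+x. f x \<partial>lborel) * (\<integral>\<^sup>+x. g x \<partial>lborel) \<le> (\<integral>\<^sup>+x. h x \<partial>lborel)\<^sup>2"
proof (cases "(\<forall>x. f x = 0) \<or> (\<forall>x. g x = 0)")
  case True
  then show ?thesis by (auto)
next
  case False
  define a where "a = (SUP x. f x)"
  define b where "b = (SUP x. g x)"
  have ab: "a \<noteq> 0" "b \<noteq> 0" "a \<noteq> top" "b \<noteq> top"
  proof -
    show "a \<noteq> 0" "b \<noteq> 0" using False by (auto simp: a_def b_def simp flip: bot_ennreal)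
    have "a \<le> ennreal B" "b \<le> ennreal B" using fin by (auto simp: a_def b_def intro: SUP_least)
    then show "a \<noteq> top" "b \<noteq> top" by (auto simp: top_unique)
  qed
  define a' b' where "a' = enn2real a" and "b' = enn2real b"
  have a': "a = ennreal a'" "a' > 0" and b': "b = ennreal b'" "b' > 0"
    using ab by (auto simp: a'_def b'_def enn2real_positive_iff less_top[symmetric] zero_less_iff_neq_zero)
  define c where "c = sqrt (a' * b')"
  have c: "c > 0" "c\<^sup>2 = a' * b'" using a' b' by (auto simp: c_def)
  let ?f = "\<lambda>x. f x / a" and ?g = "\<lambda>x. g x / b" and ?h = "\<lambda>x. h x / c"
  have "((\<integral>\<^sup>+x. ?f x \<partial>lborel) + (\<integral>\<^sup>+x. ?g x \<partial>lborel)) / 2 \<le> (\<integral>\<^sup>+x. ?h x \<partial>lborel)"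
  proof (rule prekopa_leindler_midpoint_unit)
    have ub: "F x / e \<le> 1" if "e = (SUP x. F x)" "e \<noteq> 0" "e \<noteq> top" for F :: "real \<Rightarrow> ennreal" and e x
      using that SUP_upper[of x UNIV F] by (intro divide_le_posI_ennreal) (auto simp: zero_less_iff_neq_zero)
    show "f x / a \<le> 1" "g x / b \<le> 1" for x
      using ub[OF a_def ab(1,3)] ub[OF b_def ab(2,4)] by auto
    have lb: "\<exists>x. ennreal r < F x / ennreal e" if e: "ennreal e = (SUP x. F x)" and "e > 0" "ennreal r < 1" for F :: "real \<Rightarrow> ennreal" and e r
    proof -
      have "ennreal (max r 0) < 1" using that by (auto simp: max_def)
      then have "max r 0 < 1" by (simp add: ennreal_less_one_iff)
      then have "ennreal (max r 0 * e) < ennreal e"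
        using \<open>e > 0\<close> by (intro ennreal_lessI) auto
      then obtain x where x: "ennreal (max r 0 * e) < F x"
        unfolding e less_SUP_iff by auto
      have "ennreal (max r 0) = ennreal (max r 0 * e) / ennreal e"
        using \<open>e > 0\<close> by (subst divide_ennreal) auto
      also have "\<dots> < F x / ennreal e"
        using x \<open>e > 0\<close> by (subst divide_less_ennreal) (auto simp: ennreal_divide_times ennreal_mult_divide_eq)
      finally have "ennreal (max r 0) < F x / ennreal e" .
      moreover have "ennreal r \<le> ennreal (max r 0)" by (rule ennreal_leI) simp
      ultimately show ?thesis by (blast intro: le_less_trans)
    qed
    show "\<exists>x. ennreal r < f x / a" "\<exists>x. ennreal r < g x / b" if "ennreal r < 1" for r
      using that a' b' lb[of a' f r] lb[of b' g r] by (auto simp: a_def b_def)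
    show "bounded {x. f x / a \<noteq> 0}" "bounded {x. g x / b \<noteq> 0}"
      by (rule bounded_subset[OF bd(1)] bounded_subset[OF bd(2)]; auto)+
    fix x y
    show "min (f x / a) (g y / b) \<le> h ((x + y) / 2) / c"
    proof (cases "h ((x + y) / 2)")
      case (real H)
      have "f x \<noteq> top" "g y \<noteq> top" using fin[of x] fin[of y] by (auto simp: top_unique)
      then obtain p q where p: "f x = ennreal p" "p \<ge> 0" and q: "g y = ennreal q" "q \<ge> 0"
        by (cases "f x"; cases "g y") auto
      have pq: "p * q \<le> H\<^sup>2"
        using h[of x y] real p q by (simp add: ennreal_mult[symmetric] ennreal_power)
      have "min (p / a') (q / b') \<le> H / c"
      proof (rule ccontr)
        assume "\<not> ?thesis"
        then have "H / c * (H / c) < p / a' * (q / b')"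
          using c real by (intro mult_strict_mono') auto
        also have "p / a' * (q / b') = p * q / c\<^sup>2" using c by simp
        also have "\<dots> \<le> H\<^sup>2 / c\<^sup>2" using pq by (intro divide_right_mono) auto
        finally show False by (simp add: power2_eq_square)
      qed
      then show ?thesis
        using real p q a' b' c
        by (simp add: divide_ennreal min_def split: if_splits)
    qed (use c in \<open>simp add: ennreal_top_divide\<close>)
  qed auto
  then have gm: "(\<integral>\<^sup>+x. f x \<partial>lborel) / a * ((\<integral>\<^sup>+x. g x \<partial>lborel) / b) \<le> ((\<integral>\<^sup>+x. h x \<partial>lborel) / c)\<^sup>2"
    by (intro ennreal_AM_GM) (simp add: nn_integral_divide)
  have "a * b * ((\<integral>\<^sup>+x. f x \<partial>lborel) / a * ((\<integral>\<^sup>+x. g x \<partial>lborel) / b)) \<le> (ennreal c)\<^sup>2 * ((\<integral>\<^sup>+x. h x \<partial>lborel) / c)\<^sup>2"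
  proof (rule mult_mono)
    show "a * b \<le> (ennreal c)\<^sup>2"
      using a' b' c by (simp add: ennreal_power ennreal_mult[symmetric])
  qed (use gm in auto)
  moreover have canc: "u * (v / u) = v" if "u \<noteq> 0" "u \<noteq> top" for u v :: ennreal
    using that by (simp add: ennreal_times_divide mult.commute[of u] ennreal_mult_divide_eq)
  moreover have "a * b * (u / a * (v / b)) = u * v" for u v
  proof -
    have "a * b * (u / a * (v / b)) = (a * (u / a)) * (b * (v / b))" by (simp only: mult_ac)
    then show ?thesis using ab by (simp add: canc)
  qed
  ultimately show ?thesis
    using c by (simp add: power_mult_distrib[symmetric])
qed

lemma prekopa_leindler_midpoint_real:
  fixes f g h :: "real \<Rightarrow> ennreal"
  assumes [measurable]: "f \<in> borel_measurable borel" "g \<in> borel_measurable borel" "h \<in> borel_measurable borel"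
    and h: "\<And>x y. f x * g y \<le> (h ((x + y) / 2))\<^sup>2"
  shows "(\<integral>\<^sup>+x. f x \<partial>lborel) * (\<integral>\<^sup>+x. g x \<partial>lborel) \<le> (\<integral>\<^sup>+x. h x \<partial>lborel)\<^sup>2"
proof -
  \<comment> \<open>Truncation in height and in range makes the functions bounded with bounded support.\<close>
  let ?T = "\<lambda>F n x. min (F x) (ennreal (real n)) * indicator {- real n..real n} x"
  have T: "(\<integral>\<^sup>+x. F x \<partial>lborel) = (SUP n. \<integral>\<^sup>+x. ?T F n x \<partial>lborel)" and inc: "incseq (\<lambda>n. \<integral>\<^sup>+x. ?T F n x \<partial>lborel)"
    if [measurable]: "F \<in> borel_measurable borel" for F :: "real \<Rightarrow> ennreal"
  proof -
    have incT: "incseq (?T F)"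
      by (auto simp: incseq_def le_fun_def indicator_def min_def intro: order_trans ennreal_leI)
    have "F x = (SUP n. ?T F n x)" for x
    proof (rule antisym)
      obtain m where m: "\<bar>x\<bar> \<le> real m" using real_arch_simple by blast
      have "F x = (SUP n. min (F x) (ennreal (real n)))"
      proof (rule antisym)
        have "(SUP n. min (F x) (ennreal (real n))) = min (F x) (SUP n. ennreal (real n))"
          by (simp add: inf_SUP flip: inf_min)
        also have "(SUP n. ennreal (real n)) = top"
          by (simp add: ennreal_SUP_of_nat_eq_top flip: ennreal_of_nat_eq_real_of_nat)
        finally show "F x \<le> (SUP n. min (F x) (ennreal (real n)))" by simp
      qed (auto intro: SUP_least)
      also have "\<dots> \<le> (SUP n. ?T F n x)"
      proof (rule SUP_mono)
        fix n
        show "\<exists>m\<in>UNIV. min (F x) (ennreal (real n)) \<le> ?T F m x"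
          using m by (intro bexI[of _ "max m n"]) (auto simp: min_def indicator_def intro: order_trans ennreal_leI)
      qed
      finally show "F x \<le> (SUP n. ?T F n x)" .
    qed (auto intro!: SUP_least simp: indicator_def)
    then have "(\<integral>\<^sup>+x. F x \<partial>lborel) = (\<integral>\<^sup>+x. (SUP n. ?T F n x) \<partial>lborel)" by simp
    also have "\<dots> = (SUP n. \<integral>\<^sup>+x. ?T F n x \<partial>lborel)"
      by (rule nn_integral_monotone_convergence_SUP[OF incT]) auto
    finally show "(\<integral>\<^sup>+x. F x \<partial>lborel) = (SUP n. \<integral>\<^sup>+x. ?T F n x \<partial>lborel)" .
    show "incseq (\<lambda>n. \<integral>\<^sup>+x. ?T F n x \<partial>lborel)"
      using incT by (auto simp: incseq_def le_fun_def intro!: nn_integral_mono)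
  qed
  have step: "(\<integral>\<^sup>+x. ?T f n x \<partial>lborel) * (\<integral>\<^sup>+x. ?T g n x \<partial>lborel) \<le> (\<integral>\<^sup>+x. h x \<partial>lborel)\<^sup>2" for n
  proof (rule prekopa_leindler_midpoint_real_bounded)
    show "?T f n x \<le> ennreal (real n)" "?T g n x \<le> ennreal (real n)" for x
      by (auto simp: indicator_def)
    show "bounded {x. ?T f n x \<noteq> 0}" "bounded {x. ?T g n x \<noteq> 0}"
      by (rule bounded_subset[of "{- real n..real n}"]; auto simp: indicator_def)+
    show "?T f n x * ?T g n y \<le> (h ((x + y) / 2))\<^sup>2" for x y
      by (rule order_trans[OF _ h[of x y]]) (auto simp: indicator_def intro!: mult_mono)
  qed auto
  have "(\<integral>\<^sup>+x. ?T f n x \<partial>lborel) * (\<integral>\<^sup>+x. ?T g m x \<partial>lborel) \<le> (\<integral>\<^sup>+x. h x \<partial>lborel)\<^sup>2" for n m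
    by (rule order_trans[OF mult_mono step[of "max n m"]])
      (use incseqD[OF inc[OF assms(1)], of n "max n m"] incseqD[OF inc[OF assms(2)], of m "max n m"] in auto)
  then show ?thesis
    unfolding T[OF assms(1)] T[OF assms(2)]
    by (simp add: SUP_mult_left_ennreal SUP_mult_right_ennreal SUP_least)
qed

text \<open>
  The multiplicative form tensorizes: the integrals over all coordinates but one satisfy, as functions
  of the remaining coordinate, the hypothesis of the one-dimensional inequality.
\<close>
lemma prekopa_leindler_midpoint_PiM:
  fixes f g h :: "('i \<Rightarrow> real) \<Rightarrow> ennreal"
  assumes "finite I"
    and "f \<in> borel_measurable (\<Pi>\<^sub>M i\<in>I. lborel)" "g \<in> borel_measurable (\<Pi>\<^sub>M i\<in>I. lborel)"
      "h \<in> borel_measurable (\<Pi>\<^sub>M i\<in>I. lborel)"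
    and "\<And>x y. x \<in> extensional I \<Longrightarrow> y \<in> extensional I \<Longrightarrow> f x * g y \<le> (h (\<lambda>i\<in>I. (x i + y i) / 2))\<^sup>2"
  shows "(\<integral>\<^sup>+x. f x \<partial>(\<Pi>\<^sub>M i\<in>I. lborel)) * (\<integral>\<^sup>+x. g x \<partial>(\<Pi>\<^sub>M i\<in>I. lborel)) \<le> (\<integral>\<^sup>+x. h x \<partial>(\<Pi>\<^sub>M i\<in>I. lborel))\<^sup>2"
  using assms
proof (induction I arbitrary: f g h)
  case empty
  interpret product_sigma_finite "\<lambda>_. lborel :: real measure" by standard
  have "(\<lambda>i\<in>{}. (x i + y i) / 2) = (\<lambda>k. undefined)" for x y :: "'i \<Rightarrow> real" by auto
  then show ?case using empty.prems(4)[of "\<lambda>k. undefined" "\<lambda>k. undefined"]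
    by (simp add: nn_integral_empty)
next
  case (insert i I)
  interpret product_sigma_finite "\<lambda>_. lborel :: real measure" by standard
  note [measurable] = insert.prems(1-3)
  let ?J = "\<lambda>F a. \<integral>\<^sup>+x. F (x(i := a)) \<partial>(\<Pi>\<^sub>M i\<in>I. lborel)"
  have J: "(\<integral>\<^sup>+x. F x \<partial>(\<Pi>\<^sub>M i\<in>insert i I. lborel)) = (\<integral>\<^sup>+a. ?J F a \<partial>lborel)"
    if "F \<in> borel_measurable (\<Pi>\<^sub>M i\<in>insert i I. lborel)" for F :: "('i \<Rightarrow> real) \<Rightarrow> ennreal"
    by (rule product_nn_integral_insert_rev[OF insert.hyps that])
  have [measurable]: "?J F \<in> borel_measurable borel"
    if [measurable]: "F \<in> borel_measurable (\<Pi>\<^sub>M i\<in>insert i I. lborel)" for F :: "('i \<Rightarrow> real) \<Rightarrow> ennreal"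
  proof -
    interpret I: finite_product_sigma_finite "\<lambda>_. lborel :: real measure" I by standard fact
    have "(\<lambda>z. F ((snd z)(i := fst z))) \<in> borel_measurable (borel \<Otimes>\<^sub>M (\<Pi>\<^sub>M i\<in>I. lborel))"
      by measurable
    then show ?thesis
      by (intro I.borel_measurable_nn_integral) (simp add: split_beta')
  qed
  show ?case
    unfolding J[OF insert.prems(1)] J[OF insert.prems(2)] J[OF insert.prems(3)]
  proof (rule prekopa_leindler_midpoint_real)
    fix a b :: real
    show "?J f a * ?J g b \<le> (?J h ((a + b) / 2))\<^sup>2"
    proof (rule insert.IH)
      fix x y :: "'i \<Rightarrow> real" assume xy: "x \<in> extensional I" "y \<in> extensional I"
      have "f (x(i := a)) * g (y(i := b)) \<le> (h (\<lambda>j\<in>insert i I. ((x(i := a)) j + (y(i := b)) j) / 2))\<^sup>2"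
        using xy by (intro insert.prems) (auto simp: extensional_def)
      also have "(\<lambda>j\<in>insert i I. ((x(i := a)) j + (y(i := b)) j) / 2) = (\<lambda>j\<in>I. (x j + y j) / 2)(i := (a + b) / 2)"
        using insert.hyps by (auto simp: fun_eq_iff)
      finally show "f (x(i := a)) * g (y(i := b)) \<le> (h ((\<lambda>j\<in>I. (x j + y j) / 2)(i := (a + b) / 2)))\<^sup>2" .
    qed (use insert.hyps in measurable)
  qed auto
qed

text \<open>
  The Prekopa-Leindler inequality for indicator functions. This multiplicative form has no
  dimension-dependent exponent; for bodies of equal volume it is as strong as the usual one.
\<close>
theorem brunn_minkowski_midpoint:
  fixes A B C :: "'a::euclidean_space set"
  assumes [measurable]: "A \<in> sets borel" "B \<in> sets borel" "C \<in> sets borel"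
    and sub: "\<And>x y. x \<in> A \<Longrightarrow> y \<in> B \<Longrightarrow> (1/2) *\<^sub>R (x + y) \<in> C"
  shows "emeasure lborel A * emeasure lborel B \<le> (emeasure lborel C)\<^sup>2"
proof -
  let ?M = "\<Pi>\<^sub>M b\<in>(Basis :: 'a set). lborel :: real measure"
  let ?e = "\<lambda>f :: 'a \<Rightarrow> real. \<Sum>b\<in>Basis. f b *\<^sub>R b"
  have e: "emeasure lborel S = (\<integral>\<^sup>+f. indicator S (?e f) \<partial>?M)" if [measurable]: "S \<in> sets borel" for S :: "'a set"
  proof -
    have "emeasure lborel S = (\<integral>\<^sup>+x. indicator S x \<partial>lborel)" by simp
    also have "\<dots> = (\<integral>\<^sup>+f. indicator S (?e f) \<partial>?M)"
      by (subst lborel_eq, subst nn_integral_distr) auto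
    finally show ?thesis .
  qed
  show ?thesis
    unfolding e[OF assms(1)] e[OF assms(2)] e[OF assms(3)]
  proof (rule prekopa_leindler_midpoint_PiM)
    fix x y :: "'a \<Rightarrow> real"
    have "?e (\<lambda>i\<in>Basis. (x i + y i) / 2) = (\<Sum>b\<in>Basis. ((x b + y b) / 2) *\<^sub>R b)"
      by (intro sum.cong) auto
    also have "\<dots> = (1/2) *\<^sub>R (?e x + ?e y)"
      by (simp add: scaleR_sum_right scaleR_add_left[symmetric] sum.distrib[symmetric] del: scaleR_add_left)
    finally show "indicator A (?e x) * indicator B (?e y) \<le> (indicator C (?e (\<lambda>i\<in>Basis. (x i + y i) / 2)) :: ennreal)\<^sup>2"
      using sub by (auto simp: indicator_def)
  qed auto
qed

section \<open>Equality in the Brunn-Minkowski inequality\<close>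

text \<open>
  Along a geometric progression \<open>x\<^sub>0 = a, x\<^sub>1, ..., x\<^sub>m = b\<close> the exchange hypothesis, applied to the
  middle of three consecutive terms, bounds an increment of \<open>Z\<close> by the next increment of \<open>W\<close>. The sum
  telescopes, and the ratio of the progression tends to \<open>1\<close> as \<open>m\<close> grows.
\<close>
lemma multiplicative_exchange_increments:
  fixes W Z :: "real \<Rightarrow> real"
  assumes cont: "continuous_on {0..V} W"
    and ex: "\<And>p p1 p2. p \<in> {0<..V} \<Longrightarrow> p1 \<in> {0<..V} \<Longrightarrow> p2 \<in> {0<..V} \<Longrightarrow> p1 * p2 = p\<^sup>2 \<Longrightarrow> W p + Z p \<le> W p1 + Z p2"
    and ab: "0 < a" "a \<le> b" "b < V"
  shows "Z b - Z a \<le> W b - W a"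
proof -
  define \<rho> where "\<rho> m = (b / a) powr (1 / real m)" for m :: nat
  have rho: "\<rho> \<longlonglongrightarrow> 1"
  proof -
    have "(\<lambda>m. (b / a) powr (1 / real m)) \<longlonglongrightarrow> (b / a) powr 0"
      using ab by (intro tendsto_intros lim_const_over_n) auto
    then show ?thesis using ab by (simp add: \<rho>_def[abs_def])
  qed
  have rho1: "\<rho> m \<ge> 1" for m
    using ab by (auto simp: \<rho>_def intro!: ge_one_powr_ge_zero)
  have ev: "\<forall>\<^sub>F m in sequentially. Z b - Z a \<le> W (b * \<rho> m) - W (a * \<rho> m)"
  proof -
    have "(\<lambda>m. b * \<rho> m) \<longlonglongrightarrow> b * 1" by (intro tendsto_intros rho)
    then have "\<forall>\<^sub>F m in sequentially. b * \<rho> m < V"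
      using ab by (intro order_tendstoD) auto
    then show ?thesis
      using eventually_gt_at_top[of 0]
    proof eventually_elim
      case (elim m)
      define x where "x i = a * \<rho> m ^ i" for i
      have "\<rho> m ^ m = b / a"
        using elim ab by (simp add: \<rho>_def powr_power)
      \<comment> \<open>one term beyond \<open>b\<close>, because increments of \<open>W\<close> are shifted by one index\<close>
      then have xm: "x m = b" "x (Suc m) = b * \<rho> m" "x 0 = a" "x 1 = a * \<rho> m"
        using ab by (auto simp: x_def field_simps)
      have xV: "x i \<in> {0<..V}" if "i \<le> Suc m" for i
      proof -
        have "x i \<le> x (Suc m)"
          using that rho1[of m] ab unfolding x_def by (intro mult_left_mono power_increasing) auto
        moreover have "x i > 0" using ab rho1[of m] by (auto simp: x_def)
        ultimately show ?thesis using elim xm by auto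
      qed
      have "Z (x (Suc i)) - Z (x i) \<le> W (x (Suc (Suc i))) - W (x (Suc i))" if "i < m" for i
        using ex[of "x (Suc i)" "x (Suc (Suc i))" "x i"] xV[of i] xV[of "Suc i"] xV[of "Suc (Suc i)"] that
        by (simp add: x_def power2_eq_square mult_ac)
      then have "(\<Sum>i<m. Z (x (Suc i)) - Z (x i)) \<le> (\<Sum>i<m. W (x (Suc (Suc i))) - W (x (Suc i)))"
        by (intro sum_mono) auto
      also have "(\<Sum>i<m. Z (x (Suc i)) - Z (x i)) = Z (x m) - Z (x 0)"
        by (rule sum_lessThan_telescope)
      also have "(\<Sum>i<m. W (x (Suc (Suc i))) - W (x (Suc i))) = W (x (Suc m)) - W (x (Suc 0))"
        by (rule sum_lessThan_telescope[of "\<lambda>i. W (x (Suc i))"])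
      finally show ?case using xm by simp
    qed
  qed
  have lim: "(\<lambda>m. W (c * \<rho> m)) \<longlonglongrightarrow> W c" if "0 < c" "c < V" for c
  proof -
    have "isCont W c"
      using cont that by (intro continuous_on_interior[of "{0..V}"]) auto
    moreover have "(\<lambda>m. c * \<rho> m) \<longlonglongrightarrow> c * 1" by (intro tendsto_intros rho)
    ultimately show ?thesis using isCont_tendsto_compose[of c W] by simp
  qed
  have "(\<lambda>m. W (b * \<rho> m) - W (a * \<rho> m)) \<longlonglongrightarrow> W b - W a"
    using ab by (intro tendsto_diff lim) auto
  then show ?thesis
    by (rule tendsto_lowerbound[OF _ ev]) simp
qed

lemma AE_lborel_not_in_hyperplane:
  fixes u :: "'a::euclidean_space"
  assumes "u \<noteq> 0"
  shows "AE y in lborel. u \<bullet> y \<noteq> s"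
proof (rule AE_I')
  have "negligible {y. u \<bullet> y = s}" using assms by (intro negligible_hyperplane) auto
  then have "{y. u \<bullet> y = s} \<in> null_sets lebesgue" by (simp add: negligible_iff_null_sets)
  moreover have "closed {y. u \<bullet> y = s}" by (rule closed_hyperplane)
  ultimately show "{y. u \<bullet> y = s} \<in> null_sets lborel"
    by (simp add: null_sets_completion_iff borel_closed)
qed auto

definition cap_volume :: "'a::euclidean_space \<Rightarrow> 'a set \<Rightarrow> real \<Rightarrow> real" where
  "cap_volume u K s = measure lborel (K \<inter> {y. u \<bullet> y \<le> s})"

lemma emeasure_compact_subset:
  fixes K :: "'a::euclidean_space set"
  assumes "compact K" "S \<subseteq> K" "S \<in> sets borel"
  shows "emeasure lborel S = ennreal (measure lborel S)"
proof -
  have "bounded S" using assms compact_imp_bounded bounded_subset by blast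
  from emeasure_bounded_finite[OF this] show ?thesis
    by (intro emeasure_eq_ennreal_measure) (auto simp: less_top)
qed

lemma measure_mono_compact:
  fixes K :: "'a::euclidean_space set"
  assumes "compact K" "T \<subseteq> K" "T \<in> sets borel" "S \<subseteq> T" "S \<in> sets borel"
  shows "measure lborel S \<le> measure lborel T"
proof -
  have "T \<in> fmeasurable lborel"
    using assms emeasure_compact_subset[OF assms(1-3)] by (intro fmeasurableI) auto
  then show ?thesis using assms by (intro measure_mono_fmeasurable) auto
qed

lemma measure_halfspace_split:
  fixes K :: "'a::euclidean_space set"
  assumes K: "compact K" and u: "u \<noteq> 0"
  shows "measure lborel (K \<inter> {y. u \<bullet> y \<ge> s}) = measure lborel K - cap_volume u K s"
    and "measure lborel (K \<inter> {y. u \<bullet> y < s}) = cap_volume u K s"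
proof -
  have [measurable]: "K \<in> sets borel" using K by (rule borel_compact)
  have eq: "measure lborel (K \<inter> {y. u \<bullet> y < s}) = cap_volume u K s"
    unfolding cap_volume_def
    by (rule measure_eq_AE) (use AE_lborel_not_in_hyperplane[OF u, of s] in \<open>auto elim!: eventually_mono\<close>)
  then show "measure lborel (K \<inter> {y. u \<bullet> y < s}) = cap_volume u K s" .
  have "measure lborel K = measure lborel ((K \<inter> {y. u \<bullet> y < s}) \<union> (K \<inter> {y. u \<bullet> y \<ge> s}))"
    by (rule arg_cong[where f = "measure lborel"]) auto
  also have "\<dots> = measure lborel (K \<inter> {y. u \<bullet> y < s}) + measure lborel (K \<inter> {y. u \<bullet> y \<ge> s})"
    using emeasure_compact_subset[OF K, of "K \<inter> {y. u \<bullet> y < s}"] emeasure_compact_subset[OF K, of "K \<inter> {y. u \<bullet> y \<ge> s}"]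
    by (intro measure_Union) auto
  finally show "measure lborel (K \<inter> {y. u \<bullet> y \<ge> s}) = measure lborel K - cap_volume u K s"
    using eq by simp
qed

text \<open>
  If \<open>K\<close> reaches into the open slab \<open>a < u \<bullet> z < b\<close>, then so does its interior, since a convex body is
  the closure of its interior; the slab therefore contributes positive volume.
\<close>
lemma cap_volume_strict:
  fixes K :: "'a::euclidean_space set"
  assumes K: "compact K" "convex K" "interior K \<noteq> {}" and y: "y \<in> K" "a < u \<bullet> y" "u \<bullet> y < b"
  shows "cap_volume u K a < cap_volume u K b"
proof -
  have [measurable]: "K \<in> sets borel" using K by (intro borel_compact)
  let ?S = "{z. a < u \<bullet> z} \<inter> {z. u \<bullet> z < b}"
  have "open ?S" by (intro open_Int open_halfspace_lt open_halfspace_gt)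
  have "y \<in> closure (interior K)"
    using K y convex_closure_interior[of K] closure_subset by blast
  then have ne: "?S \<inter> interior K \<noteq> {}"
    using y open_Int_closure_eq_empty[OF \<open>open ?S\<close>, of "interior K"] by blast
  have op: "open (?S \<inter> interior K)" using \<open>open ?S\<close> by auto
  have ms: "?S \<inter> interior K \<subseteq> K" using interior_subset by auto
  have "\<not> negligible (?S \<inter> interior K)" using op ne open_not_negligible by blast
  moreover have "measure lborel (?S \<inter> interior K) = measure lebesgue (?S \<inter> interior K)"
    using op by (simp add: measure_completion)
  moreover have "?S \<inter> interior K \<in> lmeasurable"
    using op ms compact_imp_bounded[OF K(1)] by (intro lmeasurable_open) (auto intro: bounded_subset)
  ultimately have pos: "measure lborel (?S \<inter> interior K) > 0"
    using negligible_iff_measure0 measure_nonneg by (metis less_eq_real_def)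
  have [measurable]: "?S \<inter> interior K \<in> sets borel" using op by auto
  have "cap_volume u K a + measure lborel (?S \<inter> interior K) = measure lborel ((K \<inter> {y. u \<bullet> y \<le> a}) \<union> (?S \<inter> interior K))"
    unfolding cap_volume_def
    using emeasure_compact_subset[OF K(1), of "K \<inter> {y. u \<bullet> y \<le> a}"] emeasure_compact_subset[OF K(1) ms]
    by (intro measure_Union[symmetric]) auto
  also have "\<dots> \<le> cap_volume u K b"
    unfolding cap_volume_def using y interior_subset[of K]
    by (intro measure_mono_compact[OF K(1)]) auto
  finally show ?thesis using pos by simp
qed

lemma continuous_cap_volume:
  fixes K :: "'a::euclidean_space set"
  assumes K: "compact K" and u: "u \<noteq> 0"
  shows "continuous_on UNIV (cap_volume u K)"
proof -
  have [measurable]: "K \<in> sets borel" using K by (rule borel_compact)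
  have eq: "cap_volume u K = (\<lambda>s. LINT y|lborel. indicator (K \<inter> {y. u \<bullet> y \<le> s}) y)"
    by (simp add: cap_volume_def fun_eq_iff)
  have "(\<lambda>n. cap_volume u K (x n)) \<longlonglongrightarrow> cap_volume u K s" if x: "x \<longlonglongrightarrow> s" for x s
    unfolding eq
  proof (rule integral_dominated_convergence[where w = "indicator K"])
    show "integrable lborel (indicator K :: 'a \<Rightarrow> real)"
      using emeasure_compact_subset[OF K, of K] by (intro integrable_real_indicator) auto
    show "AE y in lborel. (\<lambda>n. indicator (K \<inter> {y. u \<bullet> y \<le> x n}) y :: real) \<longlonglongrightarrow> indicator (K \<inter> {y. u \<bullet> y \<le> s}) y"
      using AE_lborel_not_in_hyperplane[OF u, of s]
    proof eventually_elim
      case (elim y)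
      have "\<forall>\<^sub>F n in sequentially. (u \<bullet> y \<le> x n) = (u \<bullet> y \<le> s)"
      proof (cases "u \<bullet> y < s")
        case True
        then show ?thesis using order_tendstoD(1)[OF x True] by (auto elim: eventually_mono)
      next
        case False
        then have "s < u \<bullet> y" using elim by auto
        then show ?thesis using order_tendstoD(2)[OF x \<open>s < u \<bullet> y\<close>] False by (auto elim: eventually_mono)
      qed
      then show ?case
        by (intro tendsto_eventually) (auto elim!: eventually_mono simp: indicator_def)
    qed
  qed (auto simp: indicator_def)
  then show ?thesis
    by (auto simp: continuous_on_sequentially o_def)
qed

text \<open>
  As a function of the height, the volume of a cap increases strictly and continuously from \<open>0\<close> to the
  volume of \<open>K\<close>. Its inverse \<open>W\<close> is the quantile function of the volume distribution of \<open>K\<close> in the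
  direction \<open>u\<close>.
\<close>
lemma cap_volume_inverse:
  fixes K :: "'a::euclidean_space set"
  assumes K: "compact K" "convex K" "interior K \<noteq> {}" and u: "u \<noteq> 0"
  obtains W m h where "m \<le> h" "(\<bullet>) u ` K = {m..h}" "continuous_on {0..measure lborel K} W"
    "\<And>p. p \<in> {0..measure lborel K} \<Longrightarrow> W p \<in> {m..h} \<and> cap_volume u K (W p) = p"
    "\<And>s. s \<in> {m..h} \<Longrightarrow> cap_volume u K s \<in> {0..measure lborel K} \<and> W (cap_volume u K s) = s"
    "\<And>s. s \<le> m \<Longrightarrow> cap_volume u K s = 0" "\<And>s. s \<ge> h \<Longrightarrow> cap_volume u K s = measure lborel K"
proof -
  let ?c = "cap_volume u K" and ?V = "measure lborel K"
  have [measurable]: "K \<in> sets borel" using K by (intro borel_compact)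
  have ne: "K \<noteq> {}" using K interior_subset by auto
  have "compact ((\<bullet>) u ` K)" using K by (intro compact_continuous_image continuous_intros)
  moreover have "connected ((\<bullet>) u ` K)"
    using K convex_connected by (intro connected_continuous_image continuous_intros) auto
  ultimately obtain m h where mh: "(\<bullet>) u ` K = {m..h}"
    using connected_compact_interval_1[of "(\<bullet>) u ` K"] by auto
  have "m \<le> h" using mh ne by auto
  have range: "m \<le> u \<bullet> y" "u \<bullet> y \<le> h" if "y \<in> K" for y
    using mh that by (metis atLeastAtMost_iff imageI)+
  have low: "?c s = 0" if "s \<le> m" for s
  proof -
    have "?c s = measure lborel (K \<inter> {y. u \<bullet> y < s})" using measure_halfspace_split(2)[OF K(1) u] by simp
    also have "K \<inter> {y. u \<bullet> y < s} = {}" using range that by force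
    finally show ?thesis by simp
  qed
  have high: "?c s = ?V" if "s \<ge> h" for s
  proof -
    have "K \<inter> {y. u \<bullet> y \<le> s} = K" using range that by force
    then show ?thesis by (simp add: cap_volume_def)
  qed
  have strict: "?c s < ?c s'" if "m \<le> s" "s < s'" "s' \<le> h" for s s'
  proof -
    have "(s + s') / 2 \<in> {m..h}" using that by auto
    then obtain y where "y \<in> K" "u \<bullet> y = (s + s') / 2" using mh by (metis imageE)
    then show ?thesis using that by (intro cap_volume_strict[OF K, of y]) auto
  qed
  have inj: "inj_on ?c {m..h}"
    using strict by (intro linorder_inj_onI) fastforce+
  have im: "?c ` {m..h} = {0..?V}"
  proof
    show "?c ` {m..h} \<subseteq> {0..?V}"
      using measure_mono_compact[OF K(1), of K] by (auto simp: cap_volume_def)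
    have "\<exists>s\<ge>m. s \<le> h \<and> ?c s = p" if "p \<in> {0..?V}" for p
      using that low[of m] high[of h] \<open>m \<le> h\<close> continuous_on_subset[OF continuous_cap_volume[OF K(1) u]]
      by (intro IVT') auto
    then show "{0..?V} \<subseteq> ?c ` {m..h}" by force
  qed
  define W where "W = inv_into {m..h} ?c"
  show thesis
  proof (rule that[OF \<open>m \<le> h\<close> mh, of W])
    have "continuous_on (?c ` {m..h}) W"
      using inj continuous_on_subset[OF continuous_cap_volume[OF K(1) u]]
      by (intro continuous_on_inv) (auto simp: W_def)
    then show "continuous_on {0..?V} W" by (simp add: im)
    show "W p \<in> {m..h} \<and> ?c (W p) = p" if "p \<in> {0..?V}" for p
      using that im unfolding W_def by (metis f_inv_into_f inv_into_into)
    show "?c s \<in> {0..?V} \<and> W (?c s) = s" if "s \<in> {m..h}" for s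
      using that im inj by (auto simp: W_def)
  qed (use low high in auto)
qed

text \<open>
  Integrating the distance \<open>h - u \<bullet> y\<close> to a supporting hyperplane over \<open>K\<close> by layers. The left-hand side
  contains the centroid of \<open>K\<close>, so the centroid is determined by the volumes of the caps.
\<close>
lemma integral_cap_volume:
  fixes K :: "'a::euclidean_space set"
  assumes K: "compact K" and u: "u \<noteq> 0" and h: "\<And>y. y \<in> K \<Longrightarrow> u \<bullet> y \<le> h"
  shows "ennreal (h * measure lborel K - u \<bullet> (LINT y:K|lborel. y)) =
    (\<integral>\<^sup>+r\<in>{0..}. ennreal (cap_volume u K (h - r)) \<partial>lborel)"
proof -
  have [measurable]: "K \<in> sets borel" using K by (intro borel_compact)
  have int: "integrable lborel (\<lambda>y. indicator K y *\<^sub>R y)"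
    by (intro borel_integrable_compact K continuous_intros)
  have intc: "integrable lborel (\<lambda>y. indicator K y *\<^sub>R h)"
    by (intro borel_integrable_compact K continuous_intros)
  have "(\<integral>\<^sup>+y. ennreal ((h - u \<bullet> y) * indicator K y) \<partial>lborel) = ennreal (LINT y|lborel. (h - u \<bullet> y) * indicator K y)"
  proof (rule nn_integral_eq_integral)
    have "integrable lborel (\<lambda>y. indicator K y *\<^sub>R (h - u \<bullet> y))"
      by (intro borel_integrable_compact K continuous_intros)
    then show "integrable lborel (\<lambda>y. (h - u \<bullet> y) * indicator K y)" by (simp add: mult.commute)
  qed (use h in \<open>auto simp: indicator_def\<close>)
  also have "(LINT y|lborel. (h - u \<bullet> y) * indicator K y) = (LINT y|lborel. indicator K y *\<^sub>R h - u \<bullet> (indicator K y *\<^sub>R y))"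
    by (intro Bochner_Integration.integral_cong) (auto simp: algebra_simps)
  also have "\<dots> = (LINT y|lborel. indicator K y *\<^sub>R h) - (LINT y|lborel. u \<bullet> (indicator K y *\<^sub>R y))"
    by (intro Bochner_Integration.integral_diff integrable_inner_right int intc)
  also have "\<dots> = h * measure lborel K - u \<bullet> (LINT y:K|lborel. y)"
  proof -
    have "(LINT y|lborel. u \<bullet> (indicator K y *\<^sub>R y)) = u \<bullet> (LINT y|lborel. indicator K y *\<^sub>R y)"
      using int by (intro integral_inner_right)
    then show ?thesis by (simp add: set_lebesgue_integral_def)
  qed
  finally have "ennreal (h * measure lborel K - u \<bullet> (LINT y:K|lborel. y)) =
      (\<integral>\<^sup>+y. ennreal ((h - u \<bullet> y) * indicator K y) \<partial>lborel)" by simp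
  also have "\<dots> = (\<integral>\<^sup>+r\<in>{0..}. emeasure lborel {y \<in> space lborel. ennreal r < ennreal ((h - u \<bullet> y) * indicator K y)} \<partial>lborel)"
    by (rule nn_integral_layer_cake) (auto intro: lborel.sigma_finite_measure_axioms)
  also have "\<dots> = (\<integral>\<^sup>+r\<in>{0..}. ennreal (cap_volume u K (h - r)) \<partial>lborel)"
  proof (intro nn_integral_cong)
    fix r :: real
    have "{y \<in> space lborel. ennreal r < ennreal ((h - u \<bullet> y) * indicator K y)} = K \<inter> {y. u \<bullet> y < h - r}" if "r \<ge> 0"
      using that by (auto simp: ennreal_less_iff indicator_def split: if_splits)
    moreover have "emeasure lborel (K \<inter> {y. u \<bullet> y < h - r}) = ennreal (cap_volume u K (h - r))"
      using emeasure_compact_subset[OF K, of "K \<inter> {y. u \<bullet> y < h - r}"] measure_halfspace_split(2)[OF K u] by simp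
    ultimately show "emeasure lborel {y \<in> space lborel. ennreal r < ennreal ((h - u \<bullet> y) * indicator K y)} * indicator {0..} r =
        ennreal (cap_volume u K (h - r)) * indicator {0..} r"
      by (cases "r \<ge> 0") auto
  qed
  finally show ?thesis .
qed

text \<open>
  Convex bodies of equal volume whose midpoint set has no larger volume are translates of each other.
  Fix a direction \<open>u\<close> and let \<open>W p\<close> and \<open>Z p\<close> be the heights of the caps of volume \<open>p\<close> of \<open>K\<close> and \<open>L\<close>.
  Brunn-Minkowski for caps bounds the volume of the cap of \<open>M\<close> at height \<open>(W p1 + Z p2) / 2\<close> from below
  by the geometric mean of \<open>p1\<close> and \<open>p2\<close>; applied to the complementary caps, it bounds the one at height
  \<open>(W p + Z p) / 2\<close> from above by \<open>p\<close>. Hence \<open>W p + Z p \<le> W p1 + Z p2\<close> whenever \<open>p1 * p2 = p\<^sup>2\<close>, which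
  forces \<open>W - Z\<close> to be constant. So the caps of \<open>K\<close> and \<open>L\<close> agree up to a shift of the height, and the
  size of this shift is the difference of the support functions at \<open>u\<close> as well as that of the heights of
  the centroids. The latter is linear in \<open>u\<close>.
\<close>
theorem brunn_minkowski_midpoint_equality:
  fixes K L :: "'a::euclidean_space set"
  assumes K: "compact K" "convex K" "interior K \<noteq> {}"
    and L: "compact L" "convex L" "interior L \<noteq> {}"
    and V: "measure lborel K = V" "measure lborel L = V"
    and M: "measure lborel ((\<lambda>(x, y). (1/2) *\<^sub>R (x + y)) ` (K \<times> L)) \<le> V"
  shows "\<exists>w. \<forall>u. (SUP y\<in>K. u \<bullet> y) - (SUP y\<in>L. u \<bullet> y) = u \<bullet> w"
proof (intro exI allI)
  fix u
  let ?w = "(1 / V) *\<^sub>R ((LINT y:K|lborel. y) - (LINT y:L|lborel. y))"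
  show "(SUP y\<in>K. u \<bullet> y) - (SUP y\<in>L. u \<bullet> y) = u \<bullet> ?w"
  proof (cases "u = 0")
    case True
    then show ?thesis using K L interior_subset by (auto simp: image_constant_conv)
  next
    case u: False
    define M where "M = (\<lambda>(x, y). (1/2) *\<^sub>R (x + y)) ` (K \<times> L)"
    have MV: "measure lborel M \<le> V" using M by (simp add: M_def)
    have M_mem: "(1/2) *\<^sub>R (x + y) \<in> M" if "x \<in> K" "y \<in> L" for x y
      using that by (force simp: M_def)
    have M_compact: "compact M"
      unfolding M_def split_beta' by (intro compact_continuous_image compact_Times K L continuous_intros)
    have M_convex: "convex M"
    proof -
      have "linear (\<lambda>z :: 'a \<times> 'a. (1/2) *\<^sub>R (fst z + snd z))"
        by (intro linearI) (auto simp: algebra_simps)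
      then show ?thesis unfolding M_def split_beta' by (intro convex_linear_image convex_Times K L)
    qed
    have M_int: "interior M \<noteq> {}"
    proof -
      obtain y where y: "y \<in> L" using L interior_subset by blast
      have "open ((\<lambda>x. (1/2) *\<^sub>R y + (1/2) *\<^sub>R x) ` interior K)"
        by (intro open_affinity open_interior) auto
      moreover have "(\<lambda>x. (1/2) *\<^sub>R y + (1/2) *\<^sub>R x) ` interior K \<subseteq> M"
        using M_mem[OF _ y] interior_subset[of K] by (force simp: algebra_simps)
      ultimately have "(\<lambda>x. (1/2) *\<^sub>R y + (1/2) *\<^sub>R x) ` interior K \<subseteq> interior M" by (rule interior_maximal[rotated])
      then show ?thesis using K by auto
    qed
    have [measurable]: "K \<in> sets borel" "L \<in> sets borel" "M \<in> sets borel"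
      using K L M_compact by (auto intro: borel_compact)
    have bm: "measure lborel A * measure lborel B \<le> (measure lborel C)\<^sup>2"
      if [measurable]: "A \<in> sets borel" "B \<in> sets borel" "C \<in> sets borel" and "A \<subseteq> K" "B \<subseteq> L" "C \<subseteq> M"
        and "\<And>x y. x \<in> A \<Longrightarrow> y \<in> B \<Longrightarrow> (1/2) *\<^sub>R (x + y) \<in> C" for A B C
    proof -
      have "emeasure lborel A * emeasure lborel B \<le> (emeasure lborel C)\<^sup>2"
        by (rule brunn_minkowski_midpoint) (use that in auto)
      then show ?thesis
        using that by (simp add: emeasure_compact_subset[OF K(1)] emeasure_compact_subset[OF L(1)]
            emeasure_compact_subset[OF M_compact] ennreal_mult[symmetric] ennreal_power)
    qed
    obtain W mK hK where W: "mK \<le> hK" "(\<bullet>) u ` K = {mK..hK}" "continuous_on {0..V} W"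
      "\<And>p. p \<in> {0..V} \<Longrightarrow> W p \<in> {mK..hK} \<and> cap_volume u K (W p) = p"
      "\<And>s. s \<in> {mK..hK} \<Longrightarrow> cap_volume u K s \<in> {0..V} \<and> W (cap_volume u K s) = s"
      "\<And>s. s \<le> mK \<Longrightarrow> cap_volume u K s = 0" "\<And>s. s \<ge> hK \<Longrightarrow> cap_volume u K s = V"
      by (rule cap_volume_inverse[OF K u, unfolded V]) (rule that)
    obtain Z mL hL where Z: "mL \<le> hL" "(\<bullet>) u ` L = {mL..hL}" "continuous_on {0..V} Z"
      "\<And>p. p \<in> {0..V} \<Longrightarrow> Z p \<in> {mL..hL} \<and> cap_volume u L (Z p) = p"
      "\<And>s. s \<in> {mL..hL} \<Longrightarrow> cap_volume u L s \<in> {0..V} \<and> Z (cap_volume u L s) = s"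
      "\<And>s. s \<le> mL \<Longrightarrow> cap_volume u L s = 0" "\<And>s. s \<ge> hL \<Longrightarrow> cap_volume u L s = V"
      by (rule cap_volume_inverse[OF L u, unfolded V]) (rule that)
    have Vpos: "V > 0"
    proof -
      have "mK < hK"
      proof (rule ccontr)
        assume "\<not> ?thesis"
        then have "(\<bullet>) u ` K \<subseteq> {mK}" using W(2) by auto
        then have eq: "u \<bullet> y = mK" if "y \<in> K" for y using that by blast
        have "K \<subseteq> {y. u \<bullet> y = mK}" using eq by auto
        then have "interior K \<subseteq> interior {y. u \<bullet> y = mK}" by (rule interior_mono)
        then show False using K u by (simp add: interior_hyperplane)
      qed
      then have "(mK + hK) / 2 \<in> (\<bullet>) u ` K" using W(2) by auto
      then obtain y where "y \<in> K" "u \<bullet> y = (mK + hK) / 2" by auto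
      then have "cap_volume u K mK < cap_volume u K hK"
        using \<open>mK < hK\<close> by (intro cap_volume_strict[OF K, of y]) auto
      then show ?thesis using W(6)[of mK] W(7)[of hK] by simp
    qed
    have low: "p1 * p2 \<le> (cap_volume u M ((W p1 + Z p2) / 2))\<^sup>2" if p: "p1 \<in> {0..V}" "p2 \<in> {0..V}" for p1 p2
    proof -
      have "cap_volume u K (W p1) * cap_volume u L (Z p2) \<le> (cap_volume u M ((W p1 + Z p2) / 2))\<^sup>2"
        unfolding cap_volume_def by (rule bm) (auto simp: M_mem inner_add_right)
      then show ?thesis using W(4)[OF p(1)] Z(4)[OF p(2)] by simp
    qed
    have high: "cap_volume u M ((W p + Z p) / 2) \<le> p" if p: "p \<in> {0..V}" for p
    proof -
      let ?s = "(W p + Z p) / 2"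
      have "measure lborel (K \<inter> {y. u \<bullet> y \<ge> W p}) * measure lborel (L \<inter> {y. u \<bullet> y \<ge> Z p}) \<le>
          (measure lborel (M \<inter> {y. u \<bullet> y \<ge> ?s}))\<^sup>2"
        by (rule bm) (auto simp: M_mem inner_add_right)
      then have "(V - p)\<^sup>2 \<le> (measure lborel M - cap_volume u M ?s)\<^sup>2"
        unfolding measure_halfspace_split[OF K(1) u] measure_halfspace_split[OF L(1) u]
          measure_halfspace_split[OF M_compact u]
        using W(4)[OF p] Z(4)[OF p] V by (simp add: power2_eq_square)
      moreover have "measure lborel M - cap_volume u M ?s \<ge> 0"
        using measure_mono_compact[OF M_compact, of M "M \<inter> {y. u \<bullet> y \<le> ?s}"] by (simp add: cap_volume_def)
      ultimately have "V - p \<le> measure lborel M - cap_volume u M ?s"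
        by (rule power2_le_imp_le)
      then show ?thesis using MV by simp
    qed
    have range: "(W p1 + Z p2) / 2 \<in> (\<bullet>) u ` M" if p: "p1 \<in> {0..V}" "p2 \<in> {0..V}" for p1 p2
    proof -
      obtain x y where xy: "x \<in> K" "y \<in> L" "u \<bullet> x = W p1" "u \<bullet> y = Z p2"
        using W(2,4) Z(2,4) p by (metis imageE)
      then show ?thesis
        using M_mem[OF xy(1,2)] by (intro image_eqI[of _ _ "(1/2) *\<^sub>R (x + y)"]) (auto simp: inner_add_right)
    qed
    have exch: "W p + Z p \<le> W p1 + Z p2"
      if p: "p \<in> {0<..V}" "p1 \<in> {0<..V}" "p2 \<in> {0<..V}" "p1 * p2 = p\<^sup>2" for p p1 p2
    proof (rule ccontr)
      assume less: "\<not> ?thesis"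
      let ?a = "(W p1 + Z p2) / 2" and ?b = "(W p + Z p) / 2"
      have "p\<^sup>2 \<le> (cap_volume u M ?a)\<^sup>2" using low[of p1 p2] p by auto
      then have "p \<le> cap_volume u M ?a"
        by (rule power2_le_imp_le) (simp add: cap_volume_def)
      moreover have "cap_volume u M ?b \<le> p" using p by (intro high) auto
      moreover have "cap_volume u M ?a < cap_volume u M ?b"
      proof -
        have "convex ((\<bullet>) u ` M)" using M_convex by (intro convex_linear_image linearI) (auto simp: inner_add_right)
        moreover have "?a \<in> (\<bullet>) u ` M" "?b \<in> (\<bullet>) u ` M" using p by (intro range; auto)+
        ultimately have "(1/2) *\<^sub>R ?a + (1/2) *\<^sub>R ?b \<in> (\<bullet>) u ` M" by (intro convexD) auto
        then obtain y where y: "y \<in> M" "u \<bullet> y = (1/2) *\<^sub>R ?a + (1/2) *\<^sub>R ?b" by auto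
        show ?thesis by (rule cap_volume_strict[OF M_compact M_convex M_int y(1)]) (use y(2) less in \<open>auto simp: field_simps\<close>)
      qed
      ultimately show False by simp
    qed
    have const1: "W b - Z b = W a - Z a" if "0 < a" "a \<le> b" "b < V" for a b
    proof -
      have "Z b - Z a \<le> W b - W a"
        using exch that by (intro multiplicative_exchange_increments[OF W(3)]) auto
      moreover have "W b - W a \<le> Z b - Z a"
      proof (rule multiplicative_exchange_increments[OF Z(3) _ that])
        fix p p1 p2 assume "p \<in> {0<..V}" "p1 \<in> {0<..V}" "p2 \<in> {0<..V}" "p1 * p2 = p\<^sup>2"
        then show "Z p + W p \<le> Z p1 + W p2" using exch[of p p2 p1] by (simp add: mult.commute)
      qed
      ultimately show ?thesis by simp
    qed
    \<comment> \<open>the shift of the heights; that it has the form \<open>u \<bullet> w\<close> is the last step\<close>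
    define D where "D = W (V/2) - Z (V/2)"
    have const: "W p - Z p = D" if "p \<in> {0..V}" for p
    proof -
      have "continuous_on (closure {0<..<V}) (\<lambda>p. W p - Z p)"
        using W(3) Z(3) Vpos by (auto intro!: continuous_intros)
      moreover have "W p - Z p = D" if "p \<in> {0<..<V}" for p
        using const1[of p "V/2"] const1[of "V/2" p] that Vpos by (cases "p \<le> V/2") (auto simp: D_def)
      moreover have "p \<in> closure {0<..<V}" using that Vpos by simp
      ultimately show ?thesis
        by (rule continuous_constant_on_closure[where f = "\<lambda>p. W p - Z p"])
    qed
    have ends: "W 0 = mK" "W V = hK" "Z 0 = mL" "Z V = hL"
      using W(1) W(5)[of mK] W(5)[of hK] W(6)[of mK] W(7)[of hK]
        Z(1) Z(5)[of mL] Z(5)[of hL] Z(6)[of mL] Z(7)[of hL] by auto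
    have hD: "hK - hL = D" "mK - mL = D" using const[of V] const[of 0] Vpos ends by auto
    have caps: "cap_volume u L (s - D) = cap_volume u K s" for s
    proof -
      consider "s \<le> mK" | "s \<in> {mK..hK}" | "s \<ge> hK" by fastforce
      then show ?thesis
      proof cases
        case 1 then show ?thesis using W(6)[of s] Z(6)[of "s - D"] hD by simp
      next
        case 2
        then have p: "cap_volume u K s \<in> {0..V}" "W (cap_volume u K s) = s" using W(5) by auto
        then have "s - D = Z (cap_volume u K s)" using const[OF p(1)] by simp
        then show ?thesis using Z(4)[OF p(1)] by simp
      next
        case 3 then show ?thesis using W(7)[of s] Z(7)[of "s - D"] hD by simp
      qed
    qed
    have sup: "(SUP y\<in>K. u \<bullet> y) = hK" "(SUP y\<in>L. u \<bullet> y) = hL"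
      using W(1,2) Z(1,2) by auto
    have rK: "u \<bullet> y \<le> hK" if "y \<in> K" for y using W(2) that by (metis atLeastAtMost_iff imageI)
    have rL: "u \<bullet> y \<le> hL" if "y \<in> L" for y using Z(2) that by (metis atLeastAtMost_iff imageI)
    let ?IK = "hK * V - u \<bullet> (LINT y:K|lborel. y)" and ?IL = "hL * V - u \<bullet> (LINT y:L|lborel. y)"
    have "cap_volume u K (hK - r) = cap_volume u L (hL - r)" for r
    proof -
      have "hL - r = hK - r - D" using hD by simp
      then show ?thesis using caps[of "hK - r"] by (simp only:)
    qed
    then have "ennreal ?IK = ennreal ?IL"
      using integral_cap_volume[OF K(1) u rK] integral_cap_volume[OF L(1) u rL] V by simp
    moreover have nonneg: "0 \<le> h * V - u \<bullet> (LINT y:S|lborel. y)"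
      if S: "compact S" "measure lborel S = V" and h: "\<And>y. y \<in> S \<Longrightarrow> u \<bullet> y \<le> h" for S h
    proof -
      have int: "integrable lborel (\<lambda>y. indicator S y *\<^sub>R y)" "integrable lborel (\<lambda>y. indicator S y *\<^sub>R h)"
        by (intro borel_integrable_compact S continuous_intros)+
      have "(LINT y|lborel. u \<bullet> (indicator S y *\<^sub>R y)) \<le> (LINT y|lborel. indicator S y *\<^sub>R h)"
        using h by (intro integral_mono integrable_inner_right int) (auto simp: indicator_def)
      moreover have "(LINT y|lborel. u \<bullet> (indicator S y *\<^sub>R y)) = u \<bullet> (LINT y|lborel. indicator S y *\<^sub>R y)"
        using int by (intro integral_inner_right)
      ultimately show ?thesis
        using S emeasure_compact_subset[OF S(1), of S] borel_compact[OF S(1)]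
        by (simp add: set_lebesgue_integral_def mult.commute)
    qed
    ultimately have "?IK = ?IL"
      using nonneg[OF K(1) V(1) rK] nonneg[OF L(1) V(2) rL] by simp
    then show ?thesis
      using Vpos unfolding sup by (simp add: inner_diff_right field_simps)
  qed
qed

section \<open>Wulff shapes\<close>

text \<open>
  The intersection of half-spaces with prescribed normals; the number \<open>k x\<close> bounds the support function
  in the direction \<open>x\<close>, but need not be attained.
\<close>
definition wulff :: "'a::real_inner set \<Rightarrow> ('a \<Rightarrow> real) \<Rightarrow> 'a set" where
  "wulff X k = {y. \<forall>x\<in>X. x \<bullet> y \<le> k x}"

lemma closed_wulff: "closed (wulff X k)"
proof -
  have "wulff X k = (\<Inter>x\<in>X. {y. x \<bullet> y \<le> k x})" by (auto simp: wulff_def)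
  then show ?thesis by (auto intro!: closed_INT closed_halfspace_le)
qed

text \<open>
  If one choice of positive numbers gives a bounded shape, then every choice does: a sufficiently large
  multiple of \<open>h\<close> dominates \<open>k\<close>, and scaling the numbers scales the shape.
\<close>
lemma bounded_wulff:
  assumes "finite X" and pos: "\<And>x. x \<in> X \<Longrightarrow> h x > 0" and bd: "bounded (wulff X h)"
  shows "bounded (wulff X k)"
proof -
  define s where "s = 1 + (\<Sum>x\<in>X. \<bar>k x\<bar> / h x)"
  have nn: "(\<Sum>x\<in>X. \<bar>k x\<bar> / h x) \<ge> 0"
    using pos by (intro sum_nonneg) (simp add: less_imp_le)
  then have s: "s > 0" by (simp add: s_def)
  have ks: "k x \<le> s * h x" if "x \<in> X" for x
  proof -
    have "\<bar>k x\<bar> / h x \<le> (\<Sum>x\<in>X. \<bar>k x\<bar> / h x)"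
      using that assms(1) pos by (intro member_le_sum) (auto simp: less_imp_le)
    then have "\<bar>k x\<bar> / h x \<le> s" by (simp add: s_def)
    then have "\<bar>k x\<bar> \<le> s * h x" using pos[OF that] by (simp add: field_simps)
    then show ?thesis by linarith
  qed
  have "wulff X k \<subseteq> (\<lambda>y. s *\<^sub>R y) ` wulff X h"
  proof
    fix y assume y: "y \<in> wulff X k"
    have "(1/s) *\<^sub>R y \<in> wulff X h"
      using y s ks by (force simp: wulff_def field_simps intro: order_trans)
    then show "y \<in> (\<lambda>y. s *\<^sub>R y) ` wulff X h"
      using s by (intro image_eqI[of _ _ "(1/s) *\<^sub>R y"]) auto
  qed
  moreover have "bounded ((\<lambda>y. s *\<^sub>R y) ` wulff X h)" by (rule bounded_scaling[OF bd])
  ultimately show ?thesis by (rule bounded_subset[rotated])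
qed

text \<open>
  Jensen's inequality for the logarithm of \<open>F\<close> and dyadically many points, obtained by repeated halving.
  It is stated with products because \<open>F\<close> may vanish.
\<close>
lemma power_mean_of_midpoint:
  fixes F :: "('a \<Rightarrow> real) \<Rightarrow> real" and u :: "nat \<Rightarrow> 'a \<Rightarrow> real"
  assumes nn: "\<And>k. F k \<ge> 0" and mid: "\<And>k l. F k * F l \<le> (F (\<lambda>x. (k x + l x) / 2))\<^sup>2"
  shows "(\<Prod>i<2^m. F (u i)) \<le> F (\<lambda>x. (\<Sum>i<2^m. u i x) / 2^m) ^ (2^m)"
proof (induction m arbitrary: u)
  case (Suc m)
  have "prod g {..<a + b} = prod g {..<a} * (\<Prod>i<b. g (i + a))" for g :: "nat \<Rightarrow> real" and a b
    by (induction b) (simp_all add: mult.assoc add.commute)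
  from this[of _ "2^m" "2^m"]
  have split_prod: "(\<Prod>i<2^Suc m. g i) = (\<Prod>i<2^m. g i) * (\<Prod>i<2^m. g (i + 2^m))" for g :: "nat \<Rightarrow> real"
    by (simp add: mult_2)
  have "sum g {..<a + b} = sum g {..<a} + (\<Sum>i<b. g (i + a))" for g :: "nat \<Rightarrow> real" and a b
    by (induction b) (simp_all add: add.assoc add.commute)
  from this[of _ "2^m" "2^m"]
  have split_sum: "(\<Sum>i<2^Suc m. g i) = (\<Sum>i<2^m. g i) + (\<Sum>i<2^m. g (i + 2^m))" for g :: "nat \<Rightarrow> real"
    by (simp add: mult_2)
  let ?k = "\<lambda>x. (\<Sum>i<2^m. u i x) / 2^m" and ?l = "\<lambda>x. (\<Sum>i<2^m. u (i + 2^m) x) / 2^m"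
  have "(\<Prod>i<2^Suc m. F (u i)) \<le> F ?k ^ 2^m * F ?l ^ 2^m"
    unfolding split_prod using Suc.IH[of u] Suc.IH[of "\<lambda>i. u (i + 2^m)"] nn
    by (intro mult_mono) (auto intro!: prod_nonneg)
  also have "\<dots> = (F ?k * F ?l) ^ 2^m" by (simp add: power_mult_distrib)
  also have "\<dots> \<le> ((F (\<lambda>x. (?k x + ?l x) / 2))\<^sup>2) ^ 2^m"
    using nn by (intro power_mono mid) auto
  also have "\<dots> = F (\<lambda>x. (?k x + ?l x) / 2) ^ 2^Suc m"
    by (simp add: power_mult[symmetric] mult.commute)
  also have "(\<lambda>x. (?k x + ?l x) / 2) = (\<lambda>x. (\<Sum>i<2^Suc m. u i x) / 2^Suc m)"
    unfolding split_sum by (simp add: add_divide_distrib mult.commute)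
  finally show ?case .
qed simp

lemma wulff_midpoint:
  fixes X :: "'a::euclidean_space set"
  assumes X: "finite X" "\<And>x. x \<in> X \<Longrightarrow> h x > 0" "bounded (wulff X h)"
  shows "measure lborel (wulff X k) * measure lborel (wulff X l) \<le> (measure lborel (wulff X (\<lambda>x. (k x + l x) / 2)))\<^sup>2"
proof -
  have cpt: "compact (wulff X k)" for k
    using bounded_wulff[OF X] closed_wulff by (auto simp: compact_eq_bounded_closed)
  have b: "wulff X k \<in> sets borel" for k by (intro borel_closed closed_wulff)
  have "emeasure lborel (wulff X k) * emeasure lborel (wulff X l) \<le> (emeasure lborel (wulff X (\<lambda>x. (k x + l x) / 2)))\<^sup>2"
    by (rule brunn_minkowski_midpoint[OF b b b])
      (auto simp: wulff_def inner_add_right add_divide_distrib intro!: add_mono)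
  then show ?thesis
    using emeasure_compact_subset[OF cpt order_refl b] by (simp add: ennreal_mult[symmetric] ennreal_power)
qed

section \<open>Lebesgue measure under isometries and directional stretches\<close>

text \<open>
  By Vitali's covering theorem an open set is a countable disjoint union of balls up to a null set. A
  linear isometry maps balls to balls of the same radius, and null sets to null sets, so it preserves
  the measure of every open set.
\<close>
lemma emeasure_isometric_preimage_open:
  fixes g :: "'a::euclidean_space \<Rightarrow> 'a"
  assumes g: "linear g" "bij g" and norm: "\<And>x. norm (g x) = norm x" and S: "open S"
  shows "emeasure lborel (g -` S) = emeasure lborel S"
proof -
  have cont: "continuous_on UNIV g"
    using g(1) by (simp add: linear_continuous_on linear_conv_bounded_linear)
  then have [measurable]: "g \<in> borel_measurable borel" by (rule borel_measurable_continuous_onI)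
  have pre: "g -` T \<in> sets borel" if "T \<in> sets borel" for T
    using measurable_sets[OF \<open>g \<in> borel_measurable borel\<close> that] by simp
  have linv: "linear (inv g)" using g by (simp add: inj_linear_imp_inv_linear bij_is_inj)
  have ginv: "g (inv g y) = y" "inv g (g y) = y" for y
    using g(2) by (simp_all add: bij_is_inj bij_is_surj surj_f_inv_f)
  define K where "K = {(x, r). ball x r \<subseteq> S}"
  have cover: "\<exists>i. i \<in> K \<and> x \<in> ball (fst i) (snd i) \<and> snd i < d" if x: "x \<in> S" "d > 0" for x d
  proof -
    obtain e where e: "e > 0" "ball x e \<subseteq> S" using S x(1) by (meson openE)
    have "ball x (min e (d / 2)) \<subseteq> S" using e(2) by auto
    then show ?thesis using e(1) x(2) by (intro exI[of _ "(x, min e (d / 2))"]) (auto simp: K_def)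
  qed
  obtain C where C: "countable C" "C \<subseteq> K"
     "pairwise (\<lambda>i j. disjnt (ball (fst i) (snd i)) (ball (fst j) (snd j))) C"
     "negligible (S - (\<Union>i \<in> C. ball (fst i) (snd i)))"
    using Vitali_covering_theorem_balls[of S K fst snd] cover by blast
  let ?B = "\<lambda>i. ball (fst i) (snd i)"
  let ?N = "S - (\<Union>i \<in> C. ?B i)"
  have Nb: "?N \<in> sets borel" using S by (intro sets.Diff borel_open open_UN) auto
  have null: "emeasure lborel T = 0" if "negligible T" "T \<in> sets borel" for T :: "'a set"
    using that by (simp add: negligible_iff_null_sets null_sets_completion_iff null_setsD1)
  have preN: "g -` ?N = inv g ` ?N"
  proof (intro set_eqI iffI)
    fix x assume "x \<in> g -` ?N"
    then show "x \<in> inv g ` ?N" by (intro image_eqI[of _ _ "g x"]) (auto simp: ginv)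
  qed (auto simp: ginv)
  have "negligible (g -` ?N)"
    unfolding preN by (rule negligible_differentiable_image_negligible[OF order_refl C(4)])
      (rule linear_imp_differentiable_on[OF linv])
  then have N0: "emeasure lborel (g -` ?N) = 0" by (rule null) (rule pre[OF Nb])
  have pB: "g -` ?B i = ball (inv g (fst i)) (snd i)" for i
  proof -
    have "dist (fst i) (g x) = dist (inv g (fst i)) x" for x
      using norm[of "inv g (fst i) - x"] by (simp add: dist_norm linear_diff[OF g(1)] ginv)
    then show ?thesis by auto
  qed
  have dec: "emeasure lborel (h -` S) = (\<integral>\<^sup>+i. emeasure lborel (h -` ?B i) \<partial>count_space C)"
    if h: "\<And>T. T \<in> sets borel \<Longrightarrow> h -` T \<in> sets borel" "emeasure lborel (h -` ?N) = 0" for h :: "'a \<Rightarrow> 'a"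
  proof -
    have "?B i \<subseteq> S" if "i \<in> C" for i using that C(2) by (cases i) (auto simp: K_def subset_eq)
    then have S_eq: "h -` S = (\<Union>i\<in>C. h -` ?B i) \<union> h -` ?N" by blast
    have N: "h -` ?N \<in> null_sets lborel" using h Nb by (simp add: null_sets_def)
    have "h -` ?B i \<in> sets lborel" for i using h(1)[of "?B i"] by simp
    then have "(\<Union>i\<in>C. h -` ?B i) \<in> sets lborel"
      by (rule sets.countable_UN''[OF C(1)])
    then have "emeasure lborel (h -` S) = emeasure lborel (\<Union>i\<in>C. h -` ?B i)"
      unfolding S_eq by (rule emeasure_Un_null_set[OF _ N])
    also have "\<dots> = (\<integral>\<^sup>+i. emeasure lborel (h -` ?B i) \<partial>count_space C)"
    proof (rule emeasure_UN_countable)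
      show "disjoint_family_on (\<lambda>i. h -` ?B i) C"
        using C(3) unfolding disjoint_family_on_def pairwise_def disjnt_def by blast
    qed (use h(1) C(1) in auto)
    finally show ?thesis .
  qed
  have "emeasure lborel (ball x r) = emeasure lborel (ball y r)" for x y :: 'a and r
    by (cases "r \<ge> 0") (simp_all add: emeasure_ball ball_empty)
  then have "(\<integral>\<^sup>+i. emeasure lborel (g -` ?B i) \<partial>count_space C) = (\<integral>\<^sup>+i. emeasure lborel (id -` ?B i) \<partial>count_space C)"
    unfolding pB by (intro nn_integral_cong) simp
  moreover have "emeasure lborel (id -` S) = (\<integral>\<^sup>+i. emeasure lborel (id -` ?B i) \<partial>count_space C)"
    by (rule dec) (use null[OF C(4) Nb] in simp_all)
  ultimately show ?thesis using dec[OF pre N0] by simp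
qed

text \<open>
  Open boxes have the same measure as their preimages, which characterizes Lebesgue measure; closed boxes
  follow, and these suffice for a linear map.
\<close>
lemma measure_isometric_image:
  fixes g :: "'a::euclidean_space \<Rightarrow> 'a"
  assumes g: "orthogonal_transformation g" and S: "S \<in> lmeasurable"
  shows "g ` S \<in> lmeasurable" "measure lebesgue (g ` S) = measure lebesgue S"
proof -
  have lin: "linear g" using g by (simp add: orthogonal_transformation_def)
  have bij: "bij g" by (rule orthogonal_transformation_bij[OF g])
  have linv: "linear (inv g)" using lin bij by (simp add: inj_linear_imp_inv_linear bij_is_inj)
  have ginv: "g (inv g y) = y" "inv g (g y) = y" for y
    using bij by (simp_all add: bij_is_inj bij_is_surj surj_f_inv_f)
  have norm: "norm (inv g y) = norm y" for y
    using orthogonal_transformation_norm[OF g, of "inv g y"] by (simp add: ginv)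
  have ginv_m: "inv g \<in> borel_measurable borel"
    using linv by (intro borel_measurable_continuous_onI) (simp add: linear_continuous_on linear_conv_bounded_linear)
  have distr: "lborel = distr lborel borel (inv g)"
  proof (rule lborel_eqI)
    fix l u :: 'a assume lu: "\<And>b. b \<in> Basis \<Longrightarrow> l \<bullet> b \<le> u \<bullet> b"
    have "emeasure (distr lborel borel (inv g)) (box l u) = emeasure lborel (inv g -` box l u)"
      using ginv_m by (simp add: emeasure_distr)
    also have "\<dots> = emeasure lborel (box l u)"
      using linv norm bij_imp_bij_inv[OF bij] by (intro emeasure_isometric_preimage_open) auto
    also have "\<dots> = (\<Prod>b\<in>Basis. (u - l) \<bullet> b)" using lu by (simp add: emeasure_lborel_box_eq)
    finally show "emeasure (distr lborel borel (inv g)) (box l u) = (\<Prod>b\<in>Basis. (u - l) \<bullet> b)" .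
  qed simp
  have cb: "measure lebesgue (g ` cbox a b) = 1 * measure lebesgue (cbox a b)" for a b
  proof -
    have eq: "g ` cbox a b = inv g -` cbox a b"
    proof (intro set_eqI iffI)
      fix x assume "x \<in> inv g -` cbox a b"
      then show "x \<in> g ` cbox a b" by (intro image_eqI[of _ _ "inv g x"]) (auto simp: ginv)
    qed (auto simp: ginv)
    have m: "inv g -` cbox a b \<in> sets borel" using measurable_sets[OF ginv_m, of "cbox a b"] by simp
    have "emeasure lborel (cbox a b) = emeasure (distr lborel borel (inv g)) (cbox a b)" using distr by simp
    also have "\<dots> = emeasure lborel (inv g -` cbox a b)"
      using ginv_m by (simp add: emeasure_distr)
    finally show ?thesis using m unfolding eq by (simp add: measure_completion measure_def)
  qed
  have "g ` S \<in> lmeasurable \<and> 1 * measure lebesgue S = measure lebesgue (g ` S)"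
    by (rule measure_linear_sufficient[OF lin S cb])
  then show "g ` S \<in> lmeasurable" "measure lebesgue (g ` S) = measure lebesgue S" by auto
qed

text \<open>
  The map stretches distances to the hyperplane \<open>x \<bullet> z = c\<close> by \<open>\<sigma>\<close>. Rotating \<open>x\<close> to a coordinate vector
  and translating turn it into a stretch of one coordinate.
\<close>
lemma measure_stretch_direction:
  fixes S :: "(real ^ 'n::finite) set"
  assumes x: "norm x = 1" and S: "S \<in> lmeasurable"
  shows "(\<lambda>z. z + (((\<sigma> - 1) * (x \<bullet> z - c)) *\<^sub>R x)) ` S \<in> lmeasurable"
    and "measure lebesgue ((\<lambda>z. z + (((\<sigma> - 1) * (x \<bullet> z - c)) *\<^sub>R x)) ` S) = \<bar>\<sigma>\<bar> * measure lebesgue S"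
proof -
  define i :: 'n where "i = undefined"
  have "norm (axis i (1::real)) = 1" by (simp add: norm_axis_1)
  then obtain T where T: "orthogonal_transformation T" "T x = axis i (1::real)"
  proof (rule orthogonal_transformation_exists_1[OF x])
    fix f assume "orthogonal_transformation f" "f x = axis i (1::real)"
    then show thesis by (rule that)
  qed
  define T' where "T' = inv T"
  have T': "orthogonal_transformation T'" unfolding T'_def by (rule orthogonal_transformation_inv[OF T(1)])
  have TT: "T' (T z) = z" for z
    unfolding T'_def using orthogonal_transformation_bij[OF T(1)] by (simp add: bij_is_inj)
  define m :: "'n \<Rightarrow> real" where "m k = (if k = i then \<sigma> else 1)" for k
  have prodm: "prod m UNIV = \<sigma>"
    by (simp add: m_def prod.delta)
  define st where "st z = (\<chi> k. m k * z $ k)" for z :: "real ^ 'n"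
  have st: "st z = z + ((\<sigma> - 1) * z $ i) *\<^sub>R axis i 1" for z
    by (auto simp: st_def vec_eq_iff m_def axis_def algebra_simps)
  have comp: "z + ((\<sigma> - 1) * (x \<bullet> z - c)) *\<^sub>R x = (- ((\<sigma> - 1) * c)) *\<^sub>R x + T' (st (T z))" for z
  proof -
    have "T z $ i = T z \<bullet> axis i 1" by (simp add: inner_axis)
    also have "\<dots> = T z \<bullet> T x" using T by simp
    also have "\<dots> = x \<bullet> z" using T(1) by (simp add: orthogonal_transformation_def inner_commute)
    finally have "st (T z) = T z + ((\<sigma> - 1) * (x \<bullet> z)) *\<^sub>R T x" using T by (simp add: st)
    also have "\<dots> = T (z + ((\<sigma> - 1) * (x \<bullet> z)) *\<^sub>R x)"
      using T(1) by (simp add: orthogonal_transformation_def linear_add linear_scale)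
    finally have "T' (st (T z)) = z + ((\<sigma> - 1) * (x \<bullet> z)) *\<^sub>R x" by (simp add: TT)
    then show ?thesis by (simp add: algebra_simps)
  qed
  have im: "(\<lambda>z. z + ((\<sigma> - 1) * (x \<bullet> z - c)) *\<^sub>R x) ` S = (+) ((- ((\<sigma> - 1) * c)) *\<^sub>R x) ` T' ` st ` T ` S"
    by (simp add: comp image_image)
  have m1: "T ` S \<in> lmeasurable" "measure lebesgue (T ` S) = measure lebesgue S"
    using measure_isometric_image(1)[OF T(1) S] measure_isometric_image(2)[OF T(1) S] by simp_all
  have m2: "st ` T ` S \<in> lmeasurable" "measure lebesgue (st ` T ` S) = \<bar>\<sigma>\<bar> * measure lebesgue S"
    using measurable_stretch[OF m1(1), of m] measure_stretch[OF m1(1), of m] m1(2) prodm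
    by (simp_all add: st_def[abs_def])
  have m3: "T' ` st ` T ` S \<in> lmeasurable" "measure lebesgue (T' ` st ` T ` S) = \<bar>\<sigma>\<bar> * measure lebesgue S"
    using measure_isometric_image(1)[OF T' m2(1)] measure_isometric_image(2)[OF T' m2(1)] m2(2) by simp_all
  show "(\<lambda>z. z + ((\<sigma> - 1) * (x \<bullet> z - c)) *\<^sub>R x) ` S \<in> lmeasurable"
    unfolding im by (intro measurable_translation m3)
  show "measure lebesgue ((\<lambda>z. z + ((\<sigma> - 1) * (x \<bullet> z - c)) *\<^sub>R x) ` S) = \<bar>\<sigma>\<bar> * measure lebesgue S"
    unfolding im by (simp only: measure_translation m3(2))
qed

section \<open>First variation of the volume of a Wulff shape\<close>

text \<open>
  Moving one facet hyperplane outwards by \<open>\<sigma>\<close> adds a slab of thickness \<open>\<sigma>\<close> (or removes one if \<open>\<sigma> < 0\<close>).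
  Stretching the slab by \<open>1 / \<sigma>\<close> orthogonally to the facet, with the facet hyperplane fixed, makes it a set
  \<open>E \<sigma>\<close> of thickness \<open>1\<close>, and the difference quotient of the volume is the volume of \<open>E \<sigma>\<close>. As \<open>\<sigma>\<close> tends
  to \<open>0\<close>, these sets converge to the right prism over the facet, except on the finitely many hyperplanes
  that carry its boundary, and by dominated convergence their volumes converge as well.
\<close>
lemma wulff_volume_derivative:
  fixes X :: "(real ^ 'n::finite) set"
  assumes fin: "finite X" and sph: "X \<subseteq> sphere 0 1" and pos: "\<And>x. x \<in> X \<Longrightarrow> h x > 0"
    and bd: "bounded (wulff X h)" and x0: "x0 \<in> X"
  shows "((\<lambda>\<sigma>. measure lborel (wulff X (h(x0 := h x0 + \<sigma>)))) has_real_derivative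
      measure lborel {y + s *\<^sub>R x0 | y s. y \<in> {y \<in> wulff X h. x0 \<bullet> y = h x0} \<and> 0 \<le> s \<and> s \<le> 1}) (at 0)"
proof -
  define \<eta> where "\<eta> = h x0"
  define W0 where "W0 = wulff (X - {x0}) h"
  define \<Phi> where "\<Phi> \<sigma> z = z + ((\<sigma> - 1) * (x0 \<bullet> z - \<eta>)) *\<^sub>R x0" for \<sigma> z
  define E where "E \<sigma> = {z. \<eta> < x0 \<bullet> z \<and> x0 \<bullet> z < \<eta> + 1 \<and> \<Phi> \<sigma> z \<in> W0}" for \<sigma>
  have n0: "norm x0 = 1" using sph x0 by auto
  then have x00: "x0 \<bullet> x0 = 1" by (simp add: norm_eq_1)
  have u0: "x0 \<noteq> 0" using n0 by auto
  let ?W = "\<lambda>\<sigma>. wulff X (h(x0 := \<eta> + \<sigma>))"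
  have W: "?W \<sigma> = {y \<in> W0. x0 \<bullet> y \<le> \<eta> + \<sigma>}" for \<sigma>
    using x0 by (auto simp: W0_def wulff_def)
  have W0eq: "wulff X h = ?W 0" by (simp add: \<eta>_def)
  have bdW: "bounded (?W \<sigma>)" for \<sigma> by (rule bounded_wulff[OF fin pos bd])
  have cW: "compact (?W \<sigma>)" for \<sigma> using bdW closed_wulff by (simp add: compact_eq_bounded_closed)
  have x0\<Phi>: "x0 \<bullet> \<Phi> \<sigma> z = \<eta> + \<sigma> * (x0 \<bullet> z - \<eta>)" for \<sigma> z
    by (simp add: \<Phi>_def inner_add_right x00 algebra_simps)
  have [measurable]: "W0 \<in> sets borel" unfolding W0_def by (intro borel_closed closed_wulff)
  have [measurable]: "\<Phi> \<sigma> \<in> borel_measurable borel" for \<sigma>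
    unfolding \<Phi>_def by (intro borel_measurable_continuous_onI continuous_intros)
  have [measurable]: "E \<sigma> \<in> sets borel" for \<sigma>
  proof -
    have "E \<sigma> = {z. \<eta> < x0 \<bullet> z} \<inter> {z. x0 \<bullet> z < \<eta> + 1} \<inter> (\<Phi> \<sigma> -` W0 \<inter> space borel)"
      by (auto simp: E_def)
    then show ?thesis by (auto intro: measurable_sets)
  qed
  obtain \<rho> where \<rho>: "?W 1 \<subseteq> cball 0 \<rho>"
    using bdW[of 1] unfolding bounded_iff by (auto simp: subset_eq)
  have E_ball: "E \<sigma> \<subseteq> cball 0 (\<rho> + 2)" if "\<bar>\<sigma>\<bar> \<le> 1" for \<sigma>
  proof
    fix z assume z: "z \<in> E \<sigma>"
    then have d: "0 < x0 \<bullet> z - \<eta>" "x0 \<bullet> z - \<eta> < 1" by (auto simp: E_def)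
    have "\<bar>\<sigma> * (x0 \<bullet> z - \<eta>)\<bar> \<le> 1 * 1"
      unfolding abs_mult using d that by (intro mult_mono) auto
    then have "\<Phi> \<sigma> z \<in> ?W 1" unfolding W using z x0\<Phi>[of \<sigma> z] by (auto simp: E_def)
    then have "norm (\<Phi> \<sigma> z) \<le> \<rho>" using \<rho> by auto
    moreover have "\<bar>(\<sigma> - 1) * (x0 \<bullet> z - \<eta>)\<bar> \<le> 2 * 1"
      unfolding abs_mult using d that by (intro mult_mono) auto
    then have "norm (((\<sigma> - 1) * (x0 \<bullet> z - \<eta>)) *\<^sub>R x0) \<le> 2" using n0 by simp
    moreover have "z = \<Phi> \<sigma> z - ((\<sigma> - 1) * (x0 \<bullet> z - \<eta>)) *\<^sub>R x0" by (simp add: \<Phi>_def)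
    then have "norm z \<le> norm (\<Phi> \<sigma> z) + norm (((\<sigma> - 1) * (x0 \<bullet> z - \<eta>)) *\<^sub>R x0)"
      by (metis norm_triangle_ineq4)
    ultimately show "z \<in> cball 0 (\<rho> + 2)" by simp
  qed
  define m where "m \<sigma> = measure lborel (E \<sigma> \<inter> cball 0 (\<rho> + 2))" for \<sigma>
  have mE: "m \<sigma> = measure lborel (E \<sigma>)" if "\<bar>\<sigma>\<bar> \<le> 1" for \<sigma>
    using E_ball[OF that] by (simp add: m_def inf_absorb1)
  have AE_ne: "AE z in lborel. x0 \<bullet> z \<noteq> s" for s by (rule AE_lborel_not_in_hyperplane[OF u0])
  \<comment> \<open>Up to two hyperplanes, \<open>E 0\<close> is the prism of height \<open>1\<close> over the facet.\<close>
  have area: "measure lborel {y + s *\<^sub>R x0 | y s. y \<in> {y \<in> wulff X h. x0 \<bullet> y = h x0} \<and> 0 \<le> s \<and> s \<le> 1} = m 0"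
  proof -
    have eq: "{y + s *\<^sub>R x0 | y s. y \<in> {y \<in> wulff X h. x0 \<bullet> y = h x0} \<and> 0 \<le> s \<and> s \<le> 1} =
        {z. \<eta> \<le> x0 \<bullet> z \<and> x0 \<bullet> z \<le> \<eta> + 1 \<and> \<Phi> 0 z \<in> W0}" (is "?A = ?B")
    proof (intro set_eqI iffI)
      fix z assume "z \<in> ?A"
      then obtain y s where z: "z = y + s *\<^sub>R x0" "y \<in> W0" "x0 \<bullet> y = \<eta>" "0 \<le> s" "s \<le> 1"
        unfolding W0eq W by (auto simp: \<eta>_def)
      have "x0 \<bullet> z = \<eta> + s" using z x00 by (simp add: inner_add_right)
      moreover from this have "\<Phi> 0 z = y" using z by (simp add: \<Phi>_def)
      ultimately show "z \<in> ?B" using z by simp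
    next
      fix z assume z: "z \<in> ?B"
      have "z = \<Phi> 0 z + (x0 \<bullet> z - \<eta>) *\<^sub>R x0" by (simp add: \<Phi>_def algebra_simps)
      moreover have "x0 \<bullet> \<Phi> 0 z = \<eta>" by (simp add: x0\<Phi>)
      ultimately show "z \<in> ?A" using z unfolding W0eq W
        by (intro CollectI exI[of _ "\<Phi> 0 z"] exI[of _ "x0 \<bullet> z - \<eta>"]) (auto simp: \<eta>_def)
    qed
    have "?B = {z. \<eta> \<le> x0 \<bullet> z} \<inter> {z. x0 \<bullet> z \<le> \<eta> + 1} \<inter> (\<Phi> 0 -` W0 \<inter> space borel)" by auto
    then have [measurable]: "?B \<in> sets borel" by (auto intro: measurable_sets)
    have "measure lborel ?B = measure lborel (E 0)"
    proof (rule measure_eq_AE)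
      show "AE z in lborel. (z \<in> ?B) = (z \<in> E 0)"
        using AE_ne[of \<eta>] AE_ne[of "\<eta> + 1"] by eventually_elim (auto simp: E_def)
    qed auto
    then show ?thesis unfolding eq using mE[of 0] by simp
  qed
  \<comment> \<open>for negative \<open>\<sigma>\<close> the stretch also reflects, and the same formula describes the slab removed\<close>
  have slab: "measure lborel (\<Phi> \<sigma> ` E \<sigma>) = \<bar>\<sigma>\<bar> * m \<sigma>" "\<Phi> \<sigma> ` E \<sigma> = {y \<in> W0. 0 < (x0 \<bullet> y - \<eta>) / \<sigma> \<and> (x0 \<bullet> y - \<eta>) / \<sigma> < 1}"
    "{y \<in> W0. 0 < (x0 \<bullet> y - \<eta>) / \<sigma> \<and> (x0 \<bullet> y - \<eta>) / \<sigma> < 1} \<in> sets borel"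
    if \<sigma>: "\<bar>\<sigma>\<bar> \<le> 1" "\<sigma> \<noteq> 0" for \<sigma>
  proof -
    show im: "\<Phi> \<sigma> ` E \<sigma> = {y \<in> W0. 0 < (x0 \<bullet> y - \<eta>) / \<sigma> \<and> (x0 \<bullet> y - \<eta>) / \<sigma> < 1}" (is "_ = ?R")
    proof (intro set_eqI iffI)
      fix y assume "y \<in> \<Phi> \<sigma> ` E \<sigma>"
      then show "y \<in> ?R" using \<sigma> by (auto simp: E_def x0\<Phi>)
    next
      fix y assume y: "y \<in> ?R"
      let ?z = "y + ((1 / \<sigma> - 1) * (x0 \<bullet> y - \<eta>)) *\<^sub>R x0"
      have xz: "x0 \<bullet> ?z - \<eta> = (x0 \<bullet> y - \<eta>) / \<sigma>"
        by (simp add: inner_add_right x00 algebra_simps diff_divide_distrib)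
      have "(1 / \<sigma> - 1) * (x0 \<bullet> y - \<eta>) + (\<sigma> - 1) * (x0 \<bullet> ?z - \<eta>) = 0"
        unfolding xz using \<sigma> by (simp add: field_simps)
      then have "\<Phi> \<sigma> ?z = y"
        unfolding \<Phi>_def by (metis (no_types, lifting) add.assoc add.right_neutral scaleR_add_left scaleR_zero_left)
      then show "y \<in> \<Phi> \<sigma> ` E \<sigma>"
        using y xz by (intro image_eqI[of _ _ ?z]) (auto simp: E_def)
    qed
    have "(\<lambda>y. (x0 \<bullet> y - \<eta>) / \<sigma>) \<in> borel_measurable borel" by measurable
    then show R: "?R \<in> sets borel" by measurable
    have "bounded (E \<sigma>)" using E_ball[OF \<sigma>(1)] bounded_cball bounded_subset by blast
    then have "E \<sigma> \<in> lmeasurable"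
      by (intro bounded_set_imp_lmeasurable) auto
    from measure_stretch_direction(2)[OF n0 this, of \<sigma> \<eta>]
    have "measure lebesgue (\<Phi> \<sigma> ` E \<sigma>) = \<bar>\<sigma>\<bar> * measure lebesgue (E \<sigma>)" by (simp add: \<Phi>_def[abs_def])
    then show "measure lborel (\<Phi> \<sigma> ` E \<sigma>) = \<bar>\<sigma>\<bar> * m \<sigma>"
      using R mE[OF \<sigma>(1)] unfolding im by (simp add: measure_completion)
  qed
  have quot: "(measure lborel (?W \<sigma>) - measure lborel (?W 0)) / \<sigma> = m \<sigma>" if \<sigma>: "\<bar>\<sigma>\<bar> \<le> 1" "\<sigma> \<noteq> 0" for \<sigma>
  proof -
    let ?R = "{y \<in> W0. 0 < (x0 \<bullet> y - \<eta>) / \<sigma> \<and> (x0 \<bullet> y - \<eta>) / \<sigma> < 1}"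
    have R: "measure lborel ?R = \<bar>\<sigma>\<bar> * m \<sigma>" using slab[OF \<sigma>] by simp
    have [measurable]: "?R \<in> sets borel" by (rule slab(3)[OF \<sigma>])
    have [measurable]: "?W \<tau> \<in> sets borel" for \<tau> by (intro borel_closed closed_wulff)
    have step: "measure lborel (?W b) = measure lborel (?W a) + measure lborel ?R"
      if ab: "a = 0 \<and> b = \<sigma> \<and> \<sigma> > 0 \<or> a = \<sigma> \<and> b = 0 \<and> \<sigma> < 0" for a b
    proof -
      have "?R \<subseteq> ?W b" unfolding W using ab \<sigma> by (auto simp: field_simps)
      then have "emeasure lborel ?R \<noteq> \<infinity>" using emeasure_compact_subset[OF cW, of ?R b] by simp
      moreover have "emeasure lborel (?W a) \<noteq> \<infinity>" using emeasure_compact_subset[OF cW, of "?W a" a] by simp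
      moreover have "?W a \<inter> ?R = {}" unfolding W using ab \<sigma> by (auto simp: field_simps)
      ultimately have "measure lborel (?W a \<union> ?R) = measure lborel (?W a) + measure lborel ?R"
        by (intro measure_Union) auto
      moreover have "measure lborel (?W b) = measure lborel (?W a \<union> ?R)"
      proof (rule measure_eq_AE)
        show "AE z in lborel. (z \<in> ?W b) = (z \<in> ?W a \<union> ?R)"
          using AE_ne[of \<eta>] AE_ne[of "\<eta> + \<sigma>"]
          by eventually_elim (use ab \<sigma> in \<open>auto simp: W field_simps\<close>)
      qed auto
      ultimately show ?thesis by simp
    qed
    show ?thesis
      using step[of 0 \<sigma>] step[of \<sigma> 0] R \<sigma> by (cases "\<sigma> > 0") (auto simp: field_simps)
  qed
  have cont: "(m \<longlongrightarrow> m 0) (at 0)"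
    unfolding tendsto_at_iff_sequentially
  proof (intro allI impI)
    fix S :: "nat \<Rightarrow> real" assume S: "S \<longlonglongrightarrow> 0"
    let ?I = "\<lambda>\<sigma>. indicator (E \<sigma> \<inter> cball 0 (\<rho> + 2)) :: real ^ 'n \<Rightarrow> real"
    \<comment> \<open>The limit fails only on the hyperplanes where some constraint is tight for \<open>\<Phi> 0 z\<close>. Such a set is a
      hyperplane unless \<open>x\<close> is parallel to \<open>x0\<close>; then \<open>x = - x0\<close>, and positivity of \<open>h\<close> excludes equality.\<close>
    have AE_x: "AE z in lborel. x \<bullet> \<Phi> 0 z \<noteq> h x" if x: "x \<in> X - {x0}" for x
    proof -
      let ?v = "x - (x \<bullet> x0) *\<^sub>R x0"
      have eq: "x \<bullet> \<Phi> 0 z = ?v \<bullet> z + \<eta> * (x \<bullet> x0)" for z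
        by (simp add: \<Phi>_def inner_add_right inner_diff_left inner_diff_right algebra_simps)
      show ?thesis
      proof (cases "?v = 0")
        case True
        have nx: "norm x = 1" using x sph by auto
        have xe: "x = (x \<bullet> x0) *\<^sub>R x0" using True by simp
        then have "\<bar>x \<bullet> x0\<bar> = 1" using nx n0 by (metis norm_scaleR mult.right_neutral)
        moreover have "x \<bullet> x0 \<noteq> 1" using xe x by auto
        ultimately have "x \<bullet> x0 = -1" by linarith
        then have "x \<bullet> \<Phi> 0 z = - \<eta>" for z using eq[of z] True by simp
        moreover have "\<eta> > 0" "h x > 0" using pos x x0 by (auto simp: \<eta>_def)
        ultimately show ?thesis by simp
      next
        case False
        from AE_lborel_not_in_hyperplane[OF this, of "h x - \<eta> * (x \<bullet> x0)"]
        show ?thesis by eventually_elim (auto simp: eq)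
      qed
    qed
    have AE_all: "AE z in lborel. \<forall>x\<in>X - {x0}. x \<bullet> \<Phi> 0 z \<noteq> h x"
      using fin AE_x by (intro AE_finite_allI) auto
    have "(\<lambda>n. LINT z|lborel. ?I (S n) z) \<longlonglongrightarrow> (LINT z|lborel. ?I 0 z)"
    proof (rule integral_dominated_convergence[where w = "indicator (cball 0 (\<rho> + 2))"])
      show "integrable lborel (indicator (cball 0 (\<rho> + 2)) :: real ^ 'n \<Rightarrow> real)"
        using emeasure_compact_subset[of "cball 0 (\<rho> + 2) :: (real ^ 'n) set" "cball 0 (\<rho> + 2)"]
        by (intro integrable_real_indicator) auto
      show "AE z in lborel. (\<lambda>n. ?I (S n) z) \<longlonglongrightarrow> ?I 0 z"
        using AE_all
      proof eventually_elim
        case (elim z)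
        have lim: "(\<lambda>n. x \<bullet> \<Phi> (S n) z) \<longlonglongrightarrow> x \<bullet> \<Phi> 0 z" for x
          unfolding \<Phi>_def by (intro tendsto_intros S)
        have "\<forall>\<^sub>F n in sequentially. (x \<bullet> \<Phi> (S n) z \<le> h x) = (x \<bullet> \<Phi> 0 z \<le> h x)" if "x \<in> X - {x0}" for x
        proof (cases "x \<bullet> \<Phi> 0 z < h x")
          case True
          then show ?thesis using order_tendstoD(2)[OF lim True] by (auto elim: eventually_mono)
        next
          case False
          then have gt: "h x < x \<bullet> \<Phi> 0 z" using elim that by force
          show ?thesis by (rule eventually_mono[OF order_tendstoD(1)[OF lim gt]]) (use gt in auto)
        qed
        then have "\<forall>\<^sub>F n in sequentially. \<forall>x\<in>X - {x0}. (x \<bullet> \<Phi> (S n) z \<le> h x) = (x \<bullet> \<Phi> 0 z \<le> h x)"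
          using fin by (intro eventually_ball_finite) auto
        then have "\<forall>\<^sub>F n in sequentially. ?I (S n) z = ?I 0 z"
          by eventually_elim (auto simp: indicator_def E_def W0_def wulff_def)
        then show ?case by (rule tendsto_eventually)
      qed
    qed (auto simp: indicator_def)
    then show "(m \<circ> S) \<longlonglongrightarrow> m 0" by (simp add: o_def m_def)
  qed
  have "((\<lambda>\<sigma>. (measure lborel (?W (0 + \<sigma>)) - measure lborel (?W 0)) / \<sigma>) \<longlongrightarrow> m 0) (at 0)"
  proof (rule Lim_transform_eventually[OF cont])
    have "\<forall>\<^sub>F \<sigma> in at (0::real). \<sigma> \<in> {-1<..<1} \<and> \<sigma> \<noteq> 0"
      using eventually_at_in_open[of "{-1<..<1}" "0::real"] by (auto elim: eventually_mono)
    then show "\<forall>\<^sub>F \<sigma> in at 0. m \<sigma> = (measure lborel (?W (0 + \<sigma>)) - measure lborel (?W 0)) / \<sigma>"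
      by eventually_elim (use quot in auto)
  qed
  then show ?thesis unfolding area unfolding DERIV_def by (simp add: \<eta>_def)
qed

text \<open>
  A critical point of a concave function is a maximum. The function is the logarithm of the volume of
  \<open>wulff X h\<close> as a function of \<open>h\<close>, concave by Brunn-Minkowski, and at \<open>h\<close> all its partial derivatives
  agree, so it is critical in directions \<open>k\<close> with sum \<open>0\<close>. As only partial derivatives are available, the
  argument is one-sided. If \<open>h + k\<close> had larger volume, concavity would give a gain of first order in \<open>\<tau>\<close> at
  \<open>h + \<tau> k\<close> and hence, because \<open>h\<close> is the midpoint of \<open>h + \<tau> k\<close> and \<open>h - \<tau> k\<close>, a loss of first order at
  \<open>h - \<tau> k\<close>. On the other hand \<open>h - \<tau> k\<close> is an average of points that differ from \<open>h\<close> in a single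
  coordinate, so by Jensen its loss is at most the average of theirs, which vanishes to first order.
\<close>
lemma wulff_volume_max:
  fixes X :: "(real ^ 'n::finite) set"
  assumes fin: "finite X" and pos: "\<And>x. x \<in> X \<Longrightarrow> h x > 0" and bd: "bounded (wulff X h)"
    and V0: "measure lborel (wulff X h) > 0"
    and der: "\<And>x. x \<in> X \<Longrightarrow> ((\<lambda>\<sigma>. measure lborel (wulff X (h(x := h x + \<sigma>)))) has_real_derivative a) (at 0)"
    and k: "(\<Sum>x\<in>X. k x) = 0"
  shows "measure lborel (wulff X (\<lambda>x. h x + k x)) \<le> measure lborel (wulff X h)"
proof (rule ccontr)
  assume less: "\<not> ?thesis"
  define V where "V k = measure lborel (wulff X k)" for k
  have Vn: "V k \<ge> 0" for k by (simp add: V_def)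
  have mid: "V k * V l \<le> (V (\<lambda>x. (k x + l x) / 2))\<^sup>2" for k l
    unfolding V_def by (rule wulff_midpoint[OF fin pos bd])
  have cong: "V k = V l" if "\<And>x. x \<in> X \<Longrightarrow> k x = l x" for k l
    using that by (simp add: V_def wulff_def)
  note pm = power_mean_of_midpoint[of V, OF Vn mid]
  have Vh: "V h > 0" using V0 by (simp add: V_def)
  define \<gamma> where "\<gamma> = ln (V (\<lambda>x. h x + k x)) - ln (V h)"
  have Vk: "V (\<lambda>x. h x + k x) > V h" using less by (simp add: V_def)
  then have \<gamma>: "\<gamma> > 0" using Vh by (simp add: \<gamma>_def)
  define n where "n = card X"
  \<comment> \<open>Jensen is available for \<open>2 ^ n\<close> points only; the points beyond \<open>card X\<close> are padded with \<open>h\<close>, and the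
    steps \<open>\<tau> * c * k x\<close> in the others compensate for the division by \<open>2 ^ n\<close>.\<close>
  define c :: real where "c = 2 ^ n"
  have n: "n \<le> 2 ^ n" using less_exp[of n] by simp
  obtain e where e: "bij_betw e {..<n} X"
    using ex_bij_betw_nat_finite[OF fin] by (auto simp: n_def atLeast0LessThan)
  define u where "u \<tau> i = (if i < n then h(e i := h (e i) - \<tau> * c * k (e i)) else h)" for \<tau> i
  define D where "D \<tau> = (\<Sum>i<2^n. ln (V (u \<tau> i)))" for \<tau>
  have eX: "e i \<in> X" if "i < n" for i using e that by (auto simp: bij_betw_def)
  have dV: "((\<lambda>\<tau>. V (u \<tau> i)) has_real_derivative (if i < n then - a * c * k (e i) else 0)) (at 0)" for i
  proof (cases "i < n")
    case True
    have "((\<lambda>\<sigma>. V (h(e i := h (e i) + \<sigma>))) has_real_derivative a) (at ((\<lambda>\<tau>. - \<tau> * c * k (e i)) 0))"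
      using der[OF eX[OF True]] by (simp add: V_def)
    moreover have "((\<lambda>\<tau>. - \<tau> * c * k (e i)) has_real_derivative - c * k (e i)) (at 0)"
      by (auto intro!: derivative_eq_intros)
    ultimately have "((\<lambda>\<sigma>. V (h(e i := h (e i) + \<sigma>))) \<circ> (\<lambda>\<tau>. - \<tau> * c * k (e i)) has_real_derivative a * (- c * k (e i))) (at 0)"
      by (rule DERIV_chain)
    then show ?thesis using True by (simp add: u_def o_def mult.assoc)
  qed (simp add: u_def)
  have u0: "u 0 i = h" for i by (auto simp: u_def)
  have "(D has_real_derivative (\<Sum>i<2^n. (if i < n then - a * c * k (e i) else 0) / V h)) (at 0)"
    unfolding D_def
  proof (rule DERIV_sum)
    fix i
    have "((\<lambda>\<tau>. ln (V (u \<tau> i))) has_real_derivative (1 / V (u 0 i)) * (if i < n then - a * c * k (e i) else 0)) (at 0)"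
      by (rule DERIV_chain2[OF DERIV_ln_divide dV]) (simp add: u0 Vh)
    then show "((\<lambda>\<tau>. ln (V (u \<tau> i))) has_real_derivative (if i < n then - a * c * k (e i) else 0) / V h) (at 0)"
      by (simp add: u0)
  qed
  also have "(\<Sum>i<2^n. (if i < n then - a * c * k (e i) else 0) / V h) = 0"
  proof -
    have "(\<Sum>i<2^n. (if i < n then - a * c * k (e i) else 0)) = (\<Sum>i<n. - a * c * k (e i))"
      using n by (intro sum.mono_neutral_cong_right) auto
    also have "\<dots> = - a * c * (\<Sum>i<n. k (e i))" by (simp add: sum_distrib_left sum_negf)
    also have "(\<Sum>i<n. k (e i)) = (\<Sum>x\<in>X. k x)" by (rule sum.reindex_bij_betw[OF e])
    finally show ?thesis using k by (simp add: sum_divide_distrib[symmetric])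
  qed
  finally have dD: "(D has_real_derivative 0) (at 0)" .
  define \<tau> where "\<tau> m = (1/2 :: real) ^ m" for m
  have \<tau>: "\<tau> \<longlonglongrightarrow> 0" unfolding \<tau>_def by (rule LIMSEQ_realpow_zero) auto
  have \<tau>pos: "\<tau> m > 0" for m by (simp add: \<tau>_def)
  have fl: "filterlim \<tau> (at 0) sequentially"
    using \<tau> \<tau>pos by (simp add: filterlim_at less_imp_neq[symmetric])
  have quot: "(\<lambda>m. (D (\<tau> m) - D 0) / \<tau> m) \<longlonglongrightarrow> 0"
    using filterlim_compose[OF _ fl, of "\<lambda>\<sigma>. (D (0 + \<sigma>) - D 0) / \<sigma>"] dD by (simp add: DERIV_def)
  have posu: "\<forall>\<^sub>F m in sequentially. \<forall>i\<in>{..<2^n}. V (u (\<tau> m) i) > 0"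
  proof (rule eventually_ball_finite)
    show "\<forall>i\<in>{..<2^n}. \<forall>\<^sub>F m in sequentially. V (u (\<tau> m) i) > 0"
    proof
      fix i
      have "isCont (\<lambda>\<tau>. V (u \<tau> i)) 0" by (rule DERIV_isCont[OF dV])
      then have "(\<lambda>m. V (u (\<tau> m) i)) \<longlonglongrightarrow> V (u 0 i)"
        by (rule isCont_tendsto_compose[OF _ \<tau>])
      then show "\<forall>\<^sub>F m in sequentially. V (u (\<tau> m) i) > 0"
        by (rule order_tendstoD) (simp add: u0 Vh)
    qed
  qed auto
  have "\<forall>\<^sub>F m in sequentially. (D (\<tau> m) - D 0) / \<tau> m \<le> - c * \<gamma>"
    using posu
  proof eventually_elim
    case (elim m)
    let ?p = "V (\<lambda>x. h x + \<tau> m * k x)" and ?q = "V (\<lambda>x. h x - \<tau> m * k x)"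
    have "(\<Prod>i<2^n. V (u (\<tau> m) i)) \<le> V (\<lambda>x. (\<Sum>i<2^n. u (\<tau> m) i x) / 2^n) ^ 2^n"
      by (rule pm)
    also have "V (\<lambda>x. (\<Sum>i<2^n. u (\<tau> m) i x) / 2^n) = ?q"
    proof (rule cong)
      fix x assume "x \<in> X"
      then obtain j where j: "j < n" "e j = x" using e by (auto simp: bij_betw_def)
      have "u (\<tau> m) i x = h x - (if i = j then \<tau> m * c * k x else 0)" if "i < 2^n" for i
      proof (cases "i < n")
        case True
        then have "e i = x \<longleftrightarrow> i = j" using e j by (auto simp: bij_betw_def inj_on_def)
        then show ?thesis using True by (auto simp: u_def)
      next
        case False
        then show ?thesis using j by (auto simp: u_def)
      qed
      then have "(\<Sum>i<2^n. u (\<tau> m) i x) = (\<Sum>i<(2::nat)^n. h x - (if i = j then \<tau> m * c * k x else 0))"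
        by (intro sum.cong) auto
      also have "\<dots> = 2^n * h x - \<tau> m * c * k x"
        using less_le_trans[OF j(1) n] by (simp add: sum_subtractf sum.delta)
      finally show "(\<Sum>i<2^n. u (\<tau> m) i x) / 2^n = h x - \<tau> m * k x"
        by (simp add: c_def field_simps)
    qed
    finally have q: "(\<Prod>i<2^n. V (u (\<tau> m) i)) \<le> ?q ^ 2^n" .
    have "(\<Prod>i<2^n. V (u (\<tau> m) i)) > 0" using elim by (intro prod_pos) auto
    with q have "?q ^ 2^n > 0" by linarith
    then have qpos: "?q > 0" using Vn[of "\<lambda>x. h x - \<tau> m * k x"] by (cases "?q = 0") (auto simp: power_0_left)
    have "D (\<tau> m) = ln (\<Prod>i<2^n. V (u (\<tau> m) i))"
      unfolding D_def
    proof (rule ln_prod[symmetric])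
      fix i :: nat assume "i \<in> {..<2^n}"
      from bspec[OF elim this] show "V (u (\<tau> m) i) \<noteq> 0" by simp
    qed simp
    also have "\<dots> \<le> ln (?q ^ 2^n)"
      using q \<open>(\<Prod>i<2^n. V (u (\<tau> m) i)) > 0\<close> by (subst ln_le_cancel_iff) (auto simp: qpos)
    also have "\<dots> = c * ln ?q" using qpos by (simp add: ln_realpow c_def)
    finally have q': "D (\<tau> m) \<le> c * ln ?q" .
    \<comment> \<open>\<open>h + \<tau> k\<close> as the average of one copy of \<open>h + k\<close> and \<open>2 ^ m - 1\<close> copies of \<open>h\<close>; here \<open>\<tau> = 1 / 2 ^ m\<close>\<close>
    let ?v = "\<lambda>i :: nat. if i = 0 then (\<lambda>x. h x + k x) else h"
    have "(\<Prod>i<2^m. V (?v i)) \<le> V (\<lambda>x. (\<Sum>i<2^m. ?v i x) / 2^m) ^ 2^m" by (rule pm)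
    also have "V (\<lambda>x. (\<Sum>i<2^m. ?v i x) / 2^m) = ?p"
    proof (rule cong)
      fix x
      have "(\<Sum>i<2^m. ?v i x) = (\<Sum>i<(2::nat)^m. h x + (if i = 0 then k x else 0))" by (intro sum.cong) auto
      also have "\<dots> = 2^m * h x + k x" by (simp add: sum.distrib sum.delta)
      finally show "(\<Sum>i<2^m. ?v i x) / 2^m = h x + \<tau> m * k x" by (simp add: \<tau>_def field_simps)
    qed
    finally have p: "(\<Prod>i<2^m. V (?v i)) \<le> ?p ^ 2^m" .
    have ppos0: "(\<Prod>i<2^m. V (?v i)) > 0" using Vh Vk by (intro prod_pos) auto
    with p have "?p ^ 2^m > 0" by linarith
    then have ppos: "?p > 0" using Vn[of "\<lambda>x. h x + \<tau> m * k x"] by (cases "?p = 0") (auto simp: power_0_left)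
    have "2^m * ln (V h) + \<gamma> = (\<Sum>i<(2::nat)^m. ln (V h) + (if i = 0 then \<gamma> else 0))"
      by (simp add: sum.distrib sum.delta)
    also have "\<dots> = (\<Sum>i<2^m. ln (V (?v i)))" by (intro sum.cong) (auto simp: \<gamma>_def)
    also have "\<dots> = ln (\<Prod>i<2^m. V (?v i))"
      using Vh Vk by (subst ln_prod) auto
    also have "\<dots> \<le> ln (?p ^ 2^m)"
      using p ppos0 by (subst ln_le_cancel_iff) (auto simp: ppos)
    also have "\<dots> = 2^m * ln ?p" using ppos by (simp add: ln_realpow)
    finally have p': "ln (V h) + \<tau> m * \<gamma> \<le> ln ?p" by (simp add: \<tau>_def field_simps)
    have "?p * ?q \<le> (V h)\<^sup>2" using mid[of "\<lambda>x. h x + \<tau> m * k x" "\<lambda>x. h x - \<tau> m * k x"] by simp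
    then have "ln (?p * ?q) \<le> ln ((V h)\<^sup>2)" using ppos qpos Vh by (subst ln_le_cancel_iff) auto
    then have "ln ?p + ln ?q \<le> 2 * ln (V h)" using ppos qpos Vh by (simp add: ln_mult ln_realpow)
    with p' have "ln ?q \<le> ln (V h) - \<tau> m * \<gamma>" by linarith
    then have "c * ln ?q \<le> c * (ln (V h) - \<tau> m * \<gamma>)" by (intro mult_left_mono) (auto simp: c_def)
    with q' have "D (\<tau> m) - c * ln (V h) \<le> - c * \<gamma> * \<tau> m" by (simp add: algebra_simps)
    moreover have "D 0 = c * ln (V h)" by (simp add: D_def u0 c_def)
    ultimately show ?case using \<tau>pos[of m] by (simp add: divide_le_eq)
  qed
  then have "0 \<le> - c * \<gamma>"
    by (rule tendsto_upperbound[OF quot]) simp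
  moreover have "c * \<gamma> > 0" using \<gamma> by (simp add: c_def)
  ultimately show False by simp
qed

section \<open>Integration and polynomials on the sphere\<close>

lemma sets_sphere_measure [measurable_cong, simp]: "sets sphere_measure = sets borel"
  by (simp add: sphere_measure_def)

lemma space_sphere_measure [simp]: "space sphere_measure = UNIV"
  by (simp add: sphere_measure_def)

lemma sgn_measurable [measurable]: "(sgn :: 'a::euclidean_space \<Rightarrow> 'a) \<in> borel_measurable borel"
  unfolding sgn_div_norm[abs_def] by measurable

lemma emeasure_unit_ball: "emeasure lborel (ball 0 1 :: 'a::euclidean_space set) \<noteq> 0" "emeasure lborel (ball 0 1 :: 'a set) \<noteq> \<infinity>"
proof -
  have "\<not> negligible (ball 0 1 :: 'a set)" by (intro open_not_negligible) auto
  then have "ball 0 1 \<notin> null_sets (lebesgue :: 'a measure)" by (simp add: negligible_iff_null_sets)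
  then show "emeasure lborel (ball 0 1 :: 'a set) \<noteq> 0"
    by (auto simp: null_sets_completion_iff null_sets_def)
  show "emeasure lborel (ball 0 1 :: 'a set) \<noteq> \<infinity>"
    using emeasure_bounded_finite[OF bounded_ball, of "0 :: 'a" 1] by (simp add: less_top)
qed

lemma finite_uniform_ball: "finite_measure (uniform_measure lborel (ball 0 1 :: 'a::euclidean_space set))"
  by (rule finite_measureI) (use emeasure_unit_ball in \<open>auto simp: ennreal_divide_eq_top_iff\<close>)

lemma integrable_sphere_measure:
  fixes f :: "real ^ 'n::finite \<Rightarrow> 'b::{banach, second_countable_topology}"
  assumes "continuous_on UNIV f"
  shows "integrable sphere_measure f"
proof -
  have [measurable]: "f \<in> borel_measurable borel" using assms by (rule borel_measurable_continuous_onI)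
  have "compact (f ` cball 0 1)"
    using assms by (intro compact_continuous_image) (auto intro: continuous_on_subset)
  then have "bounded (f ` cball 0 1)" by (rule compact_imp_bounded)
  then obtain B where "\<forall>y\<in>f ` cball 0 1. norm y \<le> B" unfolding bounded_iff by blast
  then have B: "\<And>x. x \<in> cball 0 1 \<Longrightarrow> norm (f x) \<le> B" by blast
  have "integrable (uniform_measure lborel (ball 0 1)) (\<lambda>x. f (sgn x))"
    by (rule finite_measure.integrable_const_bound[OF finite_uniform_ball, of _ B])
      (auto intro!: B AE_I2 simp: norm_sgn)
  then show ?thesis unfolding sphere_measure_def by (simp add: integrable_distr_eq)
qed

text \<open>
  Lebesgue measure on the ball is invariant, and an isometry commutes with the radial projection \<open>sgn\<close>.
\<close>
lemma sphere_measure_orthogonal: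
  fixes g :: "real ^ 'n::finite \<Rightarrow> real ^ 'n"
  assumes g: "orthogonal_transformation g"
  shows "distr sphere_measure borel g = sphere_measure"
proof -
  have lin: "linear g" using g by (simp add: orthogonal_transformation_def)
  have [measurable]: "g \<in> borel_measurable borel"
    using lin by (intro borel_measurable_continuous_onI linear_continuous_on linear_conv_bounded_linear[THEN iffD1])
  let ?B = "ball 0 1 :: (real ^ 'n) set"
  let ?U = "uniform_measure lborel ?B"
  have bij: "bij g" by (rule orthogonal_transformation_bij[OF g])
  have U: "distr ?U borel g = ?U"
  proof (rule measure_eqI)
    fix A :: "(real ^ 'n) set" assume "A \<in> sets (distr ?U borel g)"
    then have A [measurable]: "A \<in> sets borel" by simp
    have eq: "?B \<inter> A = g ` (?B \<inter> g -` A)"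
    proof (intro set_eqI iffI)
      fix y assume y: "y \<in> ?B \<inter> A"
      obtain x where x: "y = g x" using bij by (metis bij_pointE)
      then show "y \<in> g ` (?B \<inter> g -` A)" using y orthogonal_transformation_norm[OF g, of x] by auto
    qed (use orthogonal_transformation_norm[OF g] in auto)
    have m [measurable]: "g -` A \<in> sets borel"
      using measurable_sets[OF \<open>g \<in> borel_measurable borel\<close> A] by simp
    have lm: "?B \<inter> g -` A \<in> lmeasurable"
      by (intro bounded_set_imp_lmeasurable) (auto intro: bounded_subset[OF bounded_ball])
    have "measure lebesgue (?B \<inter> A) = measure lebesgue (?B \<inter> g -` A)"
      unfolding eq by (rule measure_isometric_image(2)[OF g lm])
    then have "emeasure lborel (?B \<inter> A) = emeasure lborel (?B \<inter> g -` A)"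
      using emeasure_compact_subset[of "cball 0 1" "?B \<inter> A"] emeasure_compact_subset[of "cball 0 1" "?B \<inter> g -` A"]
      by (simp add: measure_completion subset_eq)
    then show "emeasure (distr ?U borel g) A = emeasure ?U A"
      by (simp add: emeasure_distr emeasure_uniform_measure_1)
  qed simp
  have "distr sphere_measure borel g = distr ?U borel (g \<circ> sgn)"
    by (simp add: sphere_measure_def distr_distr)
  also have "g \<circ> sgn = sgn \<circ> g"
  proof
    fix x show "(g \<circ> sgn) x = (sgn \<circ> g) x"
      using linear_scale[OF lin] orthogonal_transformation_norm[OF g, of x] by (simp add: sgn_div_norm)
  qed
  also have "distr ?U borel (sgn \<circ> g) = distr (distr ?U borel g) borel sgn"
    by (simp add: distr_distr)
  also have "\<dots> = sphere_measure" unfolding U by (simp add: sphere_measure_def)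
  finally show ?thesis .
qed

lemma finite_exponents: "finite {a :: 'n::finite \<Rightarrow> nat. (\<Sum>i\<in>UNIV. a i) \<le> t}"
proof (rule finite_subset)
  show "{a :: 'n \<Rightarrow> nat. (\<Sum>i\<in>UNIV. a i) \<le> t} \<subseteq> (\<Pi>\<^sub>E i\<in>UNIV. {..t})"
  proof
    fix a :: "'n \<Rightarrow> nat" assume "a \<in> {a. (\<Sum>i\<in>UNIV. a i) \<le> t}"
    moreover have "a i \<le> (\<Sum>i\<in>UNIV. a i)" for i by (rule member_le_sum) auto
    ultimately show "a \<in> (\<Pi>\<^sub>E i\<in>UNIV. {..t})" by (auto intro: order_trans)
  qed
qed (intro finite_PiE, auto)

lemma poly_total_degree_le_monomial:
  assumes "(\<Sum>i\<in>UNIV. a i) \<le> t"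
  shows "poly_total_degree_le t (\<lambda>x :: real ^ 'n::finite. c * (\<Prod>i\<in>UNIV. (x $ i) ^ a i))"
  unfolding poly_total_degree_le_def
proof (intro exI ext)
  fix x :: "real ^ 'n"
  note fin = finite_exponents[where 'n = 'n and t = t]
  have "(\<Sum>b | (\<Sum>i\<in>UNIV. b i) \<le> t. (if b = a then c else 0) * (\<Prod>i\<in>UNIV. (x $ i) ^ b i)) =
      (\<Sum>b | (\<Sum>i\<in>UNIV. b i) \<le> t. if b = a then c * (\<Prod>i\<in>UNIV. (x $ i) ^ a i) else 0)"
    by (intro sum.cong) auto
  also have "\<dots> = c * (\<Prod>i\<in>UNIV. (x $ i) ^ a i)"
    using fin assms by (simp add: sum.delta)
  finally show "c * (\<Prod>i\<in>UNIV. (x $ i) ^ a i) =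
      (\<Sum>b | (\<Sum>i\<in>UNIV. b i) \<le> t. (if b = a then c else 0) * (\<Prod>i\<in>UNIV. (x $ i) ^ b i))" by simp
qed

lemma poly_total_degree_le_add:
  assumes "poly_total_degree_le t p" "poly_total_degree_le t q"
  shows "poly_total_degree_le t (\<lambda>x :: real ^ 'n::finite. p x + q x)"
proof -
  from assms obtain c d where "p = (\<lambda>x. \<Sum>a | (\<Sum>i\<in>UNIV. a i) \<le> t. c a * (\<Prod>i\<in>UNIV. (x $ i) ^ a i))"
    "q = (\<lambda>x. \<Sum>a | (\<Sum>i\<in>UNIV. a i) \<le> t. d a * (\<Prod>i\<in>UNIV. (x $ i) ^ a i))"
    unfolding poly_total_degree_le_def by blast
  then show ?thesis unfolding poly_total_degree_le_def
    by (intro exI[of _ "\<lambda>a. c a + d a"]) (simp add: sum.distrib distrib_right)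
qed

lemma poly_total_degree_le_sum:
  assumes "finite I" "\<And>i. i \<in> I \<Longrightarrow> poly_total_degree_le t (p i)"
  shows "poly_total_degree_le t (\<lambda>x :: real ^ 'n::finite. \<Sum>i\<in>I. p i x)"
  using assms
proof (induction I)
  case empty
  then show ?case using poly_total_degree_le_monomial[of "\<lambda>_. 0" t 0] by simp
qed (simp add: poly_total_degree_le_add)

lemma poly_total_degree_le_scale_coordinate:
  fixes p :: "real ^ 'n::finite \<Rightarrow> real"
  assumes "poly_total_degree_le t p"
  shows "poly_total_degree_le (Suc t) (\<lambda>x. c * (x $ j) * p x)" "poly_total_degree_le t (\<lambda>x. c * p x)"
proof -
  from assms obtain e where p: "p = (\<lambda>x. \<Sum>a | (\<Sum>i\<in>UNIV. a i) \<le> t. e a * (\<Prod>i\<in>UNIV. (x $ i) ^ a i))"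
    unfolding poly_total_degree_le_def by blast
  note fin = finite_exponents[where 'n = 'n and t = t]
  have "poly_total_degree_le t (\<lambda>x. \<Sum>a | (\<Sum>i\<in>UNIV. a i) \<le> t. (c * e a) * (\<Prod>i\<in>UNIV. (x $ i) ^ a i))"
    using fin by (intro poly_total_degree_le_sum poly_total_degree_le_monomial) auto
  then show "poly_total_degree_le t (\<lambda>x. c * p x)" by (simp add: p sum_distrib_left mult.assoc)
  have "poly_total_degree_le (Suc t) (\<lambda>x. \<Sum>a | (\<Sum>i\<in>UNIV. a i) \<le> t.
      (c * e a) * (\<Prod>i\<in>UNIV. (x $ i) ^ (a(j := Suc (a j))) i))"
  proof (intro poly_total_degree_le_sum poly_total_degree_le_monomial fin)
    fix a :: "'n \<Rightarrow> nat" assume a: "a \<in> {a. (\<Sum>i\<in>UNIV. a i) \<le> t}"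
    have "(\<Sum>i\<in>UNIV. (a(j := Suc (a j))) i) = (\<Sum>i\<in>UNIV. a i + (if i = j then 1 else 0))"
      by (intro sum.cong) auto
    also have "\<dots> = (\<Sum>i\<in>UNIV. a i) + 1" by (simp add: sum.distrib)
    finally show "(\<Sum>i\<in>UNIV. (a(j := Suc (a j))) i) \<le> Suc t" using a by simp
  qed
  also have "(\<lambda>x :: real ^ 'n. \<Sum>a | (\<Sum>i\<in>UNIV. a i) \<le> t. (c * e a) * (\<Prod>i\<in>UNIV. (x $ i) ^ (a(j := Suc (a j))) i)) =
      (\<lambda>x. c * (x $ j) * p x)"
  proof
    fix x :: "real ^ 'n"
    have "(\<Prod>i\<in>UNIV. (x $ i) ^ (a(j := Suc (a j))) i) = x $ j * (\<Prod>i\<in>UNIV. (x $ i) ^ a i)" for a :: "'n \<Rightarrow> nat"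
    proof -
      have "(\<Prod>i\<in>UNIV. (x $ i) ^ (a(j := Suc (a j))) i) = (\<Prod>i\<in>UNIV. (x $ i) ^ a i * (if i = j then x $ j else 1))"
        by (intro prod.cong) auto
      also have "\<dots> = x $ j * (\<Prod>i\<in>UNIV. (x $ i) ^ a i)" by (simp add: prod.distrib)
      finally show ?thesis .
    qed
    then show "(\<Sum>a | (\<Sum>i\<in>UNIV. a i) \<le> t. (c * e a) * (\<Prod>i\<in>UNIV. (x $ i) ^ (a(j := Suc (a j))) i)) = c * (x $ j) * p x"
      by (simp add: p sum_distrib_left mult_ac)
  qed
  finally show "poly_total_degree_le (Suc t) (\<lambda>x. c * (x $ j) * p x)" .
qed

lemma poly_total_degree_le_inner_power:
  fixes u :: "real ^ 'n::finite"
  assumes "k \<le> t"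
  shows "poly_total_degree_le t (\<lambda>x. (u \<bullet> x) ^ k)"
  using assms
proof (induction k arbitrary: t)
  case 0
  show ?case using poly_total_degree_le_monomial[of "\<lambda>_. 0" t 1] by simp
next
  case (Suc k)
  then obtain s where s: "t = Suc s" "k \<le> s" by (cases t) auto
  have "poly_total_degree_le (Suc s) (\<lambda>x. \<Sum>i\<in>UNIV. u $ i * (x $ i) * (u \<bullet> x) ^ k)"
    by (intro poly_total_degree_le_sum poly_total_degree_le_scale_coordinate Suc.IH s) auto
  also have "(\<lambda>x. \<Sum>i\<in>UNIV. u $ i * (x $ i) * (u \<bullet> x) ^ k) = (\<lambda>x. (u \<bullet> x) ^ Suc k)"
    by (simp add: inner_vec_def sum_distrib_right)
  finally show ?case by (simp add: s)
qed

lemma poly_total_degree_le_poly_inner: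
  fixes u :: "real ^ 'n::finite"
  assumes "degree q \<le> t"
  shows "poly_total_degree_le t (\<lambda>x. poly q (u \<bullet> x))"
  unfolding poly_altdef
  using assms by (intro poly_total_degree_le_sum poly_total_degree_le_scale_coordinate(2) poly_total_degree_le_inner_power) auto

section \<open>Support functions of self-polar Minkowski polytopes\<close>

lemma support_fun_upper:
  assumes "compact P" "y \<in> P"
  shows "u \<bullet> y \<le> support_fun P u"
proof -
  have "compact ((\<bullet>) u ` P)" using assms by (intro compact_continuous_image continuous_intros)
  then have "bdd_above ((\<bullet>) u ` P)" by (intro bounded_imp_bdd_above compact_imp_bounded)
  then show ?thesis unfolding support_fun_def using assms by (intro cSUP_upper)
qed

lemma support_fun_attained:
  assumes "compact P" "P \<noteq> {}"
  obtains y where "y \<in> P" "support_fun P u = u \<bullet> y"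
proof -
  have "continuous_on P (\<lambda>y. u \<bullet> y)" by (intro continuous_intros)
  from continuous_attains_sup[OF assms this]
  obtain y where y: "y \<in> P" "\<forall>z\<in>P. u \<bullet> z \<le> u \<bullet> y" by blast
  have "support_fun P u \<le> u \<bullet> y" unfolding support_fun_def using assms y by (intro cSUP_least) auto
  moreover have "u \<bullet> y \<le> support_fun P u" using support_fun_upper[OF assms(1) y(1)] .
  ultimately show ?thesis using that y by auto
qed

lemma continuous_support_fun:
  fixes P :: "(real ^ 'n::finite) set"
  assumes "compact P" "P \<noteq> {}"
  shows "continuous_on UNIV (support_fun P)"
proof -
  obtain B where B: "\<And>y. y \<in> P \<Longrightarrow> norm y \<le> B" using compact_imp_bounded[OF assms(1)] unfolding bounded_iff by auto
  obtain y0 where "y0 \<in> P" using assms by auto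
  then have B0: "B \<ge> 0" using B[of y0] norm_ge_zero[of y0] by linarith
  have one: "support_fun P u - support_fun P v \<le> B * dist u v" for u v
  proof -
    obtain y where y: "y \<in> P" "support_fun P u = u \<bullet> y" by (rule support_fun_attained[OF assms])
    have "(u - v) \<bullet> y \<le> norm (u - v) * norm y" by (rule norm_cauchy_schwarz)
    also have "\<dots> \<le> norm (u - v) * B" using B[OF y(1)] by (intro mult_left_mono) auto
    finally show ?thesis using y support_fun_upper[OF assms(1) y(1), of v]
      by (simp add: inner_diff_left dist_norm mult.commute)
  qed
  have "B-lipschitz_on UNIV (support_fun P)"
  proof (rule lipschitz_onI)
    fix u v show "dist (support_fun P u) (support_fun P v) \<le> B * dist u v"
      using one[of u v] one[of v u] by (simp add: dist_real_def dist_commute abs_le_iff)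
  qed (use B0 in auto)
  then show ?thesis by (rule lipschitz_on_continuous_on)
qed

text \<open>
  A segment from an interior point to a point outside \<open>P\<close> leaves \<open>P\<close> through a facet, and beyond that point
  it violates the inequality of the facet.
\<close>
lemma polytope_eq_wulff:
  fixes P :: "(real ^ 'n::finite) set"
  assumes P: "polytope P" "interior P \<noteq> {}" and X: "X \<subseteq> sphere 0 1"
    and bij: "bij_betw (face_in_direction P) X {F. F facet_of P}"
  shows "P = wulff X (support_fun P)"
proof (intro set_eqI iffI)
  have cP: "compact P" using P(1) by (rule polytope_imp_compact)
  show "y \<in> wulff X (support_fun P)" if "y \<in> P" for y
    using support_fun_upper[OF cP that] by (simp add: wulff_def)
  fix y assume y: "y \<in> wulff X (support_fun P)"
  show "y \<in> P"
  proof (rule ccontr)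
    assume nP: "y \<notin> P"
    obtain p where p: "p \<in> interior P" using P(2) by auto
    have "closed_segment p y \<inter> frontier P \<noteq> {}"
      using p interior_subset[of P] nP by (intro connected_Int_frontier) auto
    then obtain q where q: "q \<in> closed_segment p y" "q \<in> frontier P" by auto
    have "frontier P = P - rel_interior P"
      using cP P(2) by (simp add: frontier_def closure_closed compact_imp_closed rel_interior_nonempty_interior)
    also have "\<dots> = \<Union>{F. F facet_of P}"
      using P(1) by (intro rel_boundary_of_polyhedron polytope_imp_polyhedron)
    finally obtain F where F: "F facet_of P" "q \<in> F" using q by auto
    then obtain x where x: "x \<in> X" "F = face_in_direction P x"
      using bij unfolding bij_betw_def by (metis imageE mem_Collect_eq)
    have xq: "x \<bullet> q = support_fun P x" "q \<in> P" using F x by (auto simp: face_in_direction_def)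
    have nx: "norm x = 1" using X x by auto
    obtain e where e: "e > 0" "cball p e \<subseteq> P" using p by (metis interior_subset mem_interior_cball)
    have "p + e *\<^sub>R x \<in> P" using e nx by (auto simp: dist_norm)
    then have "x \<bullet> (p + e *\<^sub>R x) \<le> support_fun P x" by (rule support_fun_upper[OF cP])
    then have xp: "x \<bullet> p < support_fun P x" using nx e by (simp add: inner_add_right norm_eq_1)
    have xy: "x \<bullet> y \<le> support_fun P x" using y x by (simp add: wulff_def)
    obtain s where s: "0 \<le> s" "s \<le> 1" "q = (1 - s) *\<^sub>R p + s *\<^sub>R y"
      using q(1) by (auto simp: in_segment)
    have "s \<noteq> 1" using s nP xq(2) by auto
    then have "(1 - s) * (x \<bullet> p) < (1 - s) * support_fun P x" using xp s by (intro mult_strict_left_mono) auto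
    moreover have "s * (x \<bullet> y) \<le> s * support_fun P x" using xy s by (intro mult_left_mono) auto
    moreover have "support_fun P x = (1 - s) * (x \<bullet> p) + s * (x \<bullet> y)"
      using xq(1) s(3) by (simp add: inner_add_right)
    ultimately show False by (simp add: algebra_simps)
  qed
qed

text \<open>
  The uniqueness part of Minkowski's theorem, for \<open>P\<close> and its image under an isometry \<open>g\<close> that permutes
  the normals. The midpoint set of \<open>P\<close> and \<open>g ` P\<close> lies in the Wulff shape with the averaged support
  numbers. All facets of \<open>P\<close> have the same area and the support numbers keep their sum, so the first
  variation shows that this shape has no larger volume than \<open>P\<close>. This is the equality case of
  Brunn-Minkowski, and \<open>P\<close> and \<open>g ` P\<close> are translates. The vector \<open>w\<close> of the translation is \<open>0\<close>: both
  Steiner points vanish, so \<open>\<integral>(u \<bullet> w)\<^sup>2 = 0\<close>; the design property transfers this to \<open>X\<close>, where it makes \<open>w\<close>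
  orthogonal to all normals, which is impossible for a bounded polytope unless \<open>w = 0\<close>.
\<close>
lemma support_fun_invariant:
  fixes X P :: "(real ^ 'n::finite) set"
  assumes X: "spherical_design t X" "2 \<le> t" and P: "steiner_minkowski_polytope X P"
    and pos: "\<And>x. x \<in> X \<Longrightarrow> support_fun P x > 0"
    and g: "orthogonal_transformation g" "orthogonal_transformation (inv g)" "inv g ` X = X"
  shows "support_fun P (inv g u) = support_fun P u"
proof -
  let ?h = "support_fun P"
  have fin: "finite X" and sph: "X \<subseteq> sphere 0 1" using X by (auto simp: spherical_design_def)
  have mP: "polytope P" "interior P \<noteq> {}" "bij_betw (face_in_direction P) X {F. F facet_of P}"
    "\<And>x. x \<in> X \<Longrightarrow> hyperplane_area (face_in_direction P x) x = sphere_area CARD('n) / real (card X)"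
    and st: "steiner_point P = 0"
    using P by (auto simp: steiner_minkowski_polytope_def minkowski_polytope_def)
  have cP: "compact P" by (rule polytope_imp_compact[OF mP(1)])
  have xP: "convex P" by (rule polytope_imp_convex[OF mP(1)])
  have neP: "P \<noteq> {}" using mP(2) by auto
  have bP: "P \<in> sets borel" using cP by (rule borel_compact)
  have W: "P = wulff X ?h" by (rule polytope_eq_wulff[OF mP(1,2) sph mP(3)])
  have bd: "bounded (wulff X ?h)" using W cP compact_imp_bounded by metis
  have bij: "bij g" by (rule orthogonal_transformation_bij[OF g(1)])
  have lin: "linear g" using g(1) by (simp add: orthogonal_transformation_def)
  have ginv: "inv g (g y) = y" "g (inv g y) = y" for y
    using bij by (simp_all add: bij_is_inj bij_is_surj surj_f_inv_f)
  have adj: "u \<bullet> g y = inv g u \<bullet> y" for u y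
    using g(2) ginv(1)[of y] unfolding orthogonal_transformation_def by metis
  let ?L = "g ` P"
  have cL: "compact ?L" by (intro compact_continuous_image cP linear_continuous_on linear_conv_bounded_linear[THEN iffD1] lin)
  have xL: "convex ?L" by (rule convex_linear_image[OF lin xP])
  have iL: "interior ?L \<noteq> {}"
  proof -
    have "open (g ` interior P)" using open_bijective_linear_image_eq[OF lin bij] by simp
    moreover have "g ` interior P \<subseteq> ?L" using interior_subset by auto
    ultimately have "g ` interior P \<subseteq> interior ?L" by (rule interior_maximal[rotated])
    then show ?thesis using mP(2) by auto
  qed
  have lmP: "P \<in> lmeasurable" by (rule lmeasurable_compact[OF cP])
  have VL: "measure lborel ?L = measure lborel P"
    using measure_isometric_image(2)[OF g(1) lmP] borel_compact[OF cL] bP by (simp add: measure_completion)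
  have V0: "measure lborel (wulff X ?h) > 0"
  proof -
    obtain y where y: "y \<in> P" using neP by auto
    obtain x where x: "x \<in> X" using X(1) by (auto simp: spherical_design_def)
    have "cap_volume x P (x \<bullet> y - 1) < cap_volume x P (x \<bullet> y + 1)"
      by (rule cap_volume_strict[OF cP xP mP(2) y]) auto
    also have "\<dots> \<le> measure lborel P"
      unfolding cap_volume_def using bP by (intro measure_mono_compact[OF cP]) auto
    finally show ?thesis using W by (simp add: cap_volume_def) (metis measure_nonneg order_le_less_trans)
  qed
  have der: "((\<lambda>\<sigma>. measure lborel (wulff X (?h(x := ?h x + \<sigma>)))) has_real_derivative sphere_area CARD('n) / real (card X)) (at 0)"
    if x: "x \<in> X" for x
  proof -
    have "hyperplane_area (face_in_direction P x) x =
        measure lborel {y + s *\<^sub>R x | y s. y \<in> {y \<in> wulff X ?h. x \<bullet> y = ?h x} \<and> 0 \<le> s \<and> s \<le> 1}"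
      unfolding hyperplane_area_def face_in_direction_def using W by simp
    then show ?thesis
      using wulff_volume_derivative[OF fin sph pos bd x] mP(4)[OF x] by simp
  qed
  define k where "k x = (?h (inv g x) - ?h x) / 2" for x
  have injX: "inj_on (inv g) X" using bij by (meson bij_imp_bij_inv bij_is_inj inj_on_subset top_greatest)
  have "(\<Sum>x\<in>X. ?h (inv g x)) = (\<Sum>x\<in>inv g ` X. ?h x)" by (simp add: sum.reindex[OF injX])
  then have k0: "(\<Sum>x\<in>X. k x) = 0" using g(3) by (simp add: k_def sum_divide_distrib[symmetric] sum_subtractf)
  have le: "measure lborel (wulff X (\<lambda>x. ?h x + k x)) \<le> measure lborel (wulff X ?h)"
    by (rule wulff_volume_max[OF fin pos bd V0 der k0])
  let ?M = "(\<lambda>(x, y). (1/2) *\<^sub>R (x + y)) ` (P \<times> ?L)"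
  have "?M \<subseteq> wulff X (\<lambda>x. ?h x + k x)"
  proof
    fix z assume "z \<in> ?M"
    then obtain p q where z: "p \<in> P" "q \<in> P" "z = (1/2) *\<^sub>R (p + g q)" by auto
    show "z \<in> wulff X (\<lambda>x. ?h x + k x)"
      unfolding wulff_def
    proof (intro CollectI ballI)
      fix x assume "x \<in> X"
      have "x \<bullet> z = (x \<bullet> p + inv g x \<bullet> q) / 2" unfolding z by (simp add: inner_add_right adj)
      also have "\<dots> \<le> (?h x + ?h (inv g x)) / 2"
        using support_fun_upper[OF cP z(1), of x] support_fun_upper[OF cP z(2), of "inv g x"] by simp
      also have "\<dots> = ?h x + k x" by (simp add: k_def field_simps)
      finally show "x \<bullet> z \<le> ?h x + k x" .
    qed
  qed
  moreover have "compact ?M"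
    unfolding split_beta' by (intro compact_continuous_image compact_Times cP cL continuous_intros)
  moreover have "compact (wulff X (\<lambda>x. ?h x + k x))"
    using bounded_wulff[OF fin pos bd] closed_wulff by (simp add: compact_eq_bounded_closed)
  ultimately have "measure lborel ?M \<le> measure lborel (wulff X (\<lambda>x. ?h x + k x))"
    by (intro measure_mono_compact[of "wulff X (\<lambda>x. ?h x + k x)"]) (auto intro: borel_compact)
  then have "measure lborel ?M \<le> measure lborel P" using le W by simp
  from brunn_minkowski_midpoint_equality[OF cP xP mP(2) cL xL iL refl VL this]
  obtain w where w: "(SUP y\<in>P. u \<bullet> y) - (SUP y\<in>?L. u \<bullet> y) = u \<bullet> w" for u by auto
  have wh: "?h u - ?h (inv g u) = u \<bullet> w" for u
    using w[of u] by (simp add: support_fun_def image_image adj)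
  have "w = 0"
  proof -
    have contg: "continuous_on UNIV (inv g)"
      using g(2) by (intro linear_continuous_on linear_conv_bounded_linear[THEN iffD1]) (simp add: orthogonal_transformation_def)
    have ch: "continuous_on UNIV ?h" by (rule continuous_support_fun[OF cP neP])
    have chg: "continuous_on UNIV (\<lambda>u. ?h (inv g u))"
      by (rule continuous_on_compose2[OF ch contg]) auto
    have z1: "(LINT u|sphere_measure. ?h u *\<^sub>R u) = 0"
      using st by (simp add: steiner_point_def)
    have z2: "(LINT u|sphere_measure. ?h (inv g u) *\<^sub>R u) = 0"
    proof -
      have mg: "g \<in> measurable sphere_measure borel"
        using lin by (intro borel_measurable_continuous_onI[THEN measurable_cong_sets[THEN equalityD1, THEN subsetD, rotated 2]] linear_continuous_on linear_conv_bounded_linear[THEN iffD1]) auto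
      have "(LINT u|sphere_measure. ?h (inv g u) *\<^sub>R u) = (LINT u|distr sphere_measure borel g. ?h (inv g u) *\<^sub>R u)"
        by (simp add: sphere_measure_orthogonal[OF g(1)])
      also have "\<dots> = (LINT u|sphere_measure. ?h (inv g (g u)) *\<^sub>R g u)"
        by (rule integral_distr[OF mg]) (intro borel_measurable_continuous_onI continuous_intros chg)
      also have "\<dots> = (LINT u|sphere_measure. g (?h u *\<^sub>R u))"
        by (simp add: ginv linear_scale[OF lin])
      also have "\<dots> = g (LINT u|sphere_measure. ?h u *\<^sub>R u)"
        by (rule integral_bounded_linear[OF linear_conv_bounded_linear[THEN iffD1, OF lin]])
          (intro integrable_sphere_measure continuous_intros ch)
      finally show ?thesis using linear_0[OF lin] by (simp add: z1)
    qed
    have "(LINT u|sphere_measure. (u \<bullet> w)\<^sup>2) = (LINT u|sphere_measure. w \<bullet> (?h u *\<^sub>R u - ?h (inv g u) *\<^sub>R u))"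
      by (intro Bochner_Integration.integral_cong) (auto simp: wh[symmetric] power2_eq_square inner_commute[of w] algebra_simps)
    also have "\<dots> = w \<bullet> (LINT u|sphere_measure. ?h u *\<^sub>R u - ?h (inv g u) *\<^sub>R u)"
      by (intro integral_inner_right integrable_sphere_measure continuous_intros ch chg)
    also have "(LINT u|sphere_measure. ?h u *\<^sub>R u - ?h (inv g u) *\<^sub>R u) =
        (LINT u|sphere_measure. ?h u *\<^sub>R u) - (LINT u|sphere_measure. ?h (inv g u) *\<^sub>R u)"
      by (intro Bochner_Integration.integral_diff integrable_sphere_measure continuous_intros ch chg)
    also have "w \<bullet> \<dots> = 0" by (simp add: z1 z2)
    finally have "(LINT u|sphere_measure. (w \<bullet> u)\<^sup>2) = 0" by (simp add: inner_commute)
    moreover have "poly_total_degree_le t (\<lambda>u. (w \<bullet> u)\<^sup>2)"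
      using X(2) by (rule poly_total_degree_le_inner_power)
    ultimately have "(\<Sum>x\<in>X. (w \<bullet> x)\<^sup>2) = 0"
      using X(1) fin by (auto simp: spherical_design_def)
    then have wx: "w \<bullet> x = 0" if "x \<in> X" for x
      using that fin by (simp add: sum_nonneg_eq_0_iff)
    obtain B where B: "\<And>y. y \<in> wulff X ?h \<Longrightarrow> norm y \<le> B" using bd unfolding bounded_iff by auto
    have "s *\<^sub>R w \<in> wulff X ?h" for s
      using wx pos by (auto simp: wulff_def inner_commute less_imp_le)
    then have ns: "\<bar>s\<bar> * norm w \<le> B" for s using B[of "s *\<^sub>R w"] by simp
    show "w = 0"
    proof (rule ccontr)
      assume "w \<noteq> 0"
      then have "\<bar>(\<bar>B\<bar> + 1) / norm w\<bar> * norm w = \<bar>B\<bar> + 1" by simp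
      then show False using ns[of "(\<bar>B\<bar> + 1) / norm w"] by linarith
    qed
  qed
  then show ?thesis using wh[of u] by simp
qed

text \<open>
  By transitivity and the invariance above, the support function has one value \<open>\<eta>\<close> on \<open>X\<close>. Hence \<open>P\<close>
  contains the ball of radius \<open>\<eta>\<close>, and by self-polarity it is contained in the ball of radius
  \<open>1 / (c * \<eta>)\<close>; thus \<open>c * \<eta>\<^sup>2\<close> is at most the ratio of the radii. Polarity also gives
  \<open>y / \<eta> = c U p\<close> with \<open>p \<in> P\<close>, so that \<open>U x \<bullet> y = c * \<eta> * (x \<bullet> p) \<le> c * \<eta>\<^sup>2\<close>.
\<close>
lemma self_polar_inner_le:
  fixes X P :: "(real ^ 'n::finite) set"
  assumes X: "spherical_design t X" "2 \<le> t" "node_transitive X" and P: "steiner_minkowski_polytope X P"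
    and c: "c > 0" and U: "orthogonal_transformation U" and polar: "polar P = (\<lambda>y. c *\<^sub>R U y) ` P"
    and xy: "x \<in> X" "y \<in> X"
  shows "U x \<bullet> y \<le> centered_inradius P / centered_circumradius P"
proof -
  let ?h = "support_fun P"
  have sph: "X \<subseteq> sphere 0 1" using X by (auto simp: spherical_design_def)
  have mP: "polytope P" "interior P \<noteq> {}" "bij_betw (face_in_direction P) X {F. F facet_of P}"
    using P by (auto simp: steiner_minkowski_polytope_def minkowski_polytope_def)
  have cP: "compact P" by (rule polytope_imp_compact[OF mP(1)])
  have neP: "P \<noteq> {}" using mP(2) by auto
  have W: "P = wulff X ?h" by (rule polytope_eq_wulff[OF mP(1,2) sph mP(3)])
  obtain B where B: "\<And>y. y \<in> P \<Longrightarrow> norm y \<le> B" using compact_imp_bounded[OF cP] unfolding bounded_iff by auto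
  \<comment> \<open>otherwise the polar would contain the ray spanned by \<open>z\<close>, but it is a bounded image of \<open>P\<close>\<close>
  have pos: "?h z > 0" if z: "z \<in> X" for z
  proof (rule ccontr)
    assume neg: "\<not> ?thesis"
    have nz: "norm z = 1" using z sph by auto
    have s: "s *\<^sub>R z \<in> polar P" if "s \<ge> 0" for s
      unfolding polar_def
    proof (intro CollectI ballI)
      fix y assume "y \<in> P"
      then have "z \<bullet> y \<le> 0" using support_fun_upper[OF cP, of y z] neg by simp
      then have "s * (z \<bullet> y) \<le> 0" using that by (simp add: mult_nonneg_nonpos)
      then show "s *\<^sub>R z \<bullet> y \<le> 1" by simp
    qed
    have "(c * \<bar>B\<bar> + 1) *\<^sub>R z \<in> polar P" using c by (intro s) auto
    then obtain p where p: "p \<in> P" "(c * \<bar>B\<bar> + 1) *\<^sub>R z = c *\<^sub>R U p" unfolding polar by auto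
    have "norm ((c * \<bar>B\<bar> + 1) *\<^sub>R z) = c * norm p"
      unfolding p(2) using c orthogonal_transformation_norm[OF U] by simp
    moreover have "norm ((c * \<bar>B\<bar> + 1) *\<^sub>R z) = c * \<bar>B\<bar> + 1" using c nz by simp
    moreover have "c * norm p \<le> c * \<bar>B\<bar>" using B[OF p(1)] c by (intro mult_left_mono) auto
    ultimately show False by simp
  qed
  define \<eta> where "\<eta> = ?h x"
  have \<eta>pos: "\<eta> > 0" using pos xy by (simp add: \<eta>_def)
  have const: "?h z = \<eta>" if z: "z \<in> X" for z
  proof -
    obtain G where G: "orthogonal_subgroup G" "\<forall>g\<in>G. g ` X = X" "\<forall>x\<in>X. \<forall>y\<in>X. \<exists>g\<in>G. g x = y"
      using X(3) unfolding node_transitive_def by (elim exE conjE) (rule that)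
    obtain g where g: "g \<in> G" "g z = x" using G(3) z xy(1) by metis
    have orth: "orthogonal_transformation g" "inv g \<in> G" using G(1) g by (auto simp: orthogonal_subgroup_def)
    then have orth': "orthogonal_transformation (inv g)" using G(1) by (auto simp: orthogonal_subgroup_def)
    have "?h (inv g x) = ?h x"
      by (rule support_fun_invariant[OF X(1,2) P pos orth(1) orth' bspec[OF G(2) orth(2)]])
    moreover have "inv g x = z"
      using g(2) orthogonal_transformation_bij[OF orth(1)] by (metis bij_is_inj inv_f_f)
    ultimately show ?thesis by (simp add: \<eta>_def)
  qed
  have ball: "cball 0 \<eta> \<subseteq> P"
  proof
    fix z :: "real ^ 'n" assume z: "z \<in> cball 0 \<eta>"
    have "v \<bullet> z \<le> ?h v" if v: "v \<in> X" for v
    proof -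
      have "v \<bullet> z \<le> norm v * norm z" by (rule norm_cauchy_schwarz)
      also have "\<dots> \<le> \<eta>" using v sph z by auto
      finally show ?thesis using const[OF v] by simp
    qed
    then show "z \<in> P" by (subst W) (simp add: wulff_def)
  qed
  have nx: "norm x = 1" using xy sph by auto
  have r: "\<eta> \<le> centered_inradius P"
    unfolding centered_inradius_def
  proof (rule cSup_upper)
    show "\<eta> \<in> {\<rho>. 0 \<le> \<rho> \<and> cball 0 \<rho> \<subseteq> P}" using ball \<eta>pos by simp
    show "bdd_above {\<rho>. 0 \<le> \<rho> \<and> cball 0 \<rho> \<subseteq> P}"
    proof (rule bdd_aboveI)
      fix \<rho> assume \<rho>: "\<rho> \<in> {\<rho>. 0 \<le> \<rho> \<and> cball 0 \<rho> \<subseteq> P}"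
      then have "\<rho> *\<^sub>R x \<in> P" using nx by (auto simp: subset_eq)
      then show "\<rho> \<le> B" using B[of "\<rho> *\<^sub>R x"] nx \<rho> by simp
    qed
  qed
  have PR: "P \<subseteq> cball 0 (1 / (c * \<eta>))"
  proof
    fix p assume p: "p \<in> P"
    show "p \<in> cball 0 (1 / (c * \<eta>))"
    proof (cases "p = 0")
      case True then show ?thesis using c \<eta>pos by simp
    next
      case False
      have "(\<eta> / norm p) *\<^sub>R U p \<in> cball 0 \<eta>"
        using orthogonal_transformation_norm[OF U] False \<eta>pos by simp
      then have q: "(\<eta> / norm p) *\<^sub>R U p \<in> P" using ball by auto
      have "c *\<^sub>R U p \<in> polar P" unfolding polar using p by auto
      then have "(c *\<^sub>R U p) \<bullet> ((\<eta> / norm p) *\<^sub>R U p) \<le> 1" using q unfolding polar_def by blast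
      moreover have "U p \<bullet> U p = norm p * norm p"
        using orthogonal_transformation_norm[OF U, of p] by (simp add: dot_square_norm power2_eq_square)
      ultimately have "c * \<eta> * norm p \<le> 1" using False by (simp add: mult_ac)
      then show ?thesis using c \<eta>pos by (simp add: field_simps)
    qed
  qed
  have R: "centered_circumradius P \<le> 1 / (c * \<eta>)"
    unfolding centered_circumradius_def
    by (rule cInf_lower) (use PR c \<eta>pos in \<open>auto intro: bdd_belowI[of _ 0]\<close>)
  have R0: "\<eta> \<le> centered_circumradius P"
    unfolding centered_circumradius_def
  proof (rule cInf_greatest)
    show "{\<rho>. 0 \<le> \<rho> \<and> P \<subseteq> cball 0 \<rho>} \<noteq> {}" using PR c \<eta>pos by (intro ex_in_conv[THEN iffD1] exI[of _ "1 / (c * \<eta>)"]) simp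
    fix \<rho> assume "\<rho> \<in> {\<rho>. 0 \<le> \<rho> \<and> P \<subseteq> cball 0 \<rho>}"
    moreover have "\<eta> *\<^sub>R x \<in> P" using ball nx \<eta>pos by (auto simp: subset_eq)
    ultimately have "norm (\<eta> *\<^sub>R x) \<le> \<rho>" by (auto simp: subset_eq)
    then show "\<eta> \<le> \<rho>" using nx \<eta>pos by simp
  qed
  have "c * \<eta> * \<eta> = \<eta> / (1 / (c * \<eta>))" by simp
  also have "\<dots> \<le> centered_inradius P / centered_circumradius P"
    using r R R0 \<eta>pos by (intro frac_le) auto
  finally have \<alpha>: "c * \<eta> * \<eta> \<le> centered_inradius P / centered_circumradius P" .
  have "(1 / \<eta>) *\<^sub>R y \<in> polar P"
    unfolding polar_def
  proof (intro CollectI ballI)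
    fix z assume "z \<in> P"
    then have "y \<bullet> z \<le> \<eta>" using support_fun_upper[OF cP, of z y] const[OF xy(2)] by simp
    then show "(1 / \<eta>) *\<^sub>R y \<bullet> z \<le> 1" using \<eta>pos by (simp add: field_simps)
  qed
  then obtain p where p: "p \<in> P" "(1 / \<eta>) *\<^sub>R y = c *\<^sub>R U p" unfolding polar by auto
  have "y = \<eta> *\<^sub>R ((1 / \<eta>) *\<^sub>R y)" using \<eta>pos by simp
  then have "U x \<bullet> y = c * \<eta> * (U x \<bullet> U p)" unfolding p(2) by (metis inner_scaleR_right mult.assoc mult.commute)
  also have "U x \<bullet> U p = x \<bullet> p" using U by (simp add: orthogonal_transformation_def)
  also have "c * \<eta> * (x \<bullet> p) \<le> c * \<eta> * \<eta>"
    using support_fun_upper[OF cP p(1), of x] c \<eta>pos by (intro mult_left_mono) (auto simp: \<eta>_def)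
  finally show ?thesis using \<alpha> by simp
qed

section \<open>Zonal integrals over the sphere\<close>

text \<open>
  Up to a constant, the density of the first coordinate of a uniform point in the unit ball of dimension
  \<open>d\<close>; the weight for the sphere is the one of the ball in dimension \<open>d - 2\<close>.
\<close>
definition ball_weight :: "nat \<Rightarrow> real \<Rightarrow> real" where
  "ball_weight d s = (1 - s\<^sup>2) powr ((real d - 1) / 2)"

definition sphere_weight :: "nat \<Rightarrow> real \<Rightarrow> real" where
  "sphere_weight d s = (1 - s\<^sup>2) powr ((real d - 3) / 2)"

lemma sphere_weight_measurable [measurable]: "sphere_weight d \<in> borel_measurable borel"
  unfolding sphere_weight_def by measurable

lemma ball_weight_measurable [measurable]: "ball_weight d \<in> borel_measurable borel"
  unfolding ball_weight_def by measurable

lemma continuous_ball_weight: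
  assumes "d \<ge> 2"
  shows "continuous_on {-1..1} (\<lambda>s. s ^ k * ball_weight d s)"
proof -
  have "1 - s\<^sup>2 \<ge> 0" if "s \<in> {-1..1}" for s :: real
    using that by (simp add: abs_square_le_1 abs_le_iff)
  then show ?thesis
    unfolding ball_weight_def using assms
    by (intro continuous_intros continuous_on_powr') auto
qed

text \<open>
  The fundamental theorem of calculus for \<open>s\<^bsup>k+1\<^esup> (1 - s\<^sup>2)\<^bsup>(d-1)/2\<^esup>\<close>, which vanishes at both ends. For
  \<open>d = 2\<close> the weight of the sphere is unbounded at the ends, but the primitive is still continuous there.
\<close>
lemma weight_parts:
  assumes d: "d \<ge> 2"
  shows "((\<lambda>s. s ^ k * sphere_weight d s) has_integral
      (real (k + d) / (real d - 1)) * integral {-1..1} (\<lambda>s. s ^ k * ball_weight d s)) {-1..1}"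
proof -
  let ?F = "\<lambda>s. s ^ Suc k * ball_weight d s"
  let ?f = "\<lambda>s. real (k + d) * (s ^ k * ball_weight d s) - (real d - 1) * (s ^ k * sphere_weight d s)"
  have "(?f has_integral (?F 1 - ?F (-1))) {-1..1}"
  proof (rule fundamental_theorem_of_calculus_interior)
    show "continuous_on {-1..1} ?F" by (rule continuous_ball_weight[OF d])
    fix s :: real assume s: "s \<in> {-1<..<1}"
    then have p: "1 - s\<^sup>2 > 0" by (simp add: abs_square_less_1 abs_less_iff)
    have D1: "((\<lambda>s. s ^ Suc k) has_real_derivative real (Suc k) * s ^ k) (at s)"
      using DERIV_pow[of "Suc k" s] by simp
    have D2: "(ball_weight d has_real_derivative (real d - 1) / 2 * (1 - s\<^sup>2) powr ((real d - 1) / 2 - 1) * (- 2 * s)) (at s)"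
      unfolding ball_weight_def
      using p by (auto intro!: derivative_eq_intros)
    have D: "(?F has_real_derivative
        real (Suc k) * s ^ k * ball_weight d s + (real d - 1) / 2 * (1 - s\<^sup>2) powr ((real d - 1) / 2 - 1) * (- 2 * s) * s ^ Suc k) (at s)"
      by (rule DERIV_mult[OF D1 D2])
    have pw: "(1 - s\<^sup>2) powr ((real d - 1) / 2 - 1) = sphere_weight d s"
      unfolding sphere_weight_def by (rule arg_cong[where f = "\<lambda>e. (1 - s\<^sup>2) powr e"]) (simp add: field_simps)
    have bw: "ball_weight d s = (1 - s\<^sup>2) * sphere_weight d s"
    proof -
      have "(1 - s\<^sup>2) powr ((real d - 1) / 2) = (1 - s\<^sup>2) powr (1 + (real d - 3) / 2)"
        by (rule arg_cong[where f = "\<lambda>e. (1 - s\<^sup>2) powr e"]) (simp add: field_simps)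
      then show ?thesis using p by (simp add: ball_weight_def sphere_weight_def powr_add)
    qed
    have alg: "real (Suc k) * s ^ k * ((1 - s\<^sup>2) * w) + (real d - 1) / 2 * w * (- 2 * s) * s ^ Suc k =
        real (k + d) * (s ^ k * ((1 - s\<^sup>2) * w)) - (real d - 1) * (s ^ k * w)" for w
      by (simp add: field_simps power2_eq_square)
    have "(?F has_real_derivative ?f s) (at s)"
      using D unfolding pw bw alg .
    then show "(?F has_vector_derivative ?f s) (at s)"
      by (simp add: has_real_derivative_iff_has_vector_derivative)
  qed simp
  then have "(?f has_integral 0) {-1..1}" by (simp add: ball_weight_def)
  moreover have "((\<lambda>s. s ^ k * ball_weight d s) has_integral integral {-1..1} (\<lambda>s. s ^ k * ball_weight d s)) {-1..1}"
    by (intro integrable_integral integrable_continuous_interval continuous_ball_weight d)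
  then have "((\<lambda>s. real (k + d) * (s ^ k * ball_weight d s)) has_integral real (k + d) * integral {-1..1} (\<lambda>s. s ^ k * ball_weight d s)) {-1..1}"
    by (rule has_integral_mult_right)
  ultimately have "((\<lambda>s. real (k + d) * (s ^ k * ball_weight d s) - ?f s) has_integral
      real (k + d) * integral {-1..1} (\<lambda>s. s ^ k * ball_weight d s) - 0) {-1..1}"
    by (rule has_integral_diff[rotated])
  then have "((\<lambda>s. (1 / (real d - 1)) * (real (k + d) * (s ^ k * ball_weight d s) - ?f s)) has_integral
      (1 / (real d - 1)) * (real (k + d) * integral {-1..1} (\<lambda>s. s ^ k * ball_weight d s) - 0)) {-1..1}"
    by (rule has_integral_mult_right)
  then show ?thesis using d by simp
qed

text \<open>
  Up to a factor independent of \<open>k\<close>, the ratio of the moments of the two weights is \<open>(k + d) / d\<close>, the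
  ratio of the \<open>k\<close>-th moments of a coordinate on the sphere and in the ball (see \<open>cball_moment_polar\<close>).
\<close>
lemma sphere_weight_integrable:
  assumes d: "d \<ge> 2"
  shows "integrable lborel (\<lambda>s. indicator {-1..1} s * (s ^ k * sphere_weight d s))"
    and "(LINT s|lborel. indicator {-1..1} s * (s ^ k * sphere_weight d s)) =
      (real (k + d) / (real d - 1)) * (LINT s|lborel. indicator {-1..1} s * (s ^ k * ball_weight d s))"
proof -
  have "sphere_weight d integrable_on {-1..1}"
    using has_integral_integrable[OF weight_parts[OF d, of 0]] by simp
  then have "sphere_weight d absolutely_integrable_on {-1..1}"
    by (intro nonnegative_absolutely_integrable_1) (auto simp: sphere_weight_def)
  then have "integrable lebesgue (\<lambda>s. indicator {-1..1} s * sphere_weight d s)"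
    by (simp add: set_integrable_def)
  then have w: "integrable lborel (\<lambda>s. indicator {-1..1} s * sphere_weight d s)"
    by (subst (asm) integrable_completion) auto
  show i: "integrable lborel (\<lambda>s. indicator {-1..1} s * (s ^ k * sphere_weight d s))"
  proof (rule Bochner_Integration.integrable_bound[OF w])
    show "AE s in lborel. norm (indicator {-1..1} s * (s ^ k * sphere_weight d s)) \<le> norm (indicator {-1..1} s * sphere_weight d s)"
    proof (intro AE_I2)
      fix s :: real
      have "\<bar>s ^ k\<bar> \<le> 1" if "s \<in> {-1..1}" using that by (simp add: power_abs power_le_one abs_le_iff)
      then show "norm (indicator {-1..1} s * (s ^ k * sphere_weight d s)) \<le> norm (indicator {-1..1} s * sphere_weight d s)"
        by (auto simp: indicator_def abs_mult intro!: mult_left_le_one_le)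
    qed
  qed measurable
  have "set_integrable lborel {-1..1} (\<lambda>s. s ^ k * sphere_weight d s)" using i by (simp add: set_integrable_def)
  from set_borel_integral_eq_integral(2)[OF this]
  have 1: "(LINT s|lborel. indicator {-1..1} s * (s ^ k * sphere_weight d s)) = integral {-1..1} (\<lambda>s. s ^ k * sphere_weight d s)"
    by (simp add: set_lebesgue_integral_def)
  have "set_integrable lborel {-1..1} (\<lambda>s. s ^ k * ball_weight d s)"
    unfolding set_integrable_def by (intro borel_integrable_compact continuous_ball_weight d) auto
  from set_borel_integral_eq_integral(2)[OF this]
  have 2: "(LINT s|lborel. indicator {-1..1} s * (s ^ k * ball_weight d s)) = integral {-1..1} (\<lambda>s. s ^ k * ball_weight d s)"
    by (simp add: set_lebesgue_integral_def)
  show "(LINT s|lborel. indicator {-1..1} s * (s ^ k * sphere_weight d s)) =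
      (real (k + d) / (real d - 1)) * (LINT s|lborel. indicator {-1..1} s * (s ^ k * ball_weight d s))"
    unfolding 1 2 by (rule integral_unique[OF weight_parts[OF d]])
qed

text \<open>
  A nonzero polynomial has finitely many zeros, so a nonnegative one has positive integral.
\<close>
lemma sphere_weight_total_pos:
  assumes d: "d \<ge> 2" and q: "q \<noteq> 0" "\<And>s. s \<in> {-1<..<1} \<Longrightarrow> poly q s \<ge> 0"
    and int: "integrable lborel (\<lambda>s. indicator {-1..1} s * sphere_weight d s * poly q s)"
  shows "(LINT s|lborel. indicator {-1..1} s * sphere_weight d s * poly q s) > 0"
proof -
  let ?f = "\<lambda>s. indicator {-1..1} s * sphere_weight d s * poly q s"
  have nn: "?f s \<ge> 0" for s
  proof (cases "s \<in> {-1<..<1}")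
    case True
    then show ?thesis using q(2)[OF True] by (simp add: sphere_weight_def)
  next
    case False
    then have "s \<in> {-1..1} \<Longrightarrow> s\<^sup>2 = 1" by (auto simp: power2_eq_1_iff)
    then show ?thesis by (auto simp: indicator_def sphere_weight_def)
  qed
  have "(LINT s|lborel. ?f s) \<noteq> 0"
  proof
    assume "(LINT s|lborel. ?f s) = 0"
    then have ae: "AE s in lborel. ?f s = 0"
      using int nn by (subst (asm) integral_nonneg_eq_0_iff_AE) auto
    have "finite {s. poly q s = 0}" using q(1) by (rule poly_roots_finite)
    then have "AE s in lborel. s \<notin> {s. poly q s = 0}"
      by (intro AE_not_in finite_imp_null_set_lborel)
    with ae have "AE s in lborel. s \<notin> {-1<..<1::real}"
    proof eventually_elim
      case (elim s)
      show ?case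
      proof
        assume s: "s \<in> {-1<..<1}"
        then have "1 - s\<^sup>2 > 0" by (simp add: abs_square_less_1 abs_less_iff)
        then have "sphere_weight d s > 0" by (simp add: sphere_weight_def)
        then show False using elim s by auto
      qed
    qed
    then have "emeasure lborel {-1<..<1::real} = 0"
      by (subst (asm) AE_iff_measurable[of "{-1<..<1}"]) auto
    then show False by simp
  qed
  moreover have "(LINT s|lborel. ?f s) \<ge> 0" using nn by (intro integral_nonneg_AE) auto
  ultimately show ?thesis by simp
qed

lemma coord_measure_density:
  "coord_measure d = density lborel (\<lambda>s. ennreal (indicator {-1..1} s * sphere_weight d s /
     (LINT s|lborel. indicator {-1..1} s * sphere_weight d s)))"
  by (simp add: coord_measure_def sphere_weight_def set_lebesgue_integral_def)

lemma sets_coord_measure [measurable_cong, simp]: "sets (coord_measure d) = sets borel"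
  by (simp add: coord_measure_def)

lemma weight_poly_integrable:
  assumes d: "d \<ge> 2"
  shows "integrable lborel (\<lambda>s. indicator {-1..1} s * sphere_weight d s * poly q s)"
proof -
  have eq: "(\<lambda>s. indicator {-1..1} s * sphere_weight d s * poly q s) =
      (\<lambda>s. \<Sum>k\<le>degree q. coeff q k * (indicator {-1..1} s * (s ^ k * sphere_weight d s)))"
    by (simp add: poly_altdef sum_distrib_left mult_ac)
  show ?thesis unfolding eq
    by (intro Bochner_Integration.integrable_sum integrable_mult_right sphere_weight_integrable d)
qed

lemma coord_measure_integral:
  assumes d: "d \<ge> 2"
  defines "J \<equiv> LINT s|lborel. indicator {-1..1} s * sphere_weight d s"
  shows "J > 0"
    and "integrable (coord_measure d) (poly q)"
    and "(LINT s|coord_measure d. poly q s) = (LINT s|lborel. indicator {-1..1} s * sphere_weight d s * poly q s) / J"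
proof -
  have "(LINT s|lborel. indicator {-1..1} s * sphere_weight d s * poly 1 s) > 0"
    using d by (intro sphere_weight_total_pos weight_poly_integrable) auto
  then show J: "J > 0" by (simp add: J_def)
  have nn: "AE s in lborel. 0 \<le> indicator {-1..1} s * sphere_weight d s / J"
    using J by (auto simp: sphere_weight_def)
  have [measurable]: "poly q \<in> borel_measurable borel"
    by (intro borel_measurable_continuous_onI continuous_intros)
  have eq: "coord_measure d = density lborel (\<lambda>s. ennreal (indicator {-1..1} s * sphere_weight d s / J))"
    unfolding J_def by (rule coord_measure_density)
  have "integrable lborel (\<lambda>s. (indicator {-1..1} s * sphere_weight d s * poly q s) / J)"
    using weight_poly_integrable[OF d] by simp
  then show "integrable (coord_measure d) (poly q)"
    unfolding eq using nn by (subst integrable_real_density) (auto simp: mult_ac)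
  have "(LINT s|coord_measure d. poly q s) = (LINT s|lborel. (indicator {-1..1} s * sphere_weight d s * poly q s) / J)"
    unfolding eq using nn by (subst integral_real_density) (auto simp: mult_ac)
  then show "(LINT s|coord_measure d. poly q s) = (LINT s|lborel. indicator {-1..1} s * sphere_weight d s * poly q s) / J"
    by simp
qed

lemma coord_measure_pos:
  assumes d: "d \<ge> 2" and q: "q \<noteq> 0" "\<And>s. s \<in> {-1<..<1} \<Longrightarrow> poly q s \<ge> 0"
  shows "(LINT s|coord_measure d. poly q s) > 0"
  using sphere_weight_total_pos[OF d q weight_poly_integrable[OF d]] coord_measure_integral[OF d] by simp

text \<open>
  Slicing the ball orthogonally to \<open>e\<close>: the slice at height \<open>y\<close> is a ball of radius \<open>sqrt (1 - y\<^sup>2)\<close> in one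
  dimension less.
\<close>
lemma cball_coordinate_distr:
  fixes e :: "real ^ 'n::finite"
  assumes e: "e \<in> Basis"
  shows "distr (density lborel (indicator (cball 0 1 :: (real ^ 'n) set))) borel (\<lambda>x. e \<bullet> x) =
    density lborel (\<lambda>s. ennreal (unit_ball_vol (real (CARD('n) - 1)) * (indicator {-1..1} s * ball_weight CARD('n) s)))"
proof (rule measure_eqI)
  fix A :: "real set" assume "A \<in> sets (distr (density lborel (indicator (cball 0 1 :: (real ^ 'n) set))) borel (\<lambda>x. e \<bullet> x))"
  then have A [measurable]: "A \<in> sets borel" by simp
  let ?I = "Basis - {e} :: (real ^ 'n) set"
  let ?M = "\<lambda>I. \<Pi>\<^sub>M b\<in>(I :: (real ^ 'n) set). lborel :: real measure"
  interpret product_sigma_finite "\<lambda>_. lborel :: real measure" by standard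
  have [measurable, simp]: "indicator (cball 0 1 :: (real ^ 'n) set) \<in> borel_measurable borel"
    by (intro borel_measurable_indicator) simp
  have ins: "insert e ?I = Basis" "finite ?I" "e \<notin> ?I" using e by auto
  have cardI: "card ?I = CARD('n) - 1" using e by (simp add: card_Diff_singleton)
  have CARD1: "CARD('n) \<ge> 1" by (simp add: Suc_leI)
  let ?v = "unit_ball_vol (real (CARD('n) - 1))"
  let ?S = "\<lambda>r. {f. sqrt (\<Sum>i\<in>?I. (f i)\<^sup>2) \<le> r} \<inter> space (?M ?I)"
  have "emeasure (distr (density lborel (indicator (cball 0 1))) borel (\<lambda>x. e \<bullet> x)) A =
      (\<integral>\<^sup>+x. indicator (cball 0 1) x * indicator A (e \<bullet> x) \<partial>lborel)"
  proof -
    have "(\<lambda>x. e \<bullet> x) -` A \<in> sets borel"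
      using measurable_sets[OF borel_measurable_inner[OF borel_measurable_const measurable_ident], of A e] A by simp
    then have "emeasure (distr (density lborel (indicator (cball 0 1))) borel (\<lambda>x. e \<bullet> x)) A =
        (\<integral>\<^sup>+x. indicator (cball 0 1) x * indicator ((\<lambda>x. e \<bullet> x) -` A) x \<partial>lborel)"
      by (subst emeasure_distr) (simp_all add: emeasure_density)
    then show ?thesis by (simp add: indicator_def)
  qed
  also have "\<dots> = (\<integral>\<^sup>+f. indicator (cball 0 1) (\<Sum>b\<in>Basis. f b *\<^sub>R b) * indicator A (e \<bullet> (\<Sum>b\<in>Basis. f b *\<^sub>R b)) \<partial>?M Basis)"
    by (subst lborel_eq, subst nn_integral_distr) auto
  also have "\<dots> = (\<integral>\<^sup>+f. indicator {f. sqrt (\<Sum>b\<in>Basis. (f b)\<^sup>2) \<le> 1} f * indicator A (f e) \<partial>?M Basis)"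
  proof (intro nn_integral_cong)
    fix f :: "real ^ 'n \<Rightarrow> real"
    have "e \<bullet> (\<Sum>b\<in>Basis. f b *\<^sub>R b) = f e" using e by (simp add: inner_sum_right inner_Basis if_distrib cong: if_cong)
    moreover have "norm (\<Sum>b\<in>Basis. f b *\<^sub>R b) = sqrt (\<Sum>b\<in>Basis. (f b)\<^sup>2)"
      unfolding norm_eq_sqrt_inner
      by (subst euclidean_inner) (simp add: inner_sum_left inner_Basis if_distrib power2_eq_square cong: if_cong)
    ultimately show "indicator (cball 0 1) (\<Sum>b\<in>Basis. f b *\<^sub>R b) * indicator A (e \<bullet> (\<Sum>b\<in>Basis. f b *\<^sub>R b)) =
        (indicator {f. sqrt (\<Sum>b\<in>Basis. (f b)\<^sup>2) \<le> 1} f * indicator A (f e) :: ennreal)"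
      by (simp add: indicator_def)
  qed
  also have "\<dots> = (\<integral>\<^sup>+y. \<integral>\<^sup>+f. indicator {f. sqrt (\<Sum>b\<in>Basis. (f b)\<^sup>2) \<le> 1} (f(e := y)) * indicator A ((f(e := y)) e) \<partial>?M ?I \<partial>lborel)"
    by (subst ins(1)[symmetric], rule product_nn_integral_insert_rev[OF ins(2,3)]) (unfold ins(1), use e in measurable)
  also have "\<dots> = (\<integral>\<^sup>+y. indicator A y * (indicator {-1..1} y * emeasure (?M ?I) (?S (sqrt (1 - y\<^sup>2)))) \<partial>lborel)"
  proof (intro nn_integral_cong)
    fix y :: real
    have "(\<integral>\<^sup>+f. indicator {f. sqrt (\<Sum>b\<in>Basis. (f b)\<^sup>2) \<le> 1} (f(e := y)) * indicator A ((f(e := y)) e) \<partial>?M ?I) =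
        (\<integral>\<^sup>+f. (indicator A y * indicator {-1..1} y) * indicator (?S (sqrt (1 - y\<^sup>2))) f \<partial>?M ?I)"
    proof (intro nn_integral_cong)
      fix f assume f: "f \<in> space (?M ?I)"
      have "(\<Sum>b\<in>Basis. ((f(e := y)) b)\<^sup>2) = (\<Sum>b\<in>insert e ?I. ((f(e := y)) b)\<^sup>2)" by (simp only: ins(1))
      also have "\<dots> = y\<^sup>2 + (\<Sum>b\<in>?I. ((f(e := y)) b)\<^sup>2)" by (subst sum.insert) auto
      also have "(\<Sum>b\<in>?I. ((f(e := y)) b)\<^sup>2) = (\<Sum>b\<in>?I. (f b)\<^sup>2)" by (intro sum.cong) auto
      finally have s: "(\<Sum>b\<in>Basis. ((f(e := y)) b)\<^sup>2) = y\<^sup>2 + (\<Sum>b\<in>?I. (f b)\<^sup>2)" .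
      have nn: "(\<Sum>b\<in>?I. (f b)\<^sup>2) \<ge> 0" by (intro sum_nonneg) auto
      have "sqrt (y\<^sup>2 + (\<Sum>b\<in>?I. (f b)\<^sup>2)) \<le> 1 \<longleftrightarrow> y \<in> {-1..1} \<and> sqrt (\<Sum>b\<in>?I. (f b)\<^sup>2) \<le> sqrt (1 - y\<^sup>2)"
      proof -
        have "y\<^sup>2 \<le> 1 \<longleftrightarrow> y \<in> {-1..1}" by (auto simp: abs_square_le_1 abs_le_iff)
        then show ?thesis using nn by (auto simp: real_sqrt_le_iff)
      qed
      then show "indicator {f. sqrt (\<Sum>b\<in>Basis. (f b)\<^sup>2) \<le> 1} (f(e := y)) * indicator A ((f(e := y)) e) =
          (indicator A y * indicator {-1..1} y * indicator (?S (sqrt (1 - y\<^sup>2))) f :: ennreal)"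
        using f s by (simp add: indicator_def)
    qed
    also have "\<dots> = (indicator A y * indicator {-1..1} y) * (\<integral>\<^sup>+f. indicator (?S (sqrt (1 - y\<^sup>2))) f \<partial>?M ?I)"
      by (rule nn_integral_cmult) measurable
    also have "(\<integral>\<^sup>+f. indicator (?S (sqrt (1 - y\<^sup>2))) f \<partial>?M ?I) = emeasure (?M ?I) (?S (sqrt (1 - y\<^sup>2)))"
      by (rule nn_integral_indicator) measurable
    finally show "(\<integral>\<^sup>+f. indicator {f. sqrt (\<Sum>b\<in>Basis. (f b)\<^sup>2) \<le> 1} (f(e := y)) * indicator A ((f(e := y)) e) \<partial>?M ?I) =
       indicator A y * (indicator {-1..1} y * emeasure (?M ?I) (?S (sqrt (1 - y\<^sup>2))))"
      by (simp only: mult.assoc)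
  qed
  also have "\<dots> = (\<integral>\<^sup>+s. ennreal (?v * (indicator {-1..1} s * ball_weight CARD('n) s)) * indicator A s \<partial>lborel)"
  proof (intro nn_integral_cong_AE)
    have "AE y in lborel. y \<notin> {-1,1::real}" by (intro AE_not_in countable_imp_null_set_lborel) auto
    then show "AE y in lborel. indicator A y * (indicator {-1..1} y * emeasure (?M ?I) (?S (sqrt (1 - y\<^sup>2)))) =
        ennreal (?v * (indicator {-1..1} y * ball_weight CARD('n) y)) * indicator A y"
    proof eventually_elim
      case (elim y)
      show ?case
      proof (cases "y \<in> {-1<..<1}")
        case True
        then have p: "1 - y\<^sup>2 > 0" by (simp add: abs_square_less_1 abs_less_iff)
        have "emeasure (?M ?I) (?S (sqrt (1 - y\<^sup>2))) = ennreal (unit_ball_vol (real (card ?I)) * sqrt (1 - y\<^sup>2) ^ card ?I)"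
          using p by (intro emeasure_cball_aux) auto
        also have "sqrt (1 - y\<^sup>2) ^ card ?I = ball_weight CARD('n) y"
          using p CARD1 unfolding cardI ball_weight_def
          by (simp add: powr_half_sqrt[symmetric] powr_powr powr_realpow[symmetric] of_nat_diff field_simps)
        finally show ?thesis using True unfolding cardI by (simp add: indicator_def)
      next
        case False
        then show ?thesis using elim by (auto simp: indicator_def)
      qed
    qed
  qed
  also have "\<dots> = emeasure (density lborel (\<lambda>s. ennreal (?v * (indicator {-1..1} s * ball_weight CARD('n) s)))) A"
    by (subst emeasure_density) auto
  finally show "emeasure (distr (density lborel (indicator (cball 0 1))) borel (\<lambda>x. e \<bullet> x)) A =
    emeasure (density lborel (\<lambda>s. ennreal (?v * (indicator {-1..1} s * ball_weight CARD('n) s)))) A" .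
qed simp

lemma cball_moment_slices:
  fixes e :: "real ^ 'n::finite"
  assumes e: "e \<in> Basis"
  shows "(LINT x|lborel. indicator (cball 0 1) x * (e \<bullet> x) ^ k) =
    unit_ball_vol (real (CARD('n) - 1)) * (LINT s|lborel. indicator {-1..1} s * (s ^ k * ball_weight CARD('n) s))"
proof -
  let ?v = "unit_ball_vol (real (CARD('n) - 1))"
  have [measurable, simp]: "(indicator (cball 0 1 :: (real ^ 'n) set) :: _ \<Rightarrow> real) \<in> borel_measurable borel"
    by (intro borel_measurable_indicator) simp
  have cball: "density lborel (indicator (cball 0 1 :: (real ^ 'n) set)) =
      density lborel (\<lambda>x. ennreal (indicator (cball 0 1 :: (real ^ 'n) set) x))"
    by (simp add: ennreal_indicator)
  have "(LINT x|lborel. indicator (cball 0 1) x * (e \<bullet> x) ^ k) =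
      (LINT x|density lborel (indicator (cball 0 1 :: (real ^ 'n) set)). (e \<bullet> x) ^ k)"
    unfolding cball by (subst integral_real_density) auto
  also have "\<dots> = (LINT s|distr (density lborel (indicator (cball 0 1 :: (real ^ 'n) set))) borel (\<lambda>x. e \<bullet> x). s ^ k)"
    by (subst integral_distr) auto
  also have "\<dots> = (LINT s|lborel. ?v * (indicator {-1..1} s * ball_weight CARD('n) s) * s ^ k)"
    unfolding cball_coordinate_distr[OF e]
    by (subst integral_real_density) (auto simp: ball_weight_def)
  also have "\<dots> = ?v * (LINT s|lborel. indicator {-1..1} s * (s ^ k * ball_weight CARD('n) s))"
  proof -
    have "(\<lambda>s. ?v * (indicator {-1..1} s * ball_weight CARD('n) s) * s ^ k) =
        (\<lambda>s. ?v * (indicator {-1..1} s * (s ^ k * ball_weight CARD('n) s)))"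
      by (simp add: fun_eq_iff mult_ac)
    then show ?thesis by simp
  qed
  finally show ?thesis .
qed

lemma integral_lborel_scale:
  fixes F :: "'a::euclidean_space \<Rightarrow> real"
  assumes [measurable]: "F \<in> borel_measurable borel" and \<rho>: "\<rho> > 0"
  shows "(LINT x|lborel. F x) = \<rho> ^ DIM('a) * (LINT x|lborel. F (\<rho> *\<^sub>R x))"
proof -
  have "(LINT x|lborel. F x) = (LINT x|density (distr lborel borel (\<lambda>x. 0 + \<rho> *\<^sub>R x)) (\<lambda>_. ennreal (\<bar>\<rho>\<bar> ^ DIM('a))). F x)"
    using lborel_affine[of \<rho> "0 :: 'a"] \<rho> by simp
  also have "\<dots> = (LINT x|distr lborel borel (\<lambda>x :: 'a. 0 + \<rho> *\<^sub>R x). \<rho> ^ DIM('a) * F x)"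
    using \<rho> by (subst integral_real_density) auto
  also have "\<dots> = (LINT x|lborel. \<rho> ^ DIM('a) * F (\<rho> *\<^sub>R x))"
    by (subst integral_distr) auto
  finally show ?thesis by simp
qed

text \<open>
  Polar coordinates without a surface measure: in \<open>(e \<bullet> x)\<^bsup>k\<^esup> = |x|\<^bsup>k\<^esup> (e \<bullet> sgn x)\<^bsup>k\<^esup>\<close> the power of the norm is
  written as the integral of \<open>k \<rho>\<^bsup>k-1\<^esup>\<close> over \<open>0 < \<rho> < |x|\<close>. After exchanging the integrals, the inner one is
  the integral of \<open>(e \<bullet> sgn x)\<^bsup>k\<^esup>\<close> over a shell, which by homogeneity is \<open>1 - \<rho>\<^bsup>d\<^esup>\<close> times the one over the ball.
\<close>
lemma cball_moment_polar:
  fixes e :: "real ^ 'n::finite"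
  shows "(LINT x|lborel. indicator (cball 0 1) x * (e \<bullet> x) ^ k) =
    (real CARD('n) / real (k + CARD('n))) * (LINT x|lborel. indicator (cball 0 1) x * (e \<bullet> sgn x) ^ k)"
proof (cases "k = 0")
  case False
  then obtain j where j: "k = Suc j" by (cases k) auto
  let ?d = "CARD('n)"
  let ?G = "\<lambda>x. (e \<bullet> sgn x) ^ k"
  let ?A = "LINT x|lborel. indicator (cball 0 1) x * ?G x"
  let ?H = "\<lambda>x \<rho>. indicator {0..1} \<rho> * (real k * \<rho> ^ j) * (indicator {z. \<rho> < norm z} x * (indicator (cball 0 1) x * ?G x))"
  have GB: "\<bar>?G x\<bar> \<le> norm e ^ k" for x
  proof -
    have "\<bar>e \<bullet> sgn x\<bar> \<le> norm e * norm (sgn x)" by (rule Cauchy_Schwarz_ineq2)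
    also have "\<dots> \<le> norm e" by (simp add: norm_sgn)
    finally show ?thesis unfolding power_abs by (intro power_mono) auto
  qed
  have pw: "(LINT \<rho>|lborel. ?H x \<rho>) = indicator (cball 0 1) x * (e \<bullet> x) ^ k" for x
  proof (cases "norm x \<le> 1")
    case True
    have "(LINT \<rho>|lborel. ?H x \<rho>) = (LINT \<rho>|lborel. ?G x * (indicator {0..norm x} \<rho> * (real k * \<rho> ^ j)))"
    proof (intro integral_cong_AE)
      have "AE \<rho> in lborel. \<rho> \<noteq> norm x" by (rule AE_lborel_singleton)
      then show "AE \<rho> in lborel. ?H x \<rho> = ?G x * (indicator {0..norm x} \<rho> * (real k * \<rho> ^ j))"
        by eventually_elim (use True in \<open>auto simp: indicator_def\<close>)
    qed auto
    also have "\<dots> = ?G x * (LINT \<rho>|lborel. indicator {0..norm x} \<rho> * (real k * \<rho> ^ j))" by simp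
    also have "(LINT \<rho>|lborel. indicator {0..norm x} \<rho> * (real k * \<rho> ^ j)) = norm x ^ k - 0 ^ k"
    proof -
      have "(LINT \<rho>|lborel. (real k * \<rho> ^ j) * indicator {0..norm x} \<rho>) = norm x ^ k - 0 ^ k"
        by (rule integral_FTC_Icc_real[where F = "\<lambda>\<rho>. \<rho> ^ k"])
          (use DERIV_pow[of k] in \<open>auto simp: j intro!: continuous_intros\<close>)
      then show ?thesis by (simp add: mult.commute)
    qed
    also have "?G x * (norm x ^ k - 0 ^ k) = (e \<bullet> x) ^ k"
    proof -
      have "norm x *\<^sub>R sgn x = x" by (cases "x = 0") (simp_all add: sgn_div_norm)
      then have "e \<bullet> x = norm x * (e \<bullet> sgn x)" by (metis inner_scaleR_right)
      then show ?thesis using False by (simp add: power_mult_distrib)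
    qed
    finally show ?thesis using True by simp
  qed simp
  have int: "integrable (lborel \<Otimes>\<^sub>M lborel) (\<lambda>(x, \<rho>). ?H x \<rho>)"
  proof (rule Bochner_Integration.integrable_bound[where f = "\<lambda>(x, \<rho>). (real k * norm e ^ k) * indicator (cball 0 1 \<times> {0..1}) (x, \<rho>)"])
    have "emeasure (lborel \<Otimes>\<^sub>M lborel) (cball (0 :: real ^ 'n) 1 \<times> {0..1::real}) < \<infinity>"
      by (subst lborel.emeasure_pair_measure_Times)
        (use emeasure_compact_subset[of "cball (0 :: real ^ 'n) 1" "cball 0 1"] in \<open>auto simp: ennreal_mult_less_top\<close>)
    then show "integrable (lborel \<Otimes>\<^sub>M lborel) (\<lambda>(x :: real ^ 'n, \<rho>). (real k * norm e ^ k) * indicator (cball 0 1 \<times> {0..1::real}) (x, \<rho>))"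
      unfolding split_beta' by (intro integrable_mult_right integrable_real_indicator) auto
    show "AE z in lborel \<Otimes>\<^sub>M lborel. norm (case z of (x, \<rho>) \<Rightarrow> ?H x \<rho>) \<le>
        norm (case z of (x :: real ^ 'n, \<rho>) \<Rightarrow> (real k * norm e ^ k) * indicator (cball 0 1 \<times> {0..1::real}) (x, \<rho>))"
    proof (intro AE_I2)
      fix z :: "(real ^ 'n) \<times> real"
      obtain x \<rho> where z: "z = (x, \<rho>)" by (cases z)
      have "\<bar>?H x \<rho>\<bar> \<le> (real k * norm e ^ k)" if "\<rho> \<in> {0..1}" "norm x \<le> 1"
      proof -
        have "\<bar>real k * \<rho> ^ j\<bar> \<le> real k * 1"
          using that by (simp add: abs_mult power_le_one mult_left_le)
        then have "\<bar>real k * \<rho> ^ j * ?G x\<bar> \<le> real k * 1 * norm e ^ k"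
          unfolding abs_mult[of "real k * \<rho> ^ j"] using GB[of x] by (intro mult_mono) auto
        then show ?thesis using that by (auto simp: indicator_def)
      qed
      then show "norm (case z of (x, \<rho>) \<Rightarrow> ?H x \<rho>) \<le>
        norm (case z of (x, \<rho>) \<Rightarrow> (real k * norm e ^ k) * indicator (cball 0 1 \<times> {0..1::real}) (x, \<rho>))"
        unfolding z by (auto simp: indicator_def)
    qed
    have [measurable]: "Measurable.pred (borel \<Otimes>\<^sub>M borel) (\<lambda>x :: (real ^ 'n) \<times> real. fst x \<in> cball 0 1)"
      unfolding mem_cball by measurable
    have "(sgn :: real ^ 'n \<Rightarrow> _) \<in> borel_measurable lborel" by simp
    then have [measurable]: "(\<lambda>x :: (real ^ 'n) \<times> real. (e \<bullet> sgn (fst x)) ^ k) \<in> borel_measurable (lborel \<Otimes>\<^sub>M lborel)"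
      by (intro borel_measurable_power borel_measurable_inner borel_measurable_const measurable_compose[OF measurable_fst])
    show "(\<lambda>(x, \<rho>). ?H x \<rho>) \<in> borel_measurable (lborel \<Otimes>\<^sub>M lborel)"
      unfolding split_beta' indicator_def by measurable
  qed
  have outer: "(LINT x|lborel. ?H x \<rho>) = indicator {0..1} \<rho> * (real k * \<rho> ^ j) * ((1 - \<rho> ^ ?d) * ?A)" for \<rho>
  proof (cases "\<rho> \<in> {0<..1}")
    case True
    have intG: "integrable lborel (\<lambda>x. indicator (cball 0 r) x * ?G x)" for r
    proof (rule Bochner_Integration.integrable_bound[where f = "\<lambda>x. norm e ^ k * indicator (cball 0 r) x"])
      show "integrable lborel (\<lambda>x :: real ^ 'n. norm e ^ k * indicator (cball 0 r) x)"
        using emeasure_compact_subset[of "cball (0 :: real ^ 'n) r" "cball 0 r"]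
        by (intro integrable_mult_right integrable_real_indicator) auto
    qed (use GB in \<open>auto simp: indicator_def\<close>)
    have [measurable]: "(\<lambda>x. indicator (cball 0 \<rho>) x * ?G x) \<in> borel_measurable borel"
      using borel_measurable_integrable[OF intG[of \<rho>]] by simp
    have "(LINT x|lborel. indicator (cball 0 \<rho>) x * ?G x) = \<rho> ^ ?d * (LINT x|lborel. indicator (cball 0 \<rho>) (\<rho> *\<^sub>R x) * ?G (\<rho> *\<^sub>R x))"
      using integral_lborel_scale[of "\<lambda>x. indicator (cball 0 \<rho>) x * ?G x" \<rho>] True by simp
    also have "(LINT x|lborel. indicator (cball 0 \<rho>) (\<rho> *\<^sub>R x) * ?G (\<rho> *\<^sub>R x)) = ?A"
      using True by (intro Bochner_Integration.integral_cong) (auto simp: indicator_def sgn_scaleR)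
    finally have A\<rho>: "(LINT x|lborel. indicator (cball 0 \<rho>) x * ?G x) = \<rho> ^ ?d * ?A" .
    have "(LINT x|lborel. ?H x \<rho>) = (LINT x|lborel. (real k * \<rho> ^ j) * (indicator (cball 0 1) x * ?G x - indicator (cball 0 \<rho>) x * ?G x))"
      using True by (intro Bochner_Integration.integral_cong) (auto simp: indicator_def)
    also have "\<dots> = (real k * \<rho> ^ j) * (?A - (LINT x|lborel. indicator (cball 0 \<rho>) x * ?G x))"
      using intG by (simp add: Bochner_Integration.integral_diff)
    finally show ?thesis unfolding A\<rho> using True by (simp add: algebra_simps)
  next
    case False
    then consider "\<rho> \<notin> {0..1}" | "\<rho> = 0" by fastforce
    then show ?thesis
    proof cases
      case 2
      have "(LINT x|lborel. ?H x 0) = (LINT x|lborel. (real k * 0 ^ j) * (indicator (cball 0 1) x * ?G x))"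
      proof (intro integral_cong_AE)
        have "AE x in lborel. x \<noteq> (0 :: real ^ 'n)" by (rule AE_lborel_singleton)
        then show "AE x in lborel. ?H x 0 = (real k * 0 ^ j) * (indicator (cball 0 1) x * ?G x)"
          by eventually_elim (auto simp: indicator_def)
      qed (auto simp: indicator_def)
      then show ?thesis using 2 by (simp add: power_0_left)
    qed simp
  qed
  have "(LINT x|lborel. indicator (cball 0 1) x * (e \<bullet> x) ^ k) = (LINT x|lborel. LINT \<rho>|lborel. ?H x \<rho>)"
    by (simp only: pw)
  also have "\<dots> = (LINT \<rho>|lborel. LINT x|lborel. ?H x \<rho>)"
    by (rule lborel_pair.Fubini_integral[OF int, symmetric])
  also have "\<dots> = (LINT \<rho>|lborel. ((real k * \<rho> ^ j) * (1 - \<rho> ^ ?d)) * indicator {0..1} \<rho> * ?A)"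
    unfolding outer by (intro Bochner_Integration.integral_cong) auto
  also have "\<dots> = (LINT \<rho>|lborel. ((real k * \<rho> ^ j) * (1 - \<rho> ^ ?d)) * indicator {0..1} \<rho>) * ?A" by simp
  also have "(LINT \<rho>|lborel. ((real k * \<rho> ^ j) * (1 - \<rho> ^ ?d)) * indicator {0..1} \<rho>) =
      (1 ^ k - real k / real (k + ?d) * 1 ^ (k + ?d)) - (0 ^ k - real k / real (k + ?d) * 0 ^ (k + ?d))"
  proof (rule integral_FTC_Icc_real[where F = "\<lambda>\<rho>. \<rho> ^ k - real k / real (k + ?d) * \<rho> ^ (k + ?d)"])
    fix \<rho> :: real
    have "((\<lambda>\<rho>. \<rho> ^ k - real k / real (k + ?d) * \<rho> ^ (k + ?d)) has_real_derivative
        real k * \<rho> ^ (k - 1) - real k / real (k + ?d) * (real (k + ?d) * \<rho> ^ (k + ?d - 1))) (at \<rho>)"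
      by (auto intro!: derivative_eq_intros)
    also have "real k * \<rho> ^ (k - 1) - real k / real (k + ?d) * (real (k + ?d) * \<rho> ^ (k + ?d - 1)) = (real k * \<rho> ^ j) * (1 - \<rho> ^ ?d)"
    proof -
      have e: "k - 1 = j" "k + ?d - 1 = j + ?d" using j by auto
      have "real (k + ?d) \<noteq> 0" using False by simp
      then have "real k / real (k + ?d) * (real (k + ?d) * y) = real k * y" for y by simp
      then show ?thesis unfolding e by (simp only: power_add right_diff_distrib mult_1_right mult.assoc)
    qed
    finally show "((\<lambda>\<rho>. \<rho> ^ k - real k / real (k + ?d) * \<rho> ^ (k + ?d)) has_real_derivative (real k * \<rho> ^ j) * (1 - \<rho> ^ ?d)) (at \<rho>)" .
  qed (auto intro!: continuous_intros)
  also have "\<dots> = real ?d / real (k + ?d)" using False by (simp add: power_0_left field_simps)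
  finally show ?thesis .
next
  case True
  then show ?thesis by simp
qed

text \<open>
  The distribution of a coordinate of a random point on the sphere, tested against polynomials. Radial
  and slice formulas for the ball, together with integration by parts, show that the moments of both
  sides are proportional, with a constant independent of the degree; the zeroth moment fixes it.
\<close>
theorem sphere_measure_zonal:
  fixes u :: "real ^ 'n::finite"
  assumes d: "CARD('n) \<ge> 2" and u: "norm u = 1"
  shows "(LINT x|sphere_measure. poly q (u \<bullet> x)) = (LINT s|coord_measure CARD('n). poly q s)"
proof -
  let ?d = "CARD('n)"
  let ?W = "\<lambda>k. LINT s|lborel. indicator {-1..1} s * (s ^ k * sphere_weight ?d s)"
  obtain i :: 'n where "True" by simp
  let ?e = "axis i 1 :: real ^ 'n"
  have e: "?e \<in> Basis" by (simp add: axis_in_Basis_iff)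
  have ne: "norm ?e = 1" by (simp add: norm_axis_1)
  have [measurable, simp]: "(indicator (ball 0 1 :: (real ^ 'n) set) :: _ \<Rightarrow> real) \<in> borel_measurable borel"
    "(indicator (cball 0 1 :: (real ^ 'n) set) :: _ \<Rightarrow> real) \<in> borel_measurable borel"
    by (intro borel_measurable_indicator; simp)+
  define V where "V = measure lborel (ball 0 1 :: (real ^ 'n) set)"
  define C where "C = (real ?d - 1) * unit_ball_vol (real (?d - 1)) / (real ?d * V)"
  have Vpos: "V > 0" unfolding V_def by simp
  have mom: "(LINT x|sphere_measure. (?e \<bullet> x) ^ k) = C * ?W k" for k
  proof -
    have "(LINT x|sphere_measure. (?e \<bullet> x) ^ k) = (LINT x|uniform_measure lborel (ball 0 1). (?e \<bullet> sgn x) ^ k)"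
      unfolding sphere_measure_def by (subst integral_distr) auto
    also have "uniform_measure lborel (ball 0 1 :: (real ^ 'n) set) = density lborel (\<lambda>x. ennreal (indicator (ball 0 1) x / V))"
    proof -
      have "emeasure lborel (ball 0 1 :: (real ^ 'n) set) = ennreal V"
        unfolding V_def using emeasure_unit_ball(2)[where 'a = "real ^ 'n"] by (intro emeasure_eq_ennreal_measure) simp
      then have "indicator (ball 0 1) x / emeasure lborel (ball 0 1 :: (real ^ 'n) set) = ennreal (indicator (ball 0 1) x / V)" for x :: "real ^ 'n"
        using Vpos by (cases "x \<in> ball 0 1") (auto simp: divide_ennreal simp flip: ennreal_1)
      then show ?thesis unfolding uniform_measure_def by simp
    qed
    also have "(LINT x|\<dots>. (?e \<bullet> sgn x) ^ k) = (LINT x|lborel. (indicator (ball 0 1) x / V) * (?e \<bullet> sgn x) ^ k)"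
      using Vpos by (subst integral_real_density) auto
    also have "\<dots> = (LINT x|lborel. (1 / V) * (indicator (cball 0 1) x * (?e \<bullet> sgn x) ^ k))"
    proof (intro integral_cong_AE)
      have "negligible (sphere (0 :: real ^ 'n) 1)" by (rule negligible_sphere)
      then have "AE x in lborel. x \<notin> sphere (0 :: real ^ 'n) 1"
        by (intro AE_not_in) (auto simp: negligible_iff_null_sets null_sets_completion_iff)
      then show "AE x in lborel. (indicator (ball 0 1) x / V) * (?e \<bullet> sgn x) ^ k = (1 / V) * (indicator (cball 0 1) x * (?e \<bullet> sgn x) ^ k)"
        by eventually_elim (auto simp: indicator_def)
    qed auto
    also have "\<dots> = (1 / V) * (LINT x|lborel. indicator (cball 0 1) x * (?e \<bullet> sgn x) ^ k)" by (rule integral_mult_right_zero)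
    also have "(LINT x|lborel. indicator (cball 0 1) x * (?e \<bullet> sgn x) ^ k) =
        (real (k + ?d) / real ?d) * (LINT x|lborel. indicator (cball 0 1) x * (?e \<bullet> x) ^ k)"
      unfolding cball_moment_polar[of ?e k] using d by simp
    also have "(LINT x|lborel. indicator (cball 0 1) x * (?e \<bullet> x) ^ k) =
        unit_ball_vol (real (?d - 1)) * (LINT s|lborel. indicator {-1..1} s * (s ^ k * ball_weight ?d s))"
      by (rule cball_moment_slices[OF e])
    also have "(LINT s|lborel. indicator {-1..1} s * (s ^ k * ball_weight ?d s)) = ((real ?d - 1) / real (k + ?d)) * ?W k"
      unfolding sphere_weight_integrable(2)[OF d] using d by simp
    also have "1 / V * (real (k + ?d) / real ?d * (unit_ball_vol (real (?d - 1)) * (((real ?d - 1) / real (k + ?d)) * ?W k))) = C * ?W k"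
    proof -
      have "1 / V * (K / D * (v * (((D - 1) / K) * w))) = (D - 1) * v / (D * V) * w" if "K \<noteq> 0" for K D v w :: real
        using that by (simp add: mult_ac)
      from this[of "real (k + ?d)"] show ?thesis using d unfolding C_def by (simp only: of_nat_eq_0_iff)
    qed
    finally show ?thesis .
  qed
  let ?J = "LINT s|lborel. indicator {-1..1} s * sphere_weight ?d s"
  have "(LINT x|sphere_measure. (?e \<bullet> x) ^ 0) = 1"
  proof -
    interpret finite_measure "uniform_measure lborel (ball 0 1 :: (real ^ 'n) set)" by (rule finite_uniform_ball)
    have "emeasure (sphere_measure :: (real ^ 'n) measure) UNIV = 1"
      unfolding sphere_measure_def using emeasure_unit_ball[where 'a = "real ^ 'n"]
      by (simp add: emeasure_distr emeasure_uniform_measure ennreal_divide_self less_top)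
    then show ?thesis by (simp add: measure_def)
  qed
  then have "C * ?J = 1" using mom[of 0] by simp
  moreover have J: "?J > 0" by (rule coord_measure_integral(1)[OF d])
  ultimately have C: "C = 1 / ?J" by (simp add: field_simps)
  obtain g where g: "orthogonal_transformation g" "g u = ?e"
  proof (rule orthogonal_transformation_exists_1[OF u ne])
    fix g assume "orthogonal_transformation g" "g u = axis i (1::real)"
    then show thesis by (rule that)
  qed
  have mg: "g \<in> measurable sphere_measure borel"
  proof -
    have "g \<in> borel_measurable borel"
      using g(1) by (intro borel_measurable_continuous_onI linear_continuous_on linear_conv_bounded_linear[THEN iffD1])
        (simp add: orthogonal_transformation_def)
    then show ?thesis by (simp cong: measurable_cong_sets)
  qed
  have "(LINT x|sphere_measure. poly q (u \<bullet> x)) = (LINT x|sphere_measure. poly q (?e \<bullet> g x))"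
    using g by (simp add: orthogonal_transformation_def flip: g(2))
  also have "\<dots> = (LINT x|distr sphere_measure borel g. poly q (?e \<bullet> x))"
    by (rule integral_distr[OF mg, symmetric]) (intro borel_measurable_continuous_onI continuous_intros)
  also have "\<dots> = (LINT x|sphere_measure. poly q (?e \<bullet> x))" by (simp only: sphere_measure_orthogonal[OF g(1)])
  also have "\<dots> = (LINT x|sphere_measure. (\<Sum>k\<le>degree q. coeff q k * (?e \<bullet> x) ^ k))" by (simp only: poly_altdef)
  also have "\<dots> = (\<Sum>k\<le>degree q. coeff q k * (LINT x|sphere_measure. (?e \<bullet> x) ^ k))"
    by (subst Bochner_Integration.integral_sum) (auto intro!: integrable_mult_right integrable_sphere_measure continuous_intros)
  also have "\<dots> = (\<Sum>k\<le>degree q. coeff q k * ?W k) / ?J"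
    unfolding mom C by (simp add: sum_divide_distrib)
  also have "(\<Sum>k\<le>degree q. coeff q k * ?W k) = (LINT s|lborel. (\<Sum>k\<le>degree q. coeff q k * (indicator {-1..1} s * (s ^ k * sphere_weight ?d s))))"
    by (subst Bochner_Integration.integral_sum) (auto intro!: integrable_mult_right sphere_weight_integrable d)
  also have "\<dots> = (LINT s|lborel. indicator {-1..1} s * sphere_weight ?d s * poly q s)"
    by (simp add: poly_altdef sum_distrib_left mult_ac)
  also have "\<dots> / ?J = (LINT s|coord_measure ?d. poly q s)"
    by (rule coord_measure_integral(3)[OF d, symmetric])
  finally show ?thesis .
qed

section \<open>Orthogonal polynomials and Gauss quadrature for positive functionals\<close>

definition node_poly :: "real set \<Rightarrow> real poly" where
  "node_poly Z = (\<Prod>z\<in>Z. [:- z, 1:])"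

lemma poly_node_poly: "finite Z \<Longrightarrow> poly (node_poly Z) s = (\<Prod>z\<in>Z. s - z)"
  by (simp add: node_poly_def poly_prod)

lemma degree_node_poly: "finite Z \<Longrightarrow> degree (node_poly Z) = card Z"
  by (simp add: node_poly_def degree_prod_eq_sum_degree)

lemma lead_coeff_node_poly: "lead_coeff (node_poly Z) = 1"
  by (simp add: node_poly_def lead_coeff_prod)

lemma node_poly_nonzero: "node_poly Z \<noteq> 0"
  using lead_coeff_node_poly[of Z] by auto

lemma node_poly_insert: "finite Z \<Longrightarrow> z \<notin> Z \<Longrightarrow> node_poly (insert z Z) = [:- z, 1:] * node_poly Z"
  by (simp add: node_poly_def)

lemma poly_eq_0_of_card_roots:
  fixes p :: "real poly"
  assumes "finite Z" "\<And>z. z \<in> Z \<Longrightarrow> poly p z = 0" "p = 0 \<or> degree p < card Z"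
  shows "p = 0"
proof (rule ccontr)
  assume "p \<noteq> 0"
  then have "card Z \<le> card {z. poly p z = 0}"
    using assms poly_roots_finite by (intro card_mono) auto
  also have "\<dots> \<le> degree p" using \<open>p \<noteq> 0\<close> by (rule card_poly_roots_bound)
  finally show False using assms(3) \<open>p \<noteq> 0\<close> by simp
qed

lemma degree_less_of_coeff_0:
  assumes "degree p \<le> k" "coeff p k = 0"
  shows "p = 0 \<or> degree p < k"
proof (cases "degree p = k")
  case True
  then have "lead_coeff p = 0" using assms by simp
  then show ?thesis by simp
qed (use assms in simp)

text \<open>
  \<open>Z\<close> is the set of zeros of odd order in the interval, where \<open>p\<close> changes sign. It arises by induction
  on the degree: splitting off a linear factor toggles the membership of its zero.
\<close>
lemma sign_changes:
  fixes p :: "real poly"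
  assumes "p \<noteq> 0"
  shows "\<exists>Z. finite Z \<and> Z \<subseteq> {-1<..<1} \<and> (\<forall>z\<in>Z. poly p z = 0) \<and>
    ((\<forall>s\<in>{-1<..<1}. poly (p * node_poly Z) s \<ge> 0) \<or> (\<forall>s\<in>{-1<..<1}. poly (p * node_poly Z) s \<le> 0))"
  using assms
proof (induction "degree p" arbitrary: p rule: less_induct)
  case less
  show ?case
  proof (cases "\<exists>z\<in>{-1<..<1}. poly p z = 0")
    case False
    have "(\<forall>s\<in>{-1<..<1}. poly p s \<ge> 0) \<or> (\<forall>s\<in>{-1<..<1}. poly p s \<le> 0)"
    proof (rule ccontr)
      assume "\<not> ?thesis"
      then obtain a b where ab: "a \<in> {-1<..<1}" "poly p a < 0" "b \<in> {-1<..<1}" "poly p b > 0"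
        by (auto simp: not_le)
      have "\<exists>z\<in>{-1<..<1}. poly p z = 0"
      proof (cases "a < b")
        case True
        then show ?thesis using poly_IVT_pos[OF True] ab by fastforce
      next
        case False
        then have "b < a" using ab by (cases "a = b") auto
        then show ?thesis using poly_IVT_neg[OF \<open>b < a\<close>] ab by fastforce
      qed
      then show False using False by blast
    qed
    then show ?thesis by (intro exI[of _ "{}"]) (auto simp: node_poly_def)
  next
    case True
    then obtain z where z: "z \<in> {-1<..<1}" "poly p z = 0" by blast
    then obtain p' where p': "p = [:- z, 1:] * p'" by (auto simp: poly_eq_0_iff_dvd elim: dvdE)
    have p'0: "p' \<noteq> 0" using less.prems p' by auto
    then have "degree p' < degree p"
      unfolding p' by (subst degree_mult_eq) auto
    from less.hyps[OF this p'0] obtain Z where Z: "finite Z" "Z \<subseteq> {-1<..<1}" "\<forall>z\<in>Z. poly p' z = 0"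
      "(\<forall>s\<in>{-1<..<1}. poly (p' * node_poly Z) s \<ge> 0) \<or> (\<forall>s\<in>{-1<..<1}. poly (p' * node_poly Z) s \<le> 0)"
      by (elim exE conjE) (rule that)
    show ?thesis
    proof (cases "z \<in> Z")
      case True
      have "node_poly Z = [:- z, 1:] * node_poly (Z - {z})"
        using node_poly_insert[of "Z - {z}" z] Z(1) True by (simp add: insert_absorb)
      then have "p * node_poly (Z - {z}) = p' * node_poly Z" unfolding p' by (simp only: mult_ac)
      then show ?thesis using Z p' by (intro exI[of _ "Z - {z}"]) auto
    next
      case False
      have "p * node_poly (insert z Z) = ([:- z, 1:] * [:- z, 1:]) * (p' * node_poly Z)"
        unfolding node_poly_insert[OF Z(1) False] p' by (simp only: mult_ac)
      then have eq: "poly (p * node_poly (insert z Z)) s = (s - z)\<^sup>2 * poly (p' * node_poly Z) s" for s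
        by (simp add: power2_eq_square algebra_simps)
      have "(\<forall>s\<in>{-1<..<1}. poly (p * node_poly (insert z Z)) s \<ge> 0) \<or> (\<forall>s\<in>{-1<..<1}. poly (p * node_poly (insert z Z)) s \<le> 0)"
        unfolding eq using Z(4) by (auto simp del: poly_mult intro!: mult_nonneg_nonneg mult_nonneg_nonpos)
      then show ?thesis using Z z p' by (intro exI[of _ "insert z Z"]) auto
    qed
  qed
qed

definition lagrange :: "real set \<Rightarrow> real \<Rightarrow> real poly" where
  "lagrange X x = smult (1 / (\<Prod>y\<in>X - {x}. x - y)) (node_poly (X - {x}))"

lemma poly_lagrange:
  assumes "finite X" "x \<in> X" "y \<in> X"
  shows "poly (lagrange X x) y = (if x = y then 1 else 0)"
  using assms by (auto simp: lagrange_def poly_node_poly prod_zero_iff)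

lemma degree_lagrange:
  assumes "finite X" "x \<in> X"
  shows "degree (lagrange X x) < card X"
proof -
  have "degree (lagrange X x) \<le> card (X - {x})"
    unfolding lagrange_def using degree_smult_le degree_node_poly[of "X - {x}"] assms by (metis finite_Diff)
  then show ?thesis using assms by (metis card_Diff1_less le_less_trans)
qed

text \<open>
  The only properties of integration against a weight on \<open>(-1, 1)\<close> that the theory of orthogonal
  polynomials needs. Working with functionals treats the Gauss and the Gauss-Radau weight alike: the
  latter is the functional \<open>p \<mapsto> L ((1 + s) p)\<close>.
\<close>
locale positive_functional =
  fixes L :: "real poly \<Rightarrow> real"
  assumes L_add: "L (p + q) = L p + L q"
    and L_smult: "L (smult c p) = c * L p"
    and L_pos: "p \<noteq> 0 \<Longrightarrow> (\<And>s. s \<in> {-1<..<1} \<Longrightarrow> poly p s \<ge> 0) \<Longrightarrow> L p > 0"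
begin

lemma L_0: "L 0 = 0"
  using L_smult[of 0 0] by simp

lemma L_minus: "L (- p) = - L p"
  using L_smult[of "-1" p] by simp

lemma L_diff: "L (p - q) = L p - L q"
  using L_add[of p "- q"] by (simp add: L_minus)

lemma L_sum: "L (\<Sum>i\<in>I. p i) = (\<Sum>i\<in>I. L (p i))"
  by (induction I rule: infinite_finite_induct) (auto simp: L_0 L_add)

lemma L_square_pos: "p \<noteq> 0 \<Longrightarrow> L (p * p) > 0"
  by (intro L_pos) auto

text \<open>
  Orthogonal projection onto the polynomials of degree less than \<open>k\<close>, by Gram-Schmidt: the residual \<open>e\<close> of
  the monomial of degree \<open>k\<close> is the next basis vector.
\<close>
lemma projection:
  "\<exists>r. (r = 0 \<or> degree r < k) \<and> (\<forall>q. q = 0 \<or> degree q < k \<longrightarrow> L ((f - r) * q) = 0)"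
proof (induction k arbitrary: f)
  case 0
  show ?case by (intro exI[of _ 0]) (auto simp: L_0)
next
  case (Suc k)
  obtain r0 where r0: "r0 = 0 \<or> degree r0 < k" "\<And>q. q = 0 \<or> degree q < k \<Longrightarrow> L ((monom 1 k - r0) * q) = 0"
    using Suc.IH[of "monom 1 k"] by blast
  obtain r1 where r1: "r1 = 0 \<or> degree r1 < k" "\<And>q. q = 0 \<or> degree q < k \<Longrightarrow> L ((f - r1) * q) = 0"
    using Suc.IH[of f] by blast
  define e where "e = monom 1 k - r0"
  have ek: "coeff e k = 1" using r0(1) by (auto simp: e_def coeff_eq_0)
  then have e0: "e \<noteq> 0" by auto
  have de: "degree e \<le> k"
    unfolding e_def using r0(1) by (intro degree_diff_le) (auto simp: degree_monom_le)
  define t where "t = L ((f - r1) * e) / L (e * e)"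
  define r where "r = r1 + smult t e"
  have dr: "r = 0 \<or> degree r < Suc k"
    unfolding r_def using r1(1) de degree_smult_le[of t e]
    by (metis add_0 degree_add_less le_imp_less_Suc less_SucI order_trans)
  have "L ((f - r) * q) = 0" if q: "q = 0 \<or> degree q < Suc k" for q
  proof -
    define c where "c = coeff q k"
    define q' where "q' = q - smult c e"
    have "degree q' \<le> k"
      unfolding q'_def using q de degree_smult_le[of c e] by (intro degree_diff_le) auto
    moreover have "coeff q' k = 0" by (simp add: q'_def c_def ek)
    ultimately have q': "q' = 0 \<or> degree q' < k" by (rule degree_less_of_coeff_0)
    have "L ((f - r) * e) = L ((f - r1) * e) - t * L (e * e)"
      by (simp add: r_def algebra_simps L_diff L_add L_smult L_minus)
    also have "\<dots> = 0" using L_square_pos[OF e0] by (simp add: t_def)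
    finally have 1: "L ((f - r) * e) = 0" .
    have "L ((f - r) * q') = L ((f - r1) * q') - t * L (e * q')"
      by (simp add: r_def algebra_simps L_diff L_add L_smult L_minus)
    also have "\<dots> = 0" using r1(2)[OF q'] r0(2)[OF q'] by (simp add: e_def)
    finally have 2: "L ((f - r) * q') = 0" .
    have "(f - r) * q = smult c ((f - r) * e) + (f - r) * q'"
      by (simp add: q'_def algebra_simps)
    then show ?thesis using 1 2 by (simp add: L_add L_smult)
  qed
  then show ?case using dr by blast
qed

definition orthogonal_poly :: "nat \<Rightarrow> real poly" where
  "orthogonal_poly k = (THE p. degree p = k \<and> lead_coeff p = 1 \<and> (\<forall>q. degree q < k \<longrightarrow> L (p * q) = 0))"

lemma orthogonal_poly:
  shows "degree (orthogonal_poly k) = k" "lead_coeff (orthogonal_poly k) = 1"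
    "degree q < k \<Longrightarrow> L (orthogonal_poly k * q) = 0"
proof -
  have "\<exists>!p. degree p = k \<and> lead_coeff p = 1 \<and> (\<forall>q. degree q < k \<longrightarrow> L (p * q) = 0)"
  proof (rule ex_ex1I)
    obtain r where r: "r = 0 \<or> degree r < k" "\<And>q. q = 0 \<or> degree q < k \<Longrightarrow> L ((monom 1 k - r) * q) = 0"
      using projection[of k "monom 1 k"] by blast
    have ek: "coeff (monom 1 k - r) k = 1" using r(1) by (auto simp: coeff_eq_0)
    moreover have "degree (monom 1 k - r) \<le> k"
      using r(1) by (intro degree_diff_le) (auto simp: degree_monom_le)
    moreover have "degree (monom 1 k - r) \<ge> k" using ek by (intro le_degree) simp
    ultimately show "\<exists>p. degree p = k \<and> lead_coeff p = 1 \<and> (\<forall>q. degree q < k \<longrightarrow> L (p * q) = 0)"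
      using r(2) by (intro exI[of _ "monom 1 k - r"]) (metis le_antisym)
  next
    fix p p'
    assume p: "degree p = k \<and> lead_coeff p = 1 \<and> (\<forall>q. degree q < k \<longrightarrow> L (p * q) = 0)"
      and p': "degree p' = k \<and> lead_coeff p' = 1 \<and> (\<forall>q. degree q < k \<longrightarrow> L (p' * q) = 0)"
    have "degree (p - p') \<le> k" using p p' by (intro degree_diff_le) auto
    moreover have "coeff (p - p') k = 0" using p p' by auto
    ultimately have d: "p - p' = 0 \<or> degree (p - p') < k" by (rule degree_less_of_coeff_0)
    show "p = p'"
    proof (rule ccontr)
      assume "p \<noteq> p'"
      then have "degree (p - p') < k" using d by auto
      then have "L (p * (p - p')) = 0" "L (p' * (p - p')) = 0" using p p' by auto
      then have "L ((p - p') * (p - p')) = 0" by (simp add: left_diff_distrib L_diff)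
      then show False using L_square_pos[of "p - p'"] \<open>p \<noteq> p'\<close> by simp
    qed
  qed
  from theI'[OF this] show "degree (orthogonal_poly k) = k" "lead_coeff (orthogonal_poly k) = 1"
    "degree q < k \<Longrightarrow> L (orthogonal_poly k * q) = 0" by (auto simp: orthogonal_poly_def)
qed

text \<open>
  If the polynomial had fewer than \<open>k\<close> sign changes in \<open>(-1, 1)\<close>, its product with the node polynomial of
  the sign changes would have constant sign, contradicting orthogonality.
\<close>
lemma orthogonal_poly_roots:
  defines "Z \<equiv> \<lambda>k. {z. poly (orthogonal_poly k) z = 0}"
  shows "finite (Z k)" "card (Z k) = k" "Z k \<subseteq> {-1<..<1}" "orthogonal_poly k = node_poly (Z k)"
proof -
  let ?p = "orthogonal_poly k"
  have p0: "?p \<noteq> 0" using orthogonal_poly(2)[of k] by auto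
  show fin: "finite (Z k)" unfolding Z_def by (rule poly_roots_finite[OF p0])
  obtain Y where Y: "finite Y" "Y \<subseteq> {-1<..<1}" "\<forall>z\<in>Y. poly ?p z = 0"
    "(\<forall>s\<in>{-1<..<1}. poly (?p * node_poly Y) s \<ge> 0) \<or> (\<forall>s\<in>{-1<..<1}. poly (?p * node_poly Y) s \<le> 0)"
    using sign_changes[OF p0] by blast
  have "\<not> card Y < k"
  proof
    assume "card Y < k"
    then have "L (?p * node_poly Y) = 0"
      using orthogonal_poly(3) degree_node_poly[OF Y(1)] by simp
    moreover have "?p * node_poly Y \<noteq> 0" using p0 node_poly_nonzero by simp
    ultimately show False
      using Y(4) L_pos[of "?p * node_poly Y"] L_pos[of "- (?p * node_poly Y)"] L_minus[of "?p * node_poly Y"] by auto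
  qed
  then have kY: "k \<le> card Y" by simp
  have sub: "Y \<subseteq> Z k" using Y by (auto simp: Z_def)
  have cZ: "card (Z k) \<le> k" unfolding Z_def using card_poly_roots_bound[OF p0] orthogonal_poly(1)[of k] by simp
  have "Y = Z k" using kY cZ by (intro card_seteq[OF fin sub]) simp
  then show c: "card (Z k) = k" and "Z k \<subseteq> {-1<..<1}" using kY cZ Y(2) by auto
  have "?p - node_poly (Z k) = 0"
  proof (rule poly_eq_0_of_card_roots[OF fin])
    fix z assume "z \<in> Z k"
    then show "poly (?p - node_poly (Z k)) z = 0"
      using fin by (auto simp: Z_def poly_node_poly prod_zero_iff)
  next
    have "degree (?p - node_poly (Z k)) \<le> k"
      using orthogonal_poly(1) degree_node_poly[OF fin] c by (intro degree_diff_le) auto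
    moreover have "coeff (?p - node_poly (Z k)) k = 0"
      using orthogonal_poly(1,2)[of k] degree_node_poly[OF fin] lead_coeff_node_poly[of "Z k"] c by simp
    ultimately show "?p - node_poly (Z k) = 0 \<or> degree (?p - node_poly (Z k)) < card (Z k)"
      unfolding c by (rule degree_less_of_coeff_0)
  qed
  then show "?p = node_poly (Z k)" by simp
qed

text \<open>
  Division by the node polynomial: the functional kills the multiple of the node polynomial, and the
  remainder is its own Lagrange interpolant.
\<close>
lemma quadrature_exact:
  assumes X: "finite X" and orth: "\<And>s. degree s + card X \<le> t \<Longrightarrow> L (node_poly X * s) = 0"
    and q: "degree q \<le> t"
  shows "(\<Sum>x\<in>X. L (lagrange X x) * poly q x) = L q"
proof -
  let ?w = "node_poly X"
  define s where "s = q div ?w"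
  define r where "r = q mod ?w"
  have qsr: "q = ?w * s + r" by (simp add: s_def r_def mult.commute)
  have dr: "r = 0 \<or> degree r < card X"
    using degree_mod_less[OF node_poly_nonzero, of q X] degree_node_poly[OF X] by (auto simp: r_def)
  have Ls: "L (?w * s) = 0"
  proof (cases "s = 0")
    case False
    have dws: "degree (?w * s) = card X + degree s"
      using False node_poly_nonzero by (simp add: degree_mult_eq degree_node_poly[OF X])
    have "degree (?w * s) \<le> t"
    proof (rule ccontr)
      assume gt: "\<not> ?thesis"
      have "degree r < degree (?w * s)" using dr gt dws by (auto simp: not_le)
      then have "degree q = degree (?w * s)" unfolding qsr by (rule degree_add_eq_left)
      then show False using gt q by simp
    qed
    then show ?thesis using dws by (intro orth) simp
  qed (simp add: L_0)
  have qr: "poly q x = poly r x" if "x \<in> X" for x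
    using that X by (subst qsr) (auto simp: poly_node_poly prod_zero_iff)
  have "r - (\<Sum>x\<in>X. smult (poly r x) (lagrange X x)) = 0"
  proof (rule poly_eq_0_of_card_roots[OF X])
    fix z assume z: "z \<in> X"
    have "(\<Sum>x\<in>X. poly r x * poly (lagrange X x) z) = (\<Sum>x\<in>X. if x = z then poly r z else 0)"
      using z X by (intro sum.cong) (auto simp: poly_lagrange)
    then show "poly (r - (\<Sum>x\<in>X. smult (poly r x) (lagrange X x))) z = 0"
      using z X by (simp add: poly_sum)
  next
    show "r - (\<Sum>x\<in>X. smult (poly r x) (lagrange X x)) = 0 \<or>
      degree (r - (\<Sum>x\<in>X. smult (poly r x) (lagrange X x))) < card X"
    proof (cases "X = {}")
      case True
      then show ?thesis using dr by auto
    next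
      case False
      have c: "card X > 0" using False X by (simp add: card_gt_0_iff)
      have "degree (\<Sum>x\<in>X. smult (poly r x) (lagrange X x)) < card X"
        using degree_lagrange[OF X] c by (intro degree_sum_less) (auto intro: le_less_trans[OF degree_smult_le])
      then show ?thesis using dr c by (intro disjI2 degree_diff_less) auto
    qed
  qed
  then have "L r = (\<Sum>x\<in>X. poly r x * L (lagrange X x))"
    using L_sum[of "\<lambda>x. smult (poly r x) (lagrange X x)" X] by (simp add: L_smult)
  then have "L q = (\<Sum>x\<in>X. poly r x * L (lagrange X x))" using Ls L_add[of "?w * s" r] by (subst qsr) simp
  also have "\<dots> = (\<Sum>x\<in>X. L (lagrange X x) * poly q x)" using qr by (intro sum.cong) auto
  finally show ?thesis by simp
qed

text \<open>
  A polynomial that is nonnegative on the interval and vanishes at all other nodes isolates the weight.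
\<close>
lemma quadrature_weight_pos:
  assumes exact: "\<And>q. degree q \<le> t \<Longrightarrow> (\<Sum>x\<in>X. w x * poly q x) = L q" and X: "finite X" "x \<in> X"
    and g: "g \<noteq> 0" "degree g \<le> t" "\<And>s. s \<in> {-1<..<1} \<Longrightarrow> poly g s \<ge> 0"
      "\<And>y. y \<in> X \<Longrightarrow> y \<noteq> x \<Longrightarrow> poly g y = 0" "poly g x \<ge> 0"
  shows "w x > 0"
proof -
  have "(\<Sum>y\<in>X. w y * poly g y) = (\<Sum>y\<in>X. if y = x then w x * poly g x else 0)"
    using g(4) by (intro sum.cong) auto
  also have "\<dots> = w x * poly g x" using X by simp
  finally have "w x * poly g x = L g" using exact[OF g(2)] by simp
  moreover have "L g > 0" using g by (intro L_pos) auto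
  ultimately show ?thesis using g(5) by (metis mult_nonpos_nonneg not_less)
qed

end

section \<open>Couplings of discrete measures\<close>

text \<open>
  Points \<open>x\<close> of mass \<open>p x\<close> are assigned to cells \<open>\<kappa> x\<close>, and the cells are to receive the masses \<open>lam k\<close>. The
  plan leaves the fraction \<open>\<theta> k\<close> of every point of the cell \<open>k\<close> in place, so that the cell keeps the smaller
  of its present mass \<open>\<mu> k\<close> and \<open>lam k\<close>, and distributes what is left proportionally to the deficits \<open>e k\<close>.
  The mass that changes its cell is therefore at most the total deficit \<open>D\<close>.
\<close>
lemma exists_coupling_weights:
  fixes p :: "'a \<Rightarrow> real" and lam :: "nat \<Rightarrow> real"
  assumes X: "finite X" and p: "\<And>x. x \<in> X \<Longrightarrow> p x \<ge> 0" "(\<Sum>x\<in>X. p x) = 1"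
    and lam: "\<And>k. k \<le> n \<Longrightarrow> lam k \<ge> 0" "(\<Sum>k\<le>n. lam k) = 1"
    and \<kappa>: "\<And>x. x \<in> X \<Longrightarrow> \<kappa> x \<le> n"
  defines "\<mu> \<equiv> \<lambda>k. \<Sum>x | x \<in> X \<and> \<kappa> x = k. p x"
  shows "\<exists>w. (\<forall>x\<in>X. \<forall>k\<le>n. w x k \<ge> (0::real)) \<and> (\<forall>x\<in>X. (\<Sum>k\<le>n. w x k) = p x) \<and>
    (\<forall>k\<le>n. (\<Sum>x\<in>X. w x k) = lam k) \<and>
    (\<Sum>x\<in>X. \<Sum>k\<le>n. if k = \<kappa> x then 0 else w x k) \<le> (\<Sum>k\<le>n. \<bar>\<mu> k - lam k\<bar>)"
proof -
  have \<mu>0: "\<mu> k \<ge> 0" for k unfolding \<mu>_def using p by (intro sum_nonneg) auto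
  have group: "(\<Sum>x\<in>X. p x * f (\<kappa> x)) = (\<Sum>k\<le>n. \<mu> k * f k)" for f :: "nat \<Rightarrow> real"
  proof -
    have "(\<Sum>x\<in>X. p x * f (\<kappa> x)) = (\<Sum>k\<le>n. \<Sum>x | x \<in> X \<and> \<kappa> x = k. p x * f (\<kappa> x))"
      using X \<kappa> by (intro sum.group[symmetric]) auto
    also have "\<dots> = (\<Sum>k\<le>n. \<mu> k * f k)"
      unfolding \<mu>_def sum_distrib_right by (intro sum.cong) auto
    finally show ?thesis .
  qed
  define \<theta> where "\<theta> k = (if \<mu> k = 0 then 1 else min (\<mu> k) (lam k) / \<mu> k)" for k
  define e where "e k = lam k - min (\<mu> k) (lam k)" for k
  define D where "D = (\<Sum>k\<le>n. e k)"
  have e0: "e k \<ge> 0" for k by (simp add: e_def)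
  have D0: "D \<ge> 0" unfolding D_def using e0 by (intro sum_nonneg) auto
  have \<theta>: "0 \<le> \<theta> k" "\<theta> k \<le> 1" "\<mu> k * \<theta> k = min (\<mu> k) (lam k)" if "k \<le> n" for k
    using \<mu>0[of k] lam(1)[OF that] by (auto simp: \<theta>_def divide_le_eq min_def)
  have \<mu>sum: "(\<Sum>k\<le>n. \<mu> k) = 1" using group[of "\<lambda>_. 1"] p(2) by simp
  have Dm: "D = 1 - (\<Sum>k\<le>n. min (\<mu> k) (lam k))" by (simp add: D_def e_def sum_subtractf lam)
  have exc: "(\<Sum>x\<in>X. p x * (1 - \<theta> (\<kappa> x))) = D"
  proof -
    have "(\<Sum>x\<in>X. p x * (1 - \<theta> (\<kappa> x))) = (\<Sum>k\<le>n. \<mu> k * (1 - \<theta> k))" by (rule group)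
    also have "\<dots> = (\<Sum>k\<le>n. \<mu> k - min (\<mu> k) (lam k))"
      using \<theta>(3) by (intro sum.cong) (auto simp: right_diff_distrib)
    finally show ?thesis by (simp add: sum_subtractf \<mu>sum Dm)
  qed
  \<comment> \<open>if \<open>D = 0\<close>, the quotient is \<open>0\<close>, as it should be: nothing has to be moved\<close>
  define w where "w x k = (if k = \<kappa> x then p x * \<theta> k else 0) + p x * (1 - \<theta> (\<kappa> x)) * (e k / D)" for x k
  have w0: "w x k \<ge> 0" if "x \<in> X" "k \<le> n" for x k
    using p(1)[OF that(1)] \<theta>[OF that(2)] \<theta>[OF \<kappa>[OF that(1)]] e0[of k] D0 by (auto simp: w_def)
  have eD: "(\<Sum>k\<le>n. e k / D) = (if D = 0 then 0 else 1)" by (simp add: sum_divide_distrib[symmetric] D_def[symmetric])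
  have zero: "p x * (1 - \<theta> (\<kappa> x)) = 0" if "D = 0" "x \<in> X" for x
  proof -
    have "\<forall>x\<in>X. p x * (1 - \<theta> (\<kappa> x)) = 0"
      using exc that(1) X p(1) \<theta>(2) \<kappa> by (subst sum_nonneg_eq_0_iff[symmetric]) auto
    then show ?thesis using that(2) by blast
  qed
  have row: "(\<Sum>k\<le>n. w x k) = p x" if x: "x \<in> X" for x
  proof -
    have "(\<Sum>k\<le>n. w x k) = (\<Sum>k\<le>n. if k = \<kappa> x then p x * \<theta> k else 0) + p x * (1 - \<theta> (\<kappa> x)) * (\<Sum>k\<le>n. e k / D)"
      unfolding w_def sum.distrib sum_distrib_left ..
    also have "(\<Sum>k\<le>n. if k = \<kappa> x then p x * \<theta> k else 0) = p x * \<theta> (\<kappa> x)"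
      using \<kappa>[OF x] by simp
    finally show ?thesis using zero[OF _ x] unfolding eD by (cases "D = 0") (simp_all add: right_diff_distrib)
  qed
  have col: "(\<Sum>x\<in>X. w x k) = lam k" if k: "k \<le> n" for k
  proof -
    have "(\<Sum>x\<in>X. w x k) = (\<Sum>x\<in>X. if k = \<kappa> x then p x * \<theta> k else 0) + (\<Sum>x\<in>X. p x * (1 - \<theta> (\<kappa> x))) * (e k / D)"
      unfolding w_def sum.distrib sum_distrib_right ..
    also have "(\<Sum>x\<in>X. if k = \<kappa> x then p x * \<theta> k else 0) = (\<Sum>x\<in>X. p x * (if k = \<kappa> x then \<theta> k else 0))"
      by (intro sum.cong) auto
    also have "\<dots> = (\<Sum>j\<le>n. \<mu> j * (if k = j then \<theta> k else 0))" by (rule group)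
    also have "\<dots> = \<mu> k * \<theta> k" using k by (simp add: if_distrib cong: if_cong)
    also have "\<dots> + (\<Sum>x\<in>X. p x * (1 - \<theta> (\<kappa> x))) * (e k / D) = min (\<mu> k) (lam k) + e k"
    proof (cases "D = 0")
      case True
      then have "e k = 0" using e0 k unfolding D_def by (subst (asm) sum_nonneg_eq_0_iff) auto
      then show ?thesis using \<theta>(3)[OF k] by simp
    next
      case False
      then show ?thesis using \<theta>(3)[OF k] exc by simp
    qed
    finally show ?thesis by (simp add: e_def)
  qed
  have "(\<Sum>x\<in>X. \<Sum>k\<le>n. if k = \<kappa> x then 0 else w x k) \<le> (\<Sum>x\<in>X. \<Sum>k\<le>n. p x * (1 - \<theta> (\<kappa> x)) * (e k / D))"
    using p(1) \<theta>(2) \<kappa> e0 D0 by (intro sum_mono) (auto simp: w_def)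
  also have "\<dots> = (\<Sum>x\<in>X. p x * (1 - \<theta> (\<kappa> x))) * (\<Sum>k\<le>n. e k / D)"
    by (simp only: sum_distrib_left sum_distrib_right sum.swap[of _ "{..n}" X])
  also have "\<dots> = D" unfolding exc eD by simp
  also have "D \<le> (\<Sum>k\<le>n. \<bar>\<mu> k - lam k\<bar>)"
    unfolding D_def e_def by (intro sum_mono) auto
  finally show ?thesis using w0 row col by (intro exI[of _ w]) auto
qed

lemma wasserstein1_sum_dirac_le:
  fixes p :: "'a \<Rightarrow> real" and lam :: "nat \<Rightarrow> real"
  assumes X: "finite X" and w: "\<And>x k. x \<in> X \<Longrightarrow> k \<le> n \<Longrightarrow> w x k \<ge> (0::real)"
    and row: "\<And>x. x \<in> X \<Longrightarrow> (\<Sum>k\<le>n. w x k) = p x" and col: "\<And>k. k \<le> n \<Longrightarrow> (\<Sum>x\<in>X. w x k) = lam k"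
  shows "wasserstein1 (sum_dirac X p b) (sum_dirac {..n} lam \<xi>) \<le> ennreal (\<Sum>x\<in>X. \<Sum>k\<le>n. w x k * \<bar>b x - \<xi> k\<bar>)"
proof -
  let ?S = "X \<times> {..n}"
  let ?P = "point_measure ?S (\<lambda>(x, k). ennreal (w x k))"
  define K where "K = distr ?P borel (\<lambda>(x, k). (b x, \<xi> k))"
  have finS: "finite ?S" using X by simp
  have em: "emeasure (distr (point_measure A (\<lambda>a. ennreal (g a))) borel f) T = ennreal (\<Sum>a\<in>A. g a * indicator T (f a))"
    if "finite A" "\<And>a. a \<in> A \<Longrightarrow> g a \<ge> 0" "T \<in> sets borel" for A and f :: "'z \<Rightarrow> real" and g T
  proof -
    have "emeasure (distr (point_measure A (\<lambda>a. ennreal (g a))) borel f) T = (\<Sum>a\<in>f -` T \<inter> A. ennreal (g a))"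
      using that by (subst emeasure_distr) (auto simp: space_point_measure emeasure_point_measure_finite)
    also have "\<dots> = ennreal (\<Sum>a\<in>f -` T \<inter> A. g a)" using that by (intro sum_ennreal) auto
    also have "(\<Sum>a\<in>f -` T \<inter> A. g a) = (\<Sum>a\<in>A. g a * indicator T (f a))"
      using that by (intro sum.mono_neutral_cong_left) (auto simp: indicator_def)
    finally show ?thesis .
  qed
  have [measurable]: "fst \<in> borel_measurable (borel :: (real \<times> real) measure)"
    "snd \<in> borel_measurable (borel :: (real \<times> real) measure)"
    by (intro borel_measurable_continuous_onI continuous_intros)+
  have P_eq: "?P = point_measure ?S (\<lambda>a. ennreal (case_prod w a))" by (simp add: case_prod_beta')
  have K1: "distr K borel fst = sum_dirac X p b"
  proof -
    have "distr K borel fst = distr ?P borel (\<lambda>a. b (fst a))"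
      unfolding K_def by (subst distr_distr) (auto simp: o_def case_prod_beta')
    also have "\<dots> = sum_dirac X p b"
    proof (rule measure_eqI)
      fix T assume "T \<in> sets (distr ?P borel (\<lambda>a. b (fst a)))"
      then have T: "T \<in> sets borel" by simp
      have "(\<Sum>a\<in>?S. case_prod w a * indicator T (b (fst a))) = (\<Sum>x\<in>X. \<Sum>k\<le>n. w x k * indicator T (b x))"
        by (simp only: sum.cartesian_product case_prod_beta')
      also have "\<dots> = (\<Sum>x\<in>X. p x * indicator T (b x))"
        using row by (intro sum.cong) (auto simp: sum_distrib_right[symmetric])
      finally have eq: "(\<Sum>a\<in>?S. case_prod w a * indicator T (b (fst a))) = (\<Sum>x\<in>X. p x * indicator T (b x))" .
      have p0: "p x \<ge> 0" if "x \<in> X" for x unfolding row[OF that, symmetric] using w that by (intro sum_nonneg) auto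
      show "emeasure (distr ?P borel (\<lambda>a. b (fst a))) T = emeasure (sum_dirac X p b) T"
        unfolding P_eq sum_dirac_def using finS X T w p0 by (subst em, auto simp: eq[symmetric])+
    qed (simp add: sum_dirac_def)
    finally show ?thesis .
  qed
  have K2: "distr K borel snd = sum_dirac {..n} lam \<xi>"
  proof -
    have "distr K borel snd = distr ?P borel (\<lambda>a. \<xi> (snd a))"
      unfolding K_def by (subst distr_distr) (auto simp: o_def case_prod_beta')
    also have "\<dots> = sum_dirac {..n} lam \<xi>"
    proof (rule measure_eqI)
      fix T assume "T \<in> sets (distr ?P borel (\<lambda>a. \<xi> (snd a)))"
      then have T: "T \<in> sets borel" by simp
      have "(\<Sum>a\<in>?S. case_prod w a * indicator T (\<xi> (snd a))) = (\<Sum>x\<in>X. \<Sum>k\<le>n. w x k * indicator T (\<xi> k))"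
        by (simp only: sum.cartesian_product case_prod_beta')
      also have "\<dots> = (\<Sum>k\<le>n. \<Sum>x\<in>X. w x k * indicator T (\<xi> k))" by (rule sum.swap)
      also have "\<dots> = (\<Sum>k\<le>n. lam k * indicator T (\<xi> k))"
        using col by (intro sum.cong) (auto simp: sum_distrib_right[symmetric])
      finally have eq: "(\<Sum>a\<in>?S. case_prod w a * indicator T (\<xi> (snd a))) = (\<Sum>k\<le>n. lam k * indicator T (\<xi> k))" .
      have p0: "lam k \<ge> 0" if "k \<le> n" for k unfolding col[OF that, symmetric] using w that by (intro sum_nonneg) auto
      show "emeasure (distr ?P borel (\<lambda>a. \<xi> (snd a))) T = emeasure (sum_dirac {..n} lam \<xi>) T"
        unfolding P_eq sum_dirac_def using finS X T w p0 by (subst em, auto simp: eq[symmetric])+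
    qed (simp add: sum_dirac_def)
    finally show ?thesis .
  qed
  have "K \<in> couplings (sum_dirac X p b) (sum_dirac {..n} lam \<xi>)"
    using K1 K2 by (simp add: couplings_def K_def)
  then have "wasserstein1 (sum_dirac X p b) (sum_dirac {..n} lam \<xi>) \<le> (\<integral>\<^sup>+ z. ennreal \<bar>fst z - snd z\<bar> \<partial>K)"
    unfolding wasserstein1_def by (intro INF_lower)
  also have "\<dots> = (\<integral>\<^sup>+ a. ennreal \<bar>b (fst a) - \<xi> (snd a)\<bar> \<partial>?P)"
    unfolding K_def by (subst nn_integral_distr) (auto simp: case_prod_beta')
  also have "\<dots> = (\<Sum>a\<in>?S. (case a of (x, k) \<Rightarrow> ennreal (w x k)) * ennreal \<bar>b (fst a) - \<xi> (snd a)\<bar>)"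
    by (rule nn_integral_point_measure_finite[OF finS])
  also have "\<dots> = (\<Sum>a\<in>?S. ennreal (case_prod w a * \<bar>b (fst a) - \<xi> (snd a)\<bar>))"
    using w by (intro sum.cong) (auto simp: ennreal_mult)
  also have "\<dots> = ennreal (\<Sum>a\<in>?S. case_prod w a * \<bar>b (fst a) - \<xi> (snd a)\<bar>)"
    using w by (intro sum_ennreal) auto
  also have "(\<Sum>a\<in>?S. case_prod w a * \<bar>b (fst a) - \<xi> (snd a)\<bar>) = (\<Sum>x\<in>X. \<Sum>k\<le>n. w x k * \<bar>b x - \<xi> k\<bar>)"
    by (simp add: sum.cartesian_product case_prod_beta')
  finally show ?thesis .
qed

section \<open>Samples close to the nodes of a quadrature rule\<close>

text \<open>
  A finite sample \<open>b\<close> in \<open>{-1..\<alpha>}\<close> whose averages of polynomials of degree at most \<open>t\<close> agree with a positive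
  quadrature rule whose largest node is at most \<open>\<alpha>\<close>. The map \<open>\<kappa>\<close> assigns to each
  sample point a nearest node, where the largest node is replaced by \<open>\<alpha>\<close>. The node distances are at least
  \<open>2 * h\<close>, the polynomials \<open>l i\<close> separate the nodes, and \<open>\<Lambda>\<close> is a Lipschitz constant for them.
\<close>
locale near_quadrature =
  fixes t n :: nat and \<xi> lam :: "nat \<Rightarrow> real" and h \<Lambda> :: real and l :: "nat \<Rightarrow> real poly"
    and X :: "'a set" and b :: "'a \<Rightarrow> real" and \<alpha> :: real and \<kappa> :: "'a \<Rightarrow> nat"
  assumes n: "n = t div 2" "n \<ge> 1"
    and h: "0 < h" "h \<le> 1"
    and gap: "\<And>i j. i \<le> n \<Longrightarrow> j \<le> n \<Longrightarrow> i \<noteq> j \<Longrightarrow> 2 * h \<le> \<bar>\<xi> i - \<xi> j\<bar>"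
    and top: "\<And>i. i \<le> n \<Longrightarrow> \<xi> i \<le> \<xi> n"
    and range: "\<And>i. i \<le> n \<Longrightarrow> -1 \<le> \<xi> i \<and> \<xi> i \<le> 1"
    and radau: "even t \<Longrightarrow> \<xi> 0 = -1"
    and lam: "\<And>i. i \<le> n \<Longrightarrow> lam i \<ge> 0" "(\<Sum>i\<le>n. lam i) = 1"
    and l: "\<And>i. i \<le> n \<Longrightarrow> degree (l i) \<le> t"
      "\<And>i j. i \<le> n \<Longrightarrow> j \<le> n \<Longrightarrow> poly (l i) (\<xi> j) = (if i = j then 1 else 0)"
    and lip: "\<And>i s s'. i \<le> n \<Longrightarrow> s \<in> {-1..2} \<Longrightarrow> s' \<in> {-1..2} \<Longrightarrow> \<bar>poly (l i) s - poly (l i) s'\<bar> \<le> \<Lambda> * \<bar>s - s'\<bar>"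
    and \<Lambda>: "\<Lambda> \<ge> 0"
    and X: "finite X" "X \<noteq> {}"
    and \<alpha>: "\<xi> n \<le> \<alpha>" "\<alpha> \<le> \<xi> n + 1"
    and b: "\<And>x. x \<in> X \<Longrightarrow> -1 \<le> b x \<and> b x \<le> \<alpha>"
    and avg: "\<And>q. degree q \<le> t \<Longrightarrow> (1 / real (card X)) * (\<Sum>x\<in>X. poly q (b x)) = (\<Sum>i\<le>n. lam i * poly q (\<xi> i))"
    and \<kappa>: "\<And>x. x \<in> X \<Longrightarrow> \<kappa> x \<le> n"
      "\<And>x j. x \<in> X \<Longrightarrow> j \<le> n \<Longrightarrow>
        \<bar>b x - (if \<kappa> x < n then \<xi> (\<kappa> x) else \<alpha>)\<bar> \<le> \<bar>b x - (if j < n then \<xi> j else \<alpha>)\<bar>"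
begin

definition "N = real (card X)"
definition "\<delta> = \<alpha> - \<xi> n"
text \<open>
  The moving nodes: only the largest one moves, to the end of the interval.
\<close>
definition "mv k = (if k < n then \<xi> k else \<alpha>)"
text \<open>
  The nodes below the largest one are zeros of the test polynomial below, double zeros except for the
  node \<open>-1\<close> of even \<open>t\<close>, which is simple because it lies at the end of the interval.
\<close>
definition "J = {(if even t then 1 else 0)..<n}"
text \<open>
  The test polynomial of degree \<open>t\<close>: nonnegative on \<open>{-1..\<alpha>}\<close>, zero at all nodes except the largest, and of
  size \<open>O(\<alpha> - \<xi> n)\<close> there.
\<close>
definition "Q = [:\<alpha>, -1:] * (if even t then [:1, 1:] else 1) * (\<Prod>k\<in>J. [:- \<xi> k, 1:]\<^sup>2)"
text \<open>
  The constant of the quadratic estimate: a factor \<open>3 / h\<^bsup>2n+2\<^esup>\<close> comes from comparing the squared distance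
  with \<open>Q\<close>, and \<open>2 * 4 ^ n * \<delta>\<close> bounds the average of \<open>Q\<close>.
\<close>
definition "K = 6 * 4 ^ n / h ^ (2 * n + 2)"

lemma N: "N > 0" using X by (simp add: N_def card_gt_0_iff)

lemma \<delta>: "0 \<le> \<delta>" "\<delta> \<le> 1" using \<alpha> by (auto simp: \<delta>_def)

lemma K: "K \<ge> 0" using h by (simp add: K_def)

lemma poly_Q: "poly Q s = (\<alpha> - s) * (if even t then s + 1 else 1) * (\<Prod>k\<in>J. (s - \<xi> k)\<^sup>2)"
  by (simp add: Q_def poly_prod poly_power add.commute del: mult_pCons_left mult_pCons_right)

lemma degree_Q: "degree Q \<le> t"
proof -
  have "degree (\<Prod>k\<in>J. [:- \<xi> k, 1:]\<^sup>2) \<le> (\<Sum>k\<in>J. 2)"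
    by (rule order_trans[OF degree_prod_sum_le]) (auto simp: J_def o_def degree_power_eq intro!: sum_mono)
  also have "\<dots> = 2 * card J" by simp
  finally have J: "degree (\<Prod>k\<in>J. [:- \<xi> k, 1:]\<^sup>2) \<le> 2 * card J" .
  have E: "degree (if even t then [:1, 1 :: real:] else 1) \<le> (if even t then 1 else 0)" by simp
  let ?l = "[:\<alpha>, -1:]" and ?e = "if even t then [:1, 1 :: real:] else 1"
  have "degree Q \<le> degree (?l * ?e) + degree (\<Prod>k\<in>J. [:- \<xi> k, 1:]\<^sup>2)"
    unfolding Q_def by (rule degree_mult_le)
  moreover have "degree (?l * ?e) \<le> degree ?l + degree ?e" by (rule degree_mult_le)
  moreover have "degree ?l = 1" by simp
  ultimately have "degree Q \<le> 1 + (if even t then 1 else 0) + 2 * card J"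
    using J E by linarith
  also have "\<dots> = t"
  proof -
    have "card J = (if even t then n - 1 else n)" by (simp add: J_def)
    moreover have "t = 2 * (t div 2) + (if even t then 0 else 1)" by presburger
    ultimately show ?thesis using n by (cases "even t") auto
  qed
  finally show ?thesis .
qed

lemma gap_mv:
  assumes "i \<le> n" "j \<le> n" "i \<noteq> j"
  shows "2 * h \<le> \<bar>mv i - mv j\<bar>"
proof -
  have "2 * h \<le> \<bar>\<xi> i - \<xi> j\<bar>" by (rule gap[OF assms])
  moreover have "\<xi> i \<le> \<xi> n" "\<xi> j \<le> \<xi> n" using top assms by auto
  moreover have "i = n \<or> i < n" "j = n \<or> j < n" using assms by auto
  ultimately show ?thesis using \<alpha> assms by (auto simp: mv_def)
qed

text \<open>
  The moving nodes are \<open>2 * h\<close> apart, so a point is at distance at least \<open>h\<close> from all but the nearest one.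
\<close>
lemma far:
  assumes x: "x \<in> X" and j: "j \<le> n" "j \<noteq> \<kappa> x"
  shows "h \<le> \<bar>b x - mv j\<bar>"
proof -
  have "2 * h \<le> \<bar>mv (\<kappa> x) - mv j\<bar>" using gap_mv[OF \<kappa>(1)[OF x] j(1)] j by auto
  moreover have "\<bar>b x - mv (\<kappa> x)\<bar> \<le> \<bar>b x - mv j\<bar>" using \<kappa>(2)[OF x j(1)] by (simp add: mv_def)
  ultimately show ?thesis by linarith
qed

lemma prod_far:
  assumes x: "x \<in> X" and I: "I \<subseteq> J" "\<kappa> x \<notin> I"
  shows "h ^ (2 * n) \<le> (\<Prod>k\<in>I. (b x - \<xi> k)\<^sup>2)"
proof -
  have fin: "finite I" using I finite_subset by (auto simp: J_def)
  have "card I \<le> card J" using I by (intro card_mono) (auto simp: J_def)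
  also have "\<dots> \<le> n" by (simp add: J_def)
  finally have "(h\<^sup>2) ^ n \<le> (h\<^sup>2) ^ card I" using h by (intro power_decreasing) (auto simp: power_le_one)
  also have "\<dots> = (\<Prod>k\<in>I. h\<^sup>2)" by simp
  also have "\<dots> \<le> (\<Prod>k\<in>I. (b x - \<xi> k)\<^sup>2)"
  proof (intro prod_mono conjI)
    fix k assume k: "k \<in> I"
    then have "k < n" using I by (auto simp: J_def)
    then have "h \<le> \<bar>b x - \<xi> k\<bar>" using far[OF x, of k] k I by (auto simp: mv_def)
    then show "h\<^sup>2 \<le> (b x - \<xi> k)\<^sup>2" using h by (simp add: abs_le_square_iff[symmetric])
  qed auto
  finally show ?thesis by (simp add: power_mult)
qed

lemma Q_nonneg: "x \<in> X \<Longrightarrow> poly Q (b x) \<ge> 0"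
  unfolding poly_Q using b[of x] by (auto intro!: mult_nonneg_nonneg prod_nonneg)

text \<open>
  All factors of \<open>Q\<close> but the one of the nearest moving node are bounded below by powers of \<open>h\<close>. For a node
  in the interior that factor is the squared distance. For the two ends it is the distance itself, which
  dominates the square up to a factor \<open>3\<close> because the interval has length at most \<open>3\<close>.
\<close>
lemma Q_lower:
  assumes x: "x \<in> X"
  shows "h ^ (2 * n + 2) * (b x - mv (\<kappa> x))\<^sup>2 \<le> 3 * poly Q (b x)"
    and "\<kappa> x = n \<Longrightarrow> h ^ (2 * n + 2) * (\<alpha> - b x) \<le> poly Q (b x)"
proof -
  let ?s = "b x"
  let ?a = "\<alpha> - ?s" and ?c = "if even t then ?s + 1 else 1"
  have s: "-1 \<le> ?s" "?s \<le> \<alpha>" using b[OF x] by auto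
  have \<alpha>2: "\<alpha> \<le> 2" using \<alpha> range[of n] by auto
  have hh: "h ^ (2 * n + 2) = h * h * h ^ (2 * n)" by (simp add: power_add power2_eq_square)
  have h1: "h * h * h ^ (2 * n) \<le> h * h ^ (2 * n)" "h * h ^ (2 * n) \<ge> 0"
    using h by (auto intro!: mult_right_mono simp: mult_le_one)
  have c: "h \<le> ?c" if "even t \<Longrightarrow> \<kappa> x \<noteq> 0"
  proof (cases "even t")
    case True
    then have "h \<le> \<bar>?s - mv 0\<bar>" using that by (intro far[OF x]) auto
    then show ?thesis using True n(2) radau s by (simp add: mv_def)
  qed (use h in simp)
  have a: "h \<le> ?a" if "\<kappa> x \<noteq> n"
    using far[OF x, of n] that s by (simp add: mv_def)
  show top: "h ^ (2 * n + 2) * (\<alpha> - b x) \<le> poly Q (b x)" if k: "\<kappa> x = n"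
  proof -
    have "h * h ^ (2 * n) \<le> ?c * (\<Prod>k\<in>J. (?s - \<xi> k)\<^sup>2)"
      using c k n(2) prod_far[OF x order_refl] h s by (intro mult_mono) (auto simp: J_def)
    then have "h * h * h ^ (2 * n) * ?a \<le> ?c * (\<Prod>k\<in>J. (?s - \<xi> k)\<^sup>2) * ?a"
      using h1 s by (intro mult_right_mono) auto
    then show ?thesis unfolding hh poly_Q by (simp only: mult_ac)
  qed
  show "h ^ (2 * n + 2) * (b x - mv (\<kappa> x))\<^sup>2 \<le> 3 * poly Q (b x)"
  proof -
    consider "\<kappa> x = n" | "\<kappa> x \<noteq> n" "\<kappa> x \<in> J" | "\<kappa> x \<noteq> n" "\<kappa> x \<notin> J" by blast
    then show ?thesis
    proof cases
      case 1
      have "(?s - mv (\<kappa> x))\<^sup>2 = ?a * ?a" using 1 by (simp add: mv_def power2_eq_square algebra_simps)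
      also have "\<dots> \<le> 3 * ?a" using s \<alpha>2 by (intro mult_right_mono) auto
      finally have "h ^ (2 * n + 2) * (?s - mv (\<kappa> x))\<^sup>2 \<le> h ^ (2 * n + 2) * (3 * ?a)"
        using h by (intro mult_left_mono) auto
      moreover have "h ^ (2 * n + 2) * (3 * ?a) = 3 * (h ^ (2 * n + 2) * ?a)" by (rule mult.left_commute)
      ultimately show ?thesis using top[OF 1] by linarith
    next
      case 2
      then have kn: "\<kappa> x < n" by (auto simp: J_def)
      have "(\<Prod>k\<in>J. (?s - \<xi> k)\<^sup>2) = (?s - mv (\<kappa> x))\<^sup>2 * (\<Prod>k\<in>J - {\<kappa> x}. (?s - \<xi> k)\<^sup>2)"
        using 2 kn by (subst prod.remove[of J "\<kappa> x"]) (auto simp: J_def mv_def)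
      moreover have "h * h * h ^ (2 * n) \<le> ?a * ?c * (\<Prod>k\<in>J - {\<kappa> x}. (?s - \<xi> k)\<^sup>2)"
        using a c 2 h s prod_far[OF x, of "J - {\<kappa> x}"] by (intro mult_mono) (auto simp: J_def)
      then have "h * h * h ^ (2 * n) * (?s - mv (\<kappa> x))\<^sup>2 \<le> ?a * ?c * (\<Prod>k\<in>J - {\<kappa> x}. (?s - \<xi> k)\<^sup>2) * (?s - mv (\<kappa> x))\<^sup>2"
        by (intro mult_right_mono) auto
      ultimately have "h ^ (2 * n + 2) * (?s - mv (\<kappa> x))\<^sup>2 \<le> poly Q ?s"
        unfolding hh poly_Q by (simp only: mult_ac)
      then show ?thesis using Q_nonneg[OF x] by linarith
    next
      case 3
      then have k0: "even t" "\<kappa> x = 0" using \<kappa>(1)[OF x] by (auto simp: J_def split: if_splits)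
      have "(?s - mv (\<kappa> x))\<^sup>2 = (?s + 1) * (?s + 1)"
        using k0 n(2) radau by (simp add: mv_def power2_eq_square)
      also have "\<dots> \<le> 3 * (?s + 1)" using s \<alpha>2 by (intro mult_right_mono) auto
      finally have 1: "h ^ (2 * n + 2) * (?s - mv (\<kappa> x))\<^sup>2 \<le> h ^ (2 * n + 2) * (3 * (?s + 1))"
        using h by (intro mult_left_mono) auto
      have "h * h ^ (2 * n) \<le> ?a * (\<Prod>k\<in>J. (?s - \<xi> k)\<^sup>2)"
        using a 3 prod_far[OF x order_refl] h s by (intro mult_mono) auto
      then have "h * h * h ^ (2 * n) * (?s + 1) \<le> ?a * (\<Prod>k\<in>J. (?s - \<xi> k)\<^sup>2) * (?s + 1)"
        using h1 s by (intro mult_right_mono) auto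
      also have "\<dots> = poly Q ?s" using k0 by (simp add: poly_Q)
      finally show ?thesis using 1 unfolding hh by linarith
    qed
  qed
qed

text \<open>
  The quadrature rule sees only the largest node, where \<open>Q\<close> has the small factor \<open>\<delta>\<close>.
\<close>
lemma Q_average: "(1 / N) * (\<Sum>x\<in>X. poly Q (b x)) \<le> 2 * 4 ^ n * \<delta>"
proof -
  have "(1 / N) * (\<Sum>x\<in>X. poly Q (b x)) = (\<Sum>i\<le>n. lam i * poly Q (\<xi> i))"
    unfolding N_def by (rule avg[OF degree_Q])
  also have "\<dots> = (\<Sum>i\<le>n. if i = n then lam n * poly Q (\<xi> n) else 0)"
  proof (intro sum.cong refl)
    fix i assume i: "i \<in> {..n}"
    have "poly Q (\<xi> i) = 0" if "i \<noteq> n"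
    proof (cases "i \<in> J")
      case True
      then show ?thesis unfolding poly_Q by (auto simp: J_def prod_zero_iff)
    next
      case False
      then have "even t" "i = 0" using i that by (auto simp: J_def split: if_splits)
      then show ?thesis using radau by (simp add: poly_Q)
    qed
    then show "lam i * poly Q (\<xi> i) = (if i = n then lam n * poly Q (\<xi> n) else 0)" by simp
  qed
  also have "\<dots> = lam n * poly Q (\<xi> n)" by simp
  also have "\<dots> \<le> 1 * (2 * 4 ^ n * \<delta>)"
  proof (intro mult_mono)
    have "lam n \<le> (\<Sum>i\<le>n. lam i)" using lam(1) by (intro member_le_sum) auto
    then show "lam n \<le> 1" using lam(2) by simp
    have "(\<Prod>k\<in>J. (\<xi> n - \<xi> k)\<^sup>2) \<le> (\<Prod>k\<in>J. 4)"
    proof (intro prod_mono conjI)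
      fix k assume "k \<in> J"
      then have "k \<le> n" by (auto simp: J_def)
      then have "\<bar>\<xi> n - \<xi> k\<bar> \<le> \<bar>2\<bar>" using range[of n] range[of k] by auto
      then have "(\<xi> n - \<xi> k)\<^sup>2 \<le> 2\<^sup>2" by (simp only: abs_le_square_iff)
      then show "(\<xi> n - \<xi> k)\<^sup>2 \<le> 4" by simp
    qed auto
    also have "\<dots> \<le> 4 ^ n" by (simp add: J_def power_increasing)
    finally have p: "(\<Prod>k\<in>J. (\<xi> n - \<xi> k)\<^sup>2) \<le> 4 ^ n" .
    have "poly Q (\<xi> n) = \<delta> * (if even t then \<xi> n + 1 else 1) * (\<Prod>k\<in>J. (\<xi> n - \<xi> k)\<^sup>2)"
      by (simp add: poly_Q \<delta>_def)
    also have "\<dots> \<le> \<delta> * 2 * 4 ^ n"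
      using p \<delta> range[of n] by (intro mult_mono) (auto intro!: prod_nonneg)
    finally show "poly Q (\<xi> n) \<le> 2 * 4 ^ n * \<delta>" by (simp add: mult_ac)
    show "0 \<le> poly Q (\<xi> n)"
      unfolding poly_Q using \<alpha> range[of n] by (auto intro!: mult_nonneg_nonneg prod_nonneg)
  qed auto
  finally show ?thesis by simp
qed

lemma square_average: "(1 / N) * (\<Sum>x\<in>X. (b x - mv (\<kappa> x))\<^sup>2) \<le> K * \<delta>"
proof -
  have "h ^ (2 * n + 2) * (\<Sum>x\<in>X. (b x - mv (\<kappa> x))\<^sup>2) \<le> 3 * (\<Sum>x\<in>X. poly Q (b x))"
    unfolding sum_distrib_left by (intro sum_mono Q_lower)
  then have "(1 / N) * (h ^ (2 * n + 2) * (\<Sum>x\<in>X. (b x - mv (\<kappa> x))\<^sup>2)) \<le> (1 / N) * (3 * (\<Sum>x\<in>X. poly Q (b x)))"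
    using N by (intro mult_left_mono) auto
  also have "\<dots> = 3 * ((1 / N) * (\<Sum>x\<in>X. poly Q (b x)))" by simp
  also have "\<dots> \<le> 3 * (2 * 4 ^ n * \<delta>)" by (intro mult_left_mono Q_average) auto
  finally have "h ^ (2 * n + 2) * ((1 / N) * (\<Sum>x\<in>X. (b x - mv (\<kappa> x))\<^sup>2)) \<le> 6 * 4 ^ n * \<delta>" by (simp only: mult_ac)
  then show ?thesis unfolding K_def using h by (simp add: field_simps)
qed

lemma top_average: "(1 / N) * (\<Sum>x | x \<in> X \<and> \<kappa> x = n. \<alpha> - b x) \<le> K * \<delta>"
proof -
  have "h ^ (2 * n + 2) * (\<Sum>x | x \<in> X \<and> \<kappa> x = n. \<alpha> - b x) \<le> (\<Sum>x | x \<in> X \<and> \<kappa> x = n. poly Q (b x))"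
    unfolding sum_distrib_left by (intro sum_mono Q_lower) auto
  also have "\<dots> \<le> (\<Sum>x\<in>X. poly Q (b x))"
    using X Q_nonneg by (intro sum_mono2) auto
  finally have "(1 / N) * (h ^ (2 * n + 2) * (\<Sum>x | x \<in> X \<and> \<kappa> x = n. \<alpha> - b x)) \<le> (1 / N) * (\<Sum>x\<in>X. poly Q (b x))"
    using N by (intro mult_left_mono) auto
  also have "\<dots> \<le> 2 * 4 ^ n * \<delta>" by (rule Q_average)
  also have "\<dots> \<le> 6 * 4 ^ n * \<delta>" using \<delta> by (intro mult_right_mono) auto
  finally have "h ^ (2 * n + 2) * ((1 / N) * (\<Sum>x | x \<in> X \<and> \<kappa> x = n. \<alpha> - b x)) \<le> 6 * 4 ^ n * \<delta>" by (simp only: mult_ac)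
  then show ?thesis unfolding K_def using h by (simp add: field_simps)
qed

lemma delta_le_sqrt: "\<delta> \<le> sqrt \<delta>"
proof -
  have "\<delta> * \<delta> \<le> \<delta> * 1" using \<delta> by (intro mult_left_mono) auto
  then have "\<delta>\<^sup>2 \<le> \<delta>" by (simp add: power2_eq_square)
  then show ?thesis by (rule real_le_rsqrt)
qed

lemma node_shift:
  assumes "x \<in> X"
  shows "\<bar>mv (\<kappa> x) - \<xi> (\<kappa> x)\<bar> \<le> \<delta>"
  using \<kappa>(1)[OF assms] \<delta> by (cases "\<kappa> x = n") (auto simp: mv_def \<delta>_def)

definition "K1 = sqrt K + 1"

lemma K1: "K1 \<ge> 0" using K by (simp add: K1_def)

text \<open>
  Cauchy-Schwarz turns the mean squared distance into a mean distance. Replacing \<open>\<alpha>\<close> by the largest node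
  costs \<open>\<delta>\<close>, which is at most \<open>sqrt \<delta>\<close>.
\<close>
lemma distance_average: "(1 / N) * (\<Sum>x\<in>X. \<bar>b x - \<xi> (\<kappa> x)\<bar>) \<le> K1 * sqrt \<delta>"
proof -
  have "(\<Sum>x\<in>X. \<bar>b x - mv (\<kappa> x)\<bar>)\<^sup>2 = (\<Sum>x\<in>X. 1 * \<bar>b x - mv (\<kappa> x)\<bar>)\<^sup>2" by simp
  also have "\<dots> \<le> (\<Sum>x\<in>X. 1\<^sup>2) * (\<Sum>x\<in>X. \<bar>b x - mv (\<kappa> x)\<bar>\<^sup>2)" by (rule Cauchy_Schwarz_ineq_sum)
  also have "\<dots> = N * (\<Sum>x\<in>X. (b x - mv (\<kappa> x))\<^sup>2)" by (simp add: N_def)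
  finally have "((1 / N) * (\<Sum>x\<in>X. \<bar>b x - mv (\<kappa> x)\<bar>))\<^sup>2 \<le> (1 / N) * (\<Sum>x\<in>X. (b x - mv (\<kappa> x))\<^sup>2)"
    using N by (simp add: power2_eq_square field_simps)
  also have "\<dots> \<le> K * \<delta>" by (rule square_average)
  finally have "(1 / N) * (\<Sum>x\<in>X. \<bar>b x - mv (\<kappa> x)\<bar>) \<le> sqrt (K * \<delta>)" by (rule real_le_rsqrt)
  then have 1: "(1 / N) * (\<Sum>x\<in>X. \<bar>b x - mv (\<kappa> x)\<bar>) \<le> sqrt K * sqrt \<delta>" by (simp add: real_sqrt_mult)
  have "(\<Sum>x\<in>X. \<bar>b x - \<xi> (\<kappa> x)\<bar>) \<le> (\<Sum>x\<in>X. \<bar>b x - mv (\<kappa> x)\<bar> + \<delta>)"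
    using node_shift by (intro sum_mono) (smt (verit))
  also have "\<dots> = (\<Sum>x\<in>X. \<bar>b x - mv (\<kappa> x)\<bar>) + N * \<delta>" by (simp add: sum.distrib N_def)
  finally have "(1 / N) * (\<Sum>x\<in>X. \<bar>b x - \<xi> (\<kappa> x)\<bar>) \<le> (1 / N) * ((\<Sum>x\<in>X. \<bar>b x - mv (\<kappa> x)\<bar>) + N * \<delta>)"
    using N by (intro mult_left_mono) auto
  also have "\<dots> = (1 / N) * (\<Sum>x\<in>X. \<bar>b x - mv (\<kappa> x)\<bar>) + \<delta>" using N by (simp add: field_simps)
  finally show ?thesis using 1 delta_le_sqrt by (simp add: K1_def algebra_simps)
qed

lemma infdist_average:
  assumes Z: "Z = \<xi> ` {..n}"
  shows "(1 / N) * (\<Sum>x\<in>X. (infdist (b x) Z)\<^sup>2) \<le> (2 * K + 2) * \<delta>"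
proof -
  have "(infdist (b x) Z)\<^sup>2 \<le> 2 * (b x - mv (\<kappa> x))\<^sup>2 + 2 * \<delta>" if x: "x \<in> X" for x
  proof -
    have "infdist (b x) Z \<le> dist (b x) (\<xi> (\<kappa> x))"
      using Z \<kappa>(1)[OF x] by (intro infdist_le) auto
    also have "\<dots> \<le> \<bar>b x - mv (\<kappa> x)\<bar> + \<delta>" using node_shift[OF x] by (simp add: dist_real_def)
    finally have "(infdist (b x) Z)\<^sup>2 \<le> (\<bar>b x - mv (\<kappa> x)\<bar> + \<delta>)\<^sup>2"
      by (intro power_mono infdist_nonneg)
    also have "\<dots> \<le> 2 * (b x - mv (\<kappa> x))\<^sup>2 + 2 * \<delta>\<^sup>2"
    proof -
      have "0 \<le> (\<bar>b x - mv (\<kappa> x)\<bar> - \<delta>)\<^sup>2" by simp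
      then show ?thesis by (simp add: power2_sum power2_diff)
    qed
    also have "\<delta>\<^sup>2 \<le> \<delta>" using \<delta> by (simp add: power2_eq_square mult_left_le)
    finally show ?thesis by simp
  qed
  then have "(\<Sum>x\<in>X. (infdist (b x) Z)\<^sup>2) \<le> (\<Sum>x\<in>X. 2 * (b x - mv (\<kappa> x))\<^sup>2 + 2 * \<delta>)" by (intro sum_mono)
  also have "\<dots> = 2 * (\<Sum>x\<in>X. (b x - mv (\<kappa> x))\<^sup>2) + N * (2 * \<delta>)"
    by (simp add: sum.distrib sum_distrib_left N_def)
  finally have "(1 / N) * (\<Sum>x\<in>X. (infdist (b x) Z)\<^sup>2) \<le> (1 / N) * (2 * (\<Sum>x\<in>X. (b x - mv (\<kappa> x))\<^sup>2) + N * (2 * \<delta>))"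
    using N by (intro mult_left_mono) auto
  also have "\<dots> = 2 * ((1 / N) * (\<Sum>x\<in>X. (b x - mv (\<kappa> x))\<^sup>2)) + 2 * \<delta>" using N by (simp add: field_simps)
  finally show ?thesis using square_average by (simp add: algebra_simps)
qed

text \<open>
  The polynomial \<open>l k\<close> is the indicator of the node \<open>k\<close> among the nodes. Its sample average is the weight
  \<open>lam k\<close>, while moving every sample point to its node turns the average into the relative size of the
  cell; by the Lipschitz bound the difference is at most \<open>\<Lambda>\<close> times the mean distance.
\<close>
lemma mass:
  assumes k: "k \<le> n"
  shows "\<bar>real (card {x \<in> X. \<kappa> x = k}) / N - lam k\<bar> \<le> \<Lambda> * K1 * sqrt \<delta>"
proof -
  have "lam k = (\<Sum>i\<le>n. lam i * poly (l k) (\<xi> i))"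
  proof -
    have "(\<Sum>i\<le>n. lam i * poly (l k) (\<xi> i)) = (\<Sum>i\<le>n. if i = k then lam k else 0)"
      by (intro sum.cong) (auto simp: l(2)[OF k])
    then show ?thesis using k by simp
  qed
  also have "\<dots> = (1 / N) * (\<Sum>x\<in>X. poly (l k) (b x))"
    unfolding N_def by (rule avg[OF l(1)[OF k], symmetric])
  finally have lk: "lam k = (1 / N) * (\<Sum>x\<in>X. poly (l k) (b x))" .
  have "(\<Sum>x\<in>X. poly (l k) (\<xi> (\<kappa> x))) = (\<Sum>x\<in>X. if \<kappa> x = k then 1 else 0)"
    using k \<kappa>(1) l(2) by (intro sum.cong) auto
  also have "\<dots> = real (card {x \<in> X. \<kappa> x = k})"
    using X(1) by (simp add: sum.If_cases Collect_conj_eq)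
  finally have mk: "real (card {x \<in> X. \<kappa> x = k}) / N = (1 / N) * (\<Sum>x\<in>X. poly (l k) (\<xi> (\<kappa> x)))" by simp
  have "\<bar>real (card {x \<in> X. \<kappa> x = k}) / N - lam k\<bar> = (1 / N) * \<bar>\<Sum>x\<in>X. poly (l k) (\<xi> (\<kappa> x)) - poly (l k) (b x)\<bar>"
    unfolding mk lk using N by (simp add: sum_subtractf right_diff_distrib[symmetric] abs_mult diff_divide_distrib[symmetric])
  also have "\<dots> \<le> (1 / N) * (\<Sum>x\<in>X. \<Lambda> * \<bar>b x - \<xi> (\<kappa> x)\<bar>)"
  proof (intro mult_left_mono order_trans[OF sum_abs] sum_mono)
    fix x assume x: "x \<in> X"
    have "b x \<in> {-1..2}" using b[OF x] \<alpha> range[of n] by auto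
    moreover have "\<xi> (\<kappa> x) \<in> {-1..2}" using range[OF \<kappa>(1)[OF x]] by auto
    ultimately show "\<bar>poly (l k) (\<xi> (\<kappa> x)) - poly (l k) (b x)\<bar> \<le> \<Lambda> * \<bar>b x - \<xi> (\<kappa> x)\<bar>"
      using lip[OF k] by (metis abs_minus_commute)
  qed (use N in auto)
  also have "\<dots> = \<Lambda> * ((1 / N) * (\<Sum>x\<in>X. \<bar>b x - \<xi> (\<kappa> x)\<bar>))" by (simp add: sum_distrib_left)
  also have "\<dots> \<le> \<Lambda> * (K1 * sqrt \<delta>)" by (intro mult_left_mono distance_average \<Lambda>)
  finally show ?thesis by (simp add: mult.assoc)
qed

text \<open>
  The coupling moves each point to the node of its cell, at the cost of the mean distance, and then moves
  the excess of the cells, estimated by the previous lemma, over distances of at most \<open>2\<close>.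
\<close>
lemma wasserstein:
  "wasserstein1 (sum_dirac X (\<lambda>_. 1 / N) b) (sum_dirac {..n} lam \<xi>)
    \<le> ennreal ((K1 + 2 * real (n + 1) * \<Lambda> * K1) * sqrt \<delta>)"
proof -
  have \<mu>: "(\<Sum>x | x \<in> X \<and> \<kappa> x = k. 1 / N) = real (card {x \<in> X. \<kappa> x = k}) / N" for k by simp
  have "\<exists>w. (\<forall>x\<in>X. \<forall>k\<le>n. w x k \<ge> (0::real)) \<and> (\<forall>x\<in>X. (\<Sum>k\<le>n. w x k) = 1 / N) \<and>
    (\<forall>k\<le>n. (\<Sum>x\<in>X. w x k) = lam k) \<and>
    (\<Sum>x\<in>X. \<Sum>k\<le>n. if k = \<kappa> x then 0 else w x k) \<le> (\<Sum>k\<le>n. \<bar>real (card {x \<in> X. \<kappa> x = k}) / N - lam k\<bar>)"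
    by (rule exists_coupling_weights[where p = "\<lambda>_. 1 / N" and X = X and \<kappa> = \<kappa> and n = n and lam = lam, unfolded \<mu>])
      (use N in \<open>auto simp: N_def intro: X lam \<kappa>(1)\<close>)
  then obtain w where w: "\<forall>x\<in>X. \<forall>k\<le>n. w x k \<ge> (0::real)" "\<forall>x\<in>X. (\<Sum>k\<le>n. w x k) = 1 / N"
    "\<forall>k\<le>n. (\<Sum>x\<in>X. w x k) = lam k"
    "(\<Sum>x\<in>X. \<Sum>k\<le>n. if k = \<kappa> x then 0 else w x k) \<le> (\<Sum>k\<le>n. \<bar>real (card {x \<in> X. \<kappa> x = k}) / N - lam k\<bar>)"
    by (elim exE conjE) (rule that)
  have "wasserstein1 (sum_dirac X (\<lambda>_. 1 / N) b) (sum_dirac {..n} lam \<xi>) \<le> ennreal (\<Sum>x\<in>X. \<Sum>k\<le>n. w x k * \<bar>b x - \<xi> k\<bar>)"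
    using w by (intro wasserstein1_sum_dirac_le X) auto
  also have "\<dots> \<le> ennreal ((K1 + 2 * real (n + 1) * \<Lambda> * K1) * sqrt \<delta>)"
  proof (rule ennreal_leI)
    have "(\<Sum>x\<in>X. \<Sum>k\<le>n. w x k * \<bar>b x - \<xi> k\<bar>) \<le>
        (\<Sum>x\<in>X. \<Sum>k\<le>n. w x k * \<bar>b x - \<xi> (\<kappa> x)\<bar> + 2 * (if k = \<kappa> x then 0 else w x k))"
    proof (intro sum_mono)
      fix x k assume xk: "x \<in> X" "k \<in> {..n}"
      then have w0: "w x k \<ge> 0" using w(1) by auto
      show "w x k * \<bar>b x - \<xi> k\<bar> \<le> w x k * \<bar>b x - \<xi> (\<kappa> x)\<bar> + 2 * (if k = \<kappa> x then 0 else w x k)"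
      proof (cases "k = \<kappa> x")
        case False
        have "\<bar>b x - \<xi> k\<bar> \<le> \<bar>b x - \<xi> (\<kappa> x)\<bar> + 2"
          using range[OF \<kappa>(1)[OF xk(1)]] range[of k] xk(2) by auto
        then have "w x k * \<bar>b x - \<xi> k\<bar> \<le> w x k * (\<bar>b x - \<xi> (\<kappa> x)\<bar> + 2)" using w0 by (rule mult_left_mono)
        then show ?thesis using False by (simp add: algebra_simps)
      qed simp
    qed
    also have "\<dots> = (\<Sum>x\<in>X. (\<Sum>k\<le>n. w x k) * \<bar>b x - \<xi> (\<kappa> x)\<bar>) + 2 * (\<Sum>x\<in>X. \<Sum>k\<le>n. if k = \<kappa> x then 0 else w x k)"
      by (simp only: sum.distrib sum_distrib_left sum_distrib_right)
    also have "(\<Sum>x\<in>X. (\<Sum>k\<le>n. w x k) * \<bar>b x - \<xi> (\<kappa> x)\<bar>) = (1 / N) * (\<Sum>x\<in>X. \<bar>b x - \<xi> (\<kappa> x)\<bar>)"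
      using w(2) by (simp add: sum_distrib_left)
    also have "\<dots> \<le> K1 * sqrt \<delta>" by (rule distance_average)
    also have "(\<Sum>x\<in>X. \<Sum>k\<le>n. if k = \<kappa> x then 0 else w x k) \<le> (\<Sum>k\<le>n. \<Lambda> * K1 * sqrt \<delta>)"
      by (rule order_trans[OF w(4)]) (intro sum_mono mass, simp)
    also have "K1 * sqrt \<delta> + 2 * (\<Sum>k\<le>n. \<Lambda> * K1 * sqrt \<delta>) = (K1 + 2 * real (n + 1) * \<Lambda> * K1) * sqrt \<delta>"
      by (simp add: algebra_simps)
    finally show "(\<Sum>x\<in>X. \<Sum>k\<le>n. w x k * \<bar>b x - \<xi> k\<bar>) \<le> (K1 + 2 * real (n + 1) * \<Lambda> * K1) * sqrt \<delta>"
      by simp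
  qed
  finally show ?thesis .
qed

text \<open>
  Points within \<open>h\<close> of \<open>\<alpha>\<close> belong to the top cell. In that cell the average of \<open>\<alpha> - b x\<close> itself, and not
  only of its square, is \<open>O(\<delta>)\<close>, so by Markov's inequality the points at distance more than
  \<open>C * sqrt \<delta>\<close> are at most an \<open>O(sqrt \<delta>)\<close> fraction.
\<close>
lemma top_count:
  assumes C: "C \<ge> 1" "C * sqrt \<delta> < h"
  shows "\<bar>(1 / N) * real (card {x \<in> X. \<alpha> - b x \<le> C * sqrt \<delta>}) - lam n\<bar> \<le> (\<Lambda> * K1 + K) * sqrt \<delta>"
proof -
  let ?T = "{x \<in> X. \<kappa> x = n}" and ?A = "{x \<in> X. \<alpha> - b x \<le> C * sqrt \<delta>}"
  have sub: "?A \<subseteq> ?T"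
  proof
    fix x assume x: "x \<in> ?A"
    show "x \<in> ?T"
    proof (rule ccontr)
      assume "x \<notin> ?T"
      then have "h \<le> \<bar>b x - mv n\<bar>" using x by (intro far) auto
      then show False using x b[of x] C(2) by (auto simp: mv_def)
    qed
  qed
  have fin: "finite ?T" using X by simp
  have "(1 / N) * real (card (?T - ?A)) \<le> K * sqrt \<delta>"
  proof (cases "\<delta> = 0")
    case True
    have "(\<Sum>x\<in>?T. \<alpha> - b x) \<le> 0" using top_average True N by (simp add: divide_le_0_iff)
    moreover have "0 \<le> \<alpha> - b x" if "x \<in> ?T" for x using b that by auto
    ultimately have "\<forall>x\<in>?T. \<alpha> - b x = 0"
      using fin by (metis (no_types, lifting) sum_nonneg sum_nonneg_eq_0_iff antisym)
    then have "?T - ?A = {}" using True by auto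
    then show ?thesis using True by (simp only: card.empty) simp
  next
    case False
    then have d: "sqrt \<delta> > 0" using \<delta> by simp
    have "real (card (?T - ?A)) * sqrt \<delta> = (\<Sum>x\<in>?T - ?A. sqrt \<delta>)" by simp
    also have "\<dots> \<le> (\<Sum>x\<in>?T - ?A. \<alpha> - b x)"
    proof (intro sum_mono)
      fix x assume "x \<in> ?T - ?A"
      then have "C * sqrt \<delta> < \<alpha> - b x" by auto
      moreover have "1 * sqrt \<delta> \<le> C * sqrt \<delta>" using C d by (intro mult_right_mono) auto
      ultimately show "sqrt \<delta> \<le> \<alpha> - b x" by simp
    qed
    also have "\<dots> \<le> (\<Sum>x\<in>?T. \<alpha> - b x)" using fin b by (intro sum_mono2) auto
    finally have "(1 / N) * (real (card (?T - ?A)) * sqrt \<delta>) \<le> (1 / N) * (\<Sum>x\<in>?T. \<alpha> - b x)"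
      using N by (intro mult_left_mono) auto
    also have "\<dots> \<le> K * \<delta>" by (rule top_average)
    also have "K * \<delta> = (K * sqrt \<delta>) * sqrt \<delta>" using \<delta> by simp
    finally have "((1 / N) * real (card (?T - ?A))) * sqrt \<delta> \<le> (K * sqrt \<delta>) * sqrt \<delta>" by (simp only: mult_ac)
    then show ?thesis using d by (rule mult_right_le_imp_le)
  qed
  moreover have "real (card ?T) = real (card ?A) + real (card (?T - ?A))"
    using card_Diff_subset[OF finite_subset[OF sub fin] sub] card_mono[OF fin sub] by simp
  then have "(1 / N) * real (card ?A) = real (card ?T) / N - (1 / N) * real (card (?T - ?A))"
    by (simp add: add_divide_distrib)
  moreover have "0 \<le> (1 / N) * real (card (?T - ?A))" using N by simp
  moreover have "\<bar>real (card ?T) / N - lam n\<bar> \<le> \<Lambda> * K1 * sqrt \<delta>" by (rule mass) simp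
  ultimately show ?thesis by (simp add: algebra_simps abs_le_iff)
qed

end

section \<open>Gauss and Gauss-Radau quadrature for the coordinate distribution\<close>

definition coord_int :: "nat \<Rightarrow> real poly \<Rightarrow> real" where
  "coord_int d p = (LINT s|coord_measure d. poly p s)"

lemma coord_functional:
  assumes d: "d \<ge> 2"
  shows "positive_functional (coord_int d)"
proof
  fix p q :: "real poly" and c :: real
  show "coord_int d (p + q) = coord_int d p + coord_int d q"
    unfolding coord_int_def poly_add
    by (rule Bochner_Integration.integral_add) (rule coord_measure_integral(2)[OF d])+
  show "coord_int d (smult c p) = c * coord_int d p" by (simp add: coord_int_def)
  show "0 < coord_int d p" if "p \<noteq> 0" "\<And>s. s \<in> {-1<..<1} \<Longrightarrow> 0 \<le> poly p s"
    unfolding coord_int_def by (rule coord_measure_pos[OF d that])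
qed

lemma shifted_coord_functional:
  assumes d: "d \<ge> 2"
  shows "positive_functional (\<lambda>p. coord_int d ([:1, 1:] * p))"
proof -
  interpret positive_functional "coord_int d" by (rule coord_functional[OF d])
  show ?thesis
  proof
    fix p q :: "real poly" and c :: real
    show "coord_int d ([:1, 1:] * (p + q)) = coord_int d ([:1, 1:] * p) + coord_int d ([:1, 1:] * q)"
      by (simp only: distrib_left L_add)
    show "coord_int d ([:1, 1:] * smult c p) = c * coord_int d ([:1, 1:] * p)"
      by (simp only: mult_smult_right L_smult)
    show "0 < coord_int d ([:1, 1:] * p)" if "p \<noteq> 0" "\<And>s. s \<in> {-1<..<1} \<Longrightarrow> 0 \<le> poly p s"
    proof (rule L_pos)
      show "[:1, 1:] * p \<noteq> 0" using that(1) by (simp del: mult_pCons_left mult_pCons_right)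
      fix s :: real assume s: "s \<in> {-1<..<1}"
      have "poly ([:1, 1:] * p) s = (1 + s) * poly p s" by (simp add: algebra_simps)
      also have "\<dots> \<ge> 0" using s that(2)[OF s] by (intro mult_nonneg_nonneg) auto
      finally show "0 \<le> poly ([:1, 1:] * p) s" .
    qed
  qed
qed

lemma integral_shifted_coord_measure:
  assumes d: "d \<ge> 2"
  shows "(LINT s|density (coord_measure d) (\<lambda>s. ennreal (1 + s)). poly p s) = coord_int d ([:1, 1:] * p)"
proof -
  have [measurable]: "poly p \<in> borel_measurable borel" for p :: "real poly"
    by (intro borel_measurable_continuous_onI continuous_intros)
  have "AE s in coord_measure d. 0 \<le> 1 + s"
    unfolding coord_measure_density by (subst AE_density) (auto simp: indicator_def)
  then have "(LINT s|density (coord_measure d) (\<lambda>s. ennreal (1 + s)). poly p s) = (LINT s|coord_measure d. (1 + s) * poly p s)"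
    by (subst integral_real_density) (auto cong: measurable_cong_sets)
  also have "\<dots> = coord_int d ([:1, 1:] * p)"
    unfolding coord_int_def by (intro Bochner_Integration.integral_cong) (auto simp: algebra_simps)
  finally show ?thesis .
qed

lemma quad_poly_eq:
  assumes d: "d \<ge> 2"
  shows "quad_poly t d = (if odd t then positive_functional.orthogonal_poly (coord_int d) (t div 2 + 1)
    else positive_functional.orthogonal_poly (\<lambda>p. coord_int d ([:1, 1:] * p)) (t div 2))"
  unfolding quad_poly_def orth_poly_def positive_functional.orthogonal_poly_def[OF coord_functional[OF d]]
    positive_functional.orthogonal_poly_def[OF shifted_coord_functional[OF d]]
    poly_mult[symmetric] integral_shifted_coord_measure[OF d] coord_int_def[symmetric] ..

text \<open>
  The node polynomial is the orthogonal polynomial itself for odd \<open>t\<close> and \<open>1 + s\<close> times the orthogonal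
  polynomial of the shifted weight for even \<open>t\<close>. In both cases it is orthogonal to all polynomials of
  degree at most \<open>t - card X\<close>, which makes interpolation at the nodes exact in degree \<open>t\<close>.
\<close>
lemma quad_nodes_structure:
  assumes d: "d \<ge> 2" and t: "t \<ge> 2"
  defines "X \<equiv> quad_nodes t d" and "n \<equiv> t div 2"
  shows "finite X" "card X = n + 1" "X \<subseteq> {-1..<1}" "even t \<Longrightarrow> -1 \<in> X" "odd t \<Longrightarrow> -1 \<notin> X"
    "degree s + card X \<le> t \<Longrightarrow> coord_int d (node_poly X * s) = 0"
    "quad_eta t d = Max X"
proof -
  have n1: "n \<ge> 1" using t by (simp add: n_def)
  let ?Z = "{s. poly (quad_poly t d) s = 0}"
  have "finite X \<and> card X = n + 1 \<and> X \<subseteq> {-1..<1} \<and> (even t \<longrightarrow> -1 \<in> X) \<and> (odd t \<longrightarrow> -1 \<notin> X) \<and>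
    (\<forall>s. degree s + card X \<le> t \<longrightarrow> coord_int d (node_poly X * s) = 0) \<and> quad_eta t d = Max X"
  proof (cases "odd t")
    case True
    interpret positive_functional "coord_int d" by (rule coord_functional[OF d])
    have q: "quad_poly t d = orthogonal_poly (n + 1)" using True by (simp add: quad_poly_eq[OF d] n_def)
    have XZ: "X = ?Z" using True by (simp add: X_def quad_nodes_def)
    note r = orthogonal_poly_roots[of "n + 1", folded q, folded XZ]
    have "coord_int d (node_poly X * s) = 0" if "degree s + card X \<le> t" for s
    proof -
      have "degree s < n + 1" using that r(2) True by (auto simp: n_def elim!: oddE)
      then show ?thesis using orthogonal_poly(3)[of s "n + 1"] r(4) q by simp
    qed
    moreover have "quad_eta t d = Max X" by (simp add: quad_eta_def XZ)
    moreover have "X \<subseteq> {-1..<1}" "-1 \<notin> X" using r(3) by auto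
    ultimately show ?thesis using r True by auto
  next
    case False
    interpret S: positive_functional "\<lambda>p. coord_int d ([:1, 1:] * p)" by (rule shifted_coord_functional[OF d])
    have q: "quad_poly t d = S.orthogonal_poly n" using False by (simp add: quad_poly_eq[OF d] n_def)
    have XZ: "X = insert (-1) ?Z" using False by (simp add: X_def quad_nodes_def)
    note r = S.orthogonal_poly_roots[of n, folded q]
    have ni: "-1 \<notin> ?Z" using r(3) by auto
    have np: "node_poly X = [:1, 1:] * quad_poly t d"
      unfolding XZ node_poly_insert[OF r(1) ni] using r(4) by simp
    have c: "card X = n + 1" unfolding XZ using r(1,2) ni by simp
    have "coord_int d (node_poly X * s) = 0" if "degree s + card X \<le> t" for s
    proof -
      have "degree s < n" using that c False by (auto simp: n_def elim!: evenE)
      then show ?thesis using S.orthogonal_poly(3)[of s n] unfolding np q by (simp only: mult.assoc)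
    qed
    moreover have "quad_eta t d = Max X"
    proof -
      have ne: "?Z \<noteq> {}"
      proof
        assume "?Z = {}"
        then have "card ?Z = 0" by (simp only: card.empty)
        then show False using r(2) n1 by simp
      qed
      then have "Max ?Z \<in> ?Z" using r(1) by (intro Max_in)
      then have "Max X = Max ?Z" unfolding XZ using r(1,3) ne by (subst Max_insert) auto
      then show ?thesis by (simp add: quad_eta_def)
    qed
    moreover have "X \<subseteq> {-1..<1}" unfolding XZ using r(3) by auto
    moreover have "finite X" unfolding XZ using r(1) by simp
    moreover have "-1 \<in> X" by (simp add: XZ)
    ultimately show ?thesis using c False by auto
  qed
  then show "finite X" "card X = n + 1" "X \<subseteq> {-1..<1}" "even t \<Longrightarrow> -1 \<in> X" "odd t \<Longrightarrow> -1 \<notin> X"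
    "degree s + card X \<le> t \<Longrightarrow> coord_int d (node_poly X * s) = 0"
    "quad_eta t d = Max X" by blast+
qed

lemma quad_node_order:
  assumes d: "d \<ge> 2" and t: "t \<ge> 2"
  shows "i < j \<Longrightarrow> j \<le> t div 2 \<Longrightarrow> quad_node t d i < quad_node t d j"
    and "quad_node t d ` {..t div 2} = quad_nodes t d"
    and "quad_node t d (t div 2) = quad_eta t d"
    and "even t \<Longrightarrow> quad_node t d 0 = -1"
proof -
  note X = quad_nodes_structure[OF d t]
  let ?X = "quad_nodes t d" and ?n = "t div 2"
  let ?l = "sorted_list_of_set ?X"
  have len: "length ?l = ?n + 1" using X(1,2) by simp
  have st: "sorted_wrt (<) ?l" by (rule strict_sorted_list_of_set)
  have less: "quad_node t d i < quad_node t d j" if "i < j" "j \<le> ?n" for i j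
    unfolding quad_node_def using that len by (intro sorted_wrt_nth_less[OF st]) auto
  show "i < j \<Longrightarrow> j \<le> ?n \<Longrightarrow> quad_node t d i < quad_node t d j" by (rule less)
  have "quad_node t d ` {..?n} = set ?l"
    unfolding quad_node_def set_conv_nth len by (auto simp: less_Suc_eq_le)
  also have "\<dots> = ?X" using X(1) by simp
  finally show im: "quad_node t d ` {..?n} = ?X" .
  have le: "quad_node t d i \<le> quad_node t d j" if "i \<le> j" "j \<le> ?n" for i j
    using less[of i j] that by (cases "i = j") auto
  have "Max ?X = quad_node t d ?n"
  proof (rule Max_eqI[OF X(1)])
    show "quad_node t d ?n \<in> ?X" using im by auto
    fix y assume "y \<in> ?X"
    then obtain i where "i \<le> ?n" "y = quad_node t d i" using im by auto
    then show "y \<le> quad_node t d ?n" using le by auto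
  qed
  then show "quad_node t d ?n = quad_eta t d" using X(7) by simp
  assume "even t"
  then obtain i where "i \<le> ?n" "-1 = quad_node t d i" using X(4) im by force
  moreover have "quad_node t d 0 \<in> ?X" using im by auto
  then have "-1 \<le> quad_node t d 0" using X(3) by auto
  ultimately show "quad_node t d 0 = -1" using le[of 0 i] by auto
qed

text \<open>
  The functional applied to the Lagrange polynomials gives exact weights, and testing with the Lagrange
  polynomials shows that there are no others. For positivity, the square of the node polynomial of the
  remaining nodes has degree \<open>2 * n\<close>. If \<open>t\<close> is even and the node is not \<open>-1\<close>, the factor of the node \<open>-1\<close>
  is taken only once, as it has constant sign on the interval.
\<close>
lemma quad_weight:
  assumes d: "d \<ge> 2" and t: "t \<ge> 2"
  shows "degree q \<le> t \<Longrightarrow> (\<Sum>k\<le>t div 2. quad_weight t d k * poly q (quad_node t d k)) = coord_int d q"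
    and "k \<le> t div 2 \<Longrightarrow> quad_weight t d k > 0"
proof -
  let ?n = "t div 2" and ?X = "quad_nodes t d" and ?\<xi> = "quad_node t d"
  note X = quad_nodes_structure[OF d t]
  interpret positive_functional "coord_int d" by (rule coord_functional[OF d])
  have n: "?n \<ge> 1" "?n + 1 \<le> t" using t by auto
  have inj: "inj_on ?\<xi> {..?n}"
    using quad_node_order(1)[OF d t] by (intro linorder_inj_onI) fastforce+
  have bij: "bij_betw ?\<xi> {..?n} ?X"
    using inj quad_node_order(2)[OF d t] by (simp add: bij_betw_def)
  have ex: "(\<Sum>x\<in>?X. coord_int d (lagrange ?X x) * poly q x) = coord_int d q" if "degree q \<le> t" for q
    by (rule quadrature_exact[OF X(1) X(6) that])
  let ?P = "\<lambda>w. (\<forall>k > ?n. w k = 0) \<and> (\<forall>q :: real poly. degree q \<le> t \<longrightarrow>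
        (\<Sum>k\<le>?n. w k * poly q (?\<xi> k)) = (LINT s|coord_measure d. poly q s))"
  define w0 where "w0 k = (if k \<le> ?n then coord_int d (lagrange ?X (?\<xi> k)) else 0)" for k
  have w0: "?P w0"
  proof (intro conjI allI impI)
    fix q :: "real poly" assume q: "degree q \<le> t"
    have "(\<Sum>k\<le>?n. w0 k * poly q (?\<xi> k)) = (\<Sum>k\<le>?n. coord_int d (lagrange ?X (?\<xi> k)) * poly q (?\<xi> k))"
      by (intro sum.cong) (auto simp: w0_def)
    also have "\<dots> = (\<Sum>x\<in>?X. coord_int d (lagrange ?X x) * poly q x)"
      by (rule sum.reindex_bij_betw[OF bij])
    finally show "(\<Sum>k\<le>?n. w0 k * poly q (?\<xi> k)) = (LINT s|coord_measure d. poly q s)"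
      using ex[OF q] by (simp add: coord_int_def)
  qed (simp add: w0_def)
  have uniq: "w k = w0 k" if w: "?P w" for w k
  proof (cases "k \<le> ?n")
    case True
    have xk: "?\<xi> k \<in> ?X" using True quad_node_order(2)[OF d t] by auto
    have "degree (lagrange ?X (?\<xi> k)) \<le> t" using degree_lagrange[OF X(1) xk] X(2) n by simp
    then have "coord_int d (lagrange ?X (?\<xi> k)) = (\<Sum>j\<le>?n. w j * poly (lagrange ?X (?\<xi> k)) (?\<xi> j))"
      using w by (simp add: coord_int_def)
    also have "\<dots> = (\<Sum>j\<le>?n. if j = k then w k else 0)"
    proof (intro sum.cong refl)
      fix j assume j: "j \<in> {..?n}"
      then have xj: "?\<xi> j \<in> ?X" using quad_node_order(2)[OF d t] by auto
      have "?\<xi> k = ?\<xi> j \<longleftrightarrow> k = j" using inj True j by (auto simp: inj_on_def)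
      then show "w j * poly (lagrange ?X (?\<xi> k)) (?\<xi> j) = (if j = k then w k else 0)"
        using poly_lagrange[OF X(1) xk xj] by auto
    qed
    also have "\<dots> = w k" using True by simp
    finally show ?thesis using True by (simp add: w0_def)
  qed (use w in \<open>simp add: w0_def\<close>)
  have "quad_weight t d = w0"
    unfolding quad_weight_def
  proof (rule the_equality)
    show "?P w0" by (rule w0)
    show "w = w0" if "?P w" for w using uniq[OF that] by auto
  qed
  then have P: "?P (quad_weight t d)" using w0 by simp
  then show exact: "(\<Sum>k\<le>?n. quad_weight t d k * poly q (?\<xi> k)) = coord_int d q" if "degree q \<le> t" for q
    using that by (simp add: coord_int_def)
  have qw: "quad_weight t d k = coord_int d (lagrange ?X (?\<xi> k))" if "k \<le> ?n" for k
    using that \<open>quad_weight t d = w0\<close> by (simp add: w0_def)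
  show "quad_weight t d k > 0" if k: "k \<le> ?n"
  proof -
    let ?x = "?\<xi> k"
    have xk: "?x \<in> ?X" using k quad_node_order(2)[OF d t] by auto
    have x1: "-1 \<le> ?x" using xk X(3) by auto
    show ?thesis
    proof (cases "odd t \<or> ?x = -1")
      case True
      let ?m = "node_poly (?X - {?x})"
      have dm: "degree ?m = ?n" using degree_node_poly[of "?X - {?x}"] X(1,2) xk by simp
      have m0: "?m \<noteq> 0" by (rule node_poly_nonzero)
      show ?thesis
        unfolding qw[OF k]
      proof (rule quadrature_weight_pos[OF ex X(1) xk])
        show "?m * ?m \<noteq> 0" using m0 by simp
        show "degree (?m * ?m) \<le> t" using dm m0 by (simp add: degree_mult_eq)
        show "poly (?m * ?m) y = 0" if "y \<in> ?X" "y \<noteq> ?x" for y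
          using that X(1) by (simp add: poly_node_poly prod_zero_iff)
      qed auto
    next
      case False
      let ?m = "node_poly (?X - {?x, -1})"
      let ?g = "[:1, 1:] * (?m * ?m)"
      have e: "even t" "-1 \<in> ?X" using False X(4) by auto
      have "card (?X - {?x, -1}) = ?n - 1"
        using X(1,2) xk e False by (subst card_Diff_subset) auto
      then have dm: "degree ?m = ?n - 1" using degree_node_poly[of "?X - {?x, -1}"] X(1) by simp
      have m0: "?m \<noteq> 0" by (rule node_poly_nonzero)
      have pg: "poly ?g s = (1 + s) * (poly ?m s * poly ?m s)" for s by (simp add: algebra_simps)
      show ?thesis
        unfolding qw[OF k]
      proof (rule quadrature_weight_pos[OF ex X(1) xk])
        show "?g \<noteq> 0" using m0 by (simp del: mult_pCons_left mult_pCons_right)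
        have "degree ?g = 1 + (?n - 1 + (?n - 1))"
          using m0 dm by (simp add: degree_mult_eq del: mult_pCons_left mult_pCons_right)
        then show "degree ?g \<le> t" using n by simp
        show "0 \<le> poly ?g s" if "s \<in> {-1<..<1}" for s
          unfolding pg using that by (intro mult_nonneg_nonneg[OF _ zero_le_square]) auto
        show "poly ?g y = 0" if "y \<in> ?X" "y \<noteq> ?x" for y
          unfolding pg using that X(1) by (cases "y = -1") (auto simp: poly_node_poly prod_zero_iff)
        show "0 \<le> poly ?g ?x" unfolding pg using x1 by (intro mult_nonneg_nonneg[OF _ zero_le_square]) auto
      qed
    qed
  qed
qed

lemma poly_lipschitz:
  fixes p :: "real poly"
  shows "\<exists>\<Lambda>\<ge>0. \<forall>s\<in>{a..b}. \<forall>s'\<in>{a..b}. \<bar>poly p s - poly p s'\<bar> \<le> \<Lambda> * \<bar>s - s'\<bar>"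
proof -
  have "bounded (poly (pderiv p) ` {a..b})"
    by (intro compact_imp_bounded compact_continuous_image continuous_intros) auto
  then obtain B where B: "\<forall>y\<in>poly (pderiv p) ` {a..b}. norm y \<le> B"
    unfolding bounded_iff by (elim exE) (rule that)
  have "\<bar>poly p s - poly p s'\<bar> \<le> \<bar>B\<bar> * \<bar>s - s'\<bar>" if "s \<in> {a..b}" "s' \<in> {a..b}" for s s'
  proof -
    have "norm (poly p s - poly p s') \<le> \<bar>B\<bar> * norm (s - s')"
    proof (rule field_differentiable_bound[of "{a..b}" "poly p" "poly (pderiv p)"])
      show "(poly p has_field_derivative poly (pderiv p) z) (at z within {a..b})" for z
        by (rule has_field_derivative_at_within[OF poly_DERIV])
      show "norm (poly (pderiv p) z) \<le> \<bar>B\<bar>" if "z \<in> {a..b}" for z using B that by force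
    qed (use that in auto)
    then show ?thesis by simp
  qed
  then show ?thesis by (intro exI[of _ "\<bar>B\<bar>"]) auto
qed

text \<open>
  The separation of the nodes and a common Lipschitz constant of the Lagrange polynomials. The interval
  \<open>{-1..2}\<close> leaves room for values of \<open>\<alpha>\<close> up to \<open>1\<close> beyond the largest node.
\<close>
lemma quadrature_constants:
  assumes d: "d \<ge> 2" and t: "t \<ge> 2"
  defines "n \<equiv> t div 2" and "\<xi> \<equiv> quad_node t d"
  obtains h \<Lambda> where "0 < h" "h \<le> 1" "\<And>i j. i \<le> n \<Longrightarrow> j \<le> n \<Longrightarrow> i \<noteq> j \<Longrightarrow> 2 * h \<le> \<bar>\<xi> i - \<xi> j\<bar>"
    "\<Lambda> \<ge> 0" "\<And>i s s'. i \<le> n \<Longrightarrow> s \<in> {-1..2} \<Longrightarrow> s' \<in> {-1..2} \<Longrightarrow>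
      \<bar>poly (lagrange (quad_nodes t d) (\<xi> i)) s - poly (lagrange (quad_nodes t d) (\<xi> i)) s'\<bar> \<le> \<Lambda> * \<bar>s - s'\<bar>"
proof -
  let ?l = "\<lambda>i. lagrange (quad_nodes t d) (\<xi> i)"
  define M where "M i = (SOME \<Lambda>. \<Lambda> \<ge> 0 \<and> (\<forall>s\<in>{-1..2}. \<forall>s'\<in>{-1..2}.
      \<bar>poly (?l i) s - poly (?l i) s'\<bar> \<le> \<Lambda> * \<bar>s - s'\<bar>))" for i
  have Mex: "M i \<ge> 0 \<and> (\<forall>s\<in>{-1..2}. \<forall>s'\<in>{-1..2}. \<bar>poly (?l i) s - poly (?l i) s'\<bar> \<le> M i * \<bar>s - s'\<bar>)" for i
    unfolding M_def
    by (rule someI_ex) (rule poly_lipschitz)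
  have M: "M i \<ge> 0" "s \<in> {-1..2} \<Longrightarrow> s' \<in> {-1..2} \<Longrightarrow>
      \<bar>poly (?l i) s - poly (?l i) s'\<bar> \<le> M i * \<bar>s - s'\<bar>" for i s s'
    using Mex[of i] by auto
  define \<Lambda> where "\<Lambda> = (\<Sum>i\<le>n. M i)"
  have lip: "\<bar>poly (?l i) s - poly (?l i) s'\<bar> \<le> \<Lambda> * \<bar>s - s'\<bar>" if "i \<le> n" "s \<in> {-1..2}" "s' \<in> {-1..2}" for i s s'
  proof -
    have "M i \<le> \<Lambda>" unfolding \<Lambda>_def using that(1) M(1) by (intro member_le_sum) auto
    then have "M i * \<bar>s - s'\<bar> \<le> \<Lambda> * \<bar>s - s'\<bar>" by (intro mult_right_mono) auto
    then show ?thesis using M(2)[OF that(2,3), of i] by linarith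
  qed
  let ?D = "(\<lambda>(i, j). \<bar>\<xi> i - \<xi> j\<bar>) ` {(i, j). i \<le> n \<and> j \<le> n \<and> i \<noteq> j}"
  have "finite {(i, j). i \<le> n \<and> j \<le> n \<and> i \<noteq> j}"
    by (rule finite_subset[of _ "{..n} \<times> {..n}"]) auto
  then have fin: "finite ?D" by (rule finite_imageI)
  have sep: "\<xi> i \<noteq> \<xi> j" if "i \<le> n" "j \<le> n" "i \<noteq> j" for i j
    using quad_node_order(1)[OF d t, of i j] quad_node_order(1)[OF d t, of j i] that
    unfolding n_def \<xi>_def by (cases i j rule: linorder_cases) auto
  have pos: "x > 0" if "x \<in> ?D" for x
    using that sep by auto
  define h where "h = min 1 (Min (insert 1 ?D) / 2)"
  have "Min (insert 1 ?D) \<in> insert 1 ?D" using fin by (intro Min_in) auto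
  then have "Min (insert 1 ?D) = 1 \<or> Min (insert 1 ?D) > 0" using pos by blast
  then have "Min (insert 1 ?D) > 0" by (elim disjE) simp_all
  then have h: "0 < h" "h \<le> 1" by (auto simp: h_def)
  have gap: "2 * h \<le> \<bar>\<xi> i - \<xi> j\<bar>" if "i \<le> n" "j \<le> n" "i \<noteq> j" for i j
  proof -
    have "Min (insert 1 ?D) \<le> \<bar>\<xi> i - \<xi> j\<bar>" using fin that by (intro Min_le) force+
    then show ?thesis by (simp add: h_def)
  qed
  have L0: "\<Lambda> \<ge> 0" unfolding \<Lambda>_def using M(1) by (intro sum_nonneg) auto
  show thesis by (rule that[where h = h and \<Lambda> = \<Lambda>]) (use h gap lip L0 in auto)
qed

section \<open>Designs with nearly extremal self-polar Minkowski polytopes\<close>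

theorem theorem7p3:
  fixes t :: nat
  assumes "CARD('d::finite) \<ge> 2" and "t \<ge> 2"
  shows "\<exists>\<epsilon>0 C c_star :: real. \<epsilon>0 > 0 \<and> C > 0 \<and> c_star > 0 \<and>
    (\<forall>(X :: (real ^ 'd) set) (P :: (real ^ 'd) set) (c :: real) (U :: real ^ 'd \<Rightarrow> real ^ 'd).
      let d = CARD('d);
          n = t div 2;
          N = card X;
          \<alpha> = centered_inradius P / centered_circumradius P;
          \<delta> = \<alpha> - quad_eta t d;
          b = (\<lambda>x y. U x \<bullet> y);
          A = (\<lambda>x y. \<alpha> - b x y)
      in
        spherical_design t X \<longrightarrow> node_transitive X \<longrightarrow>
        steiner_minkowski_polytope X P \<longrightarrow>
        c > 0 \<longrightarrow> orthogonal_transformation U \<longrightarrow>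
        polar P = (\<lambda>y. c *\<^sub>R U y) ` P \<longrightarrow>
        0 \<le> \<delta> \<longrightarrow> \<delta> \<le> \<epsilon>0 \<longrightarrow>
        (\<forall>x\<in>X.
          (wasserstein1 (sum_dirac X (\<lambda>y. 1 / real N) (b x)) (quad_measure t d)
              \<le> ennreal (C * sqrt \<delta>) \<and>
           (1 / real N) * (\<Sum>y\<in>X. (infdist (b x y) (quad_nodes t d))\<^sup>2) \<le> C * \<delta>) \<and>
          (\<forall>\<pi>. nearest_node_projection t d \<alpha> \<pi> \<longrightarrow>
            (\<forall>k\<le>n. \<bar>real (card {y \<in> X. b x y \<in> moving_cell t d \<alpha> \<pi> k}) / real N
                     - quad_weight t d k\<bar> \<le> C * sqrt \<delta>)) \<and>
          \<bar>(1 / real N) * real (card {y \<in> X. A x y \<le> C * sqrt \<delta>})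
             - quad_weight t d n\<bar> \<le> C * sqrt \<delta>) \<and>
        \<delta> \<ge> c_star / (real N)\<^sup>2 * (MAX k\<in>{..n}. (infdist (real N * quad_weight t d k) \<int>)\<^sup>2))"
proof -
  define d where "d = CARD('d)"
  define n where "n = t div 2"
  define \<xi> where "\<xi> = quad_node t d"
  define lam where "lam = quad_weight t d"
  define l where "l i = lagrange (quad_nodes t d) (\<xi> i)" for i
  have d: "d \<ge> 2" and t: "t \<ge> 2" using assms by (simp_all add: d_def)
  note nodes = quad_nodes_structure[OF d t, folded n_def]
  note order = quad_node_order[OF d t, folded n_def \<xi>_def]
  note weight = quad_weight[OF d t, folded n_def \<xi>_def lam_def]
  obtain h \<Lambda> where h: "0 < h" "h \<le> 1" "\<And>i j. i \<le> n \<Longrightarrow> j \<le> n \<Longrightarrow> i \<noteq> j \<Longrightarrow> 2 * h \<le> \<bar>\<xi> i - \<xi> j\<bar>"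
    and \<Lambda>: "\<Lambda> \<ge> 0" "\<And>i s s'. i \<le> n \<Longrightarrow> s \<in> {-1..2} \<Longrightarrow> s' \<in> {-1..2} \<Longrightarrow> \<bar>poly (l i) s - poly (l i) s'\<bar> \<le> \<Lambda> * \<bar>s - s'\<bar>"
    using quadrature_constants[OF d t, folded n_def \<xi>_def, folded l_def] by blast
  define K where "K = 6 * 4 ^ n / h ^ (2 * n + 2)"
  define K1 where "K1 = sqrt K + 1"
  \<comment> \<open>one constant that exceeds each of those coming from the four estimates\<close>
  define C where "C = 4 + 2 * K + (K1 + 2 * real (n + 1) * \<Lambda> * K1) + \<Lambda> * K1 + K"
  \<comment> \<open>the second bound makes \<open>C * sqrt \<delta> < h\<close>, as the count in the top cell requires\<close>
  define \<epsilon>0 where "\<epsilon>0 = min 1 ((h / (2 * C))\<^sup>2)"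
  have K: "K \<ge> 0" "K1 \<ge> 0" using h by (auto simp: K_def K1_def)
  have nonneg: "\<Lambda> * K1 \<ge> 0" "2 * real (n + 1) * \<Lambda> * K1 \<ge> 0" using K \<Lambda> by auto
  have C: "C \<ge> 1" "2 * K + 2 \<le> C" "K1 + 2 * real (n + 1) * \<Lambda> * K1 \<le> C" "\<Lambda> * K1 \<le> C" "\<Lambda> * K1 + K \<le> C"
    using K nonneg unfolding C_def by linarith+
  have C0: "C > 0" using C by linarith
  have \<epsilon>0: "\<epsilon>0 > 0" using h C0 by (simp add: \<epsilon>0_def)
  have n1: "n \<ge> 1" using t by (simp add: n_def)
  have inj: "inj_on \<xi> {..n}" using order(1) by (intro linorder_inj_onI) fastforce+
  have \<xi>X: "\<xi> i \<in> quad_nodes t d" if "i \<le> n" for i using order(2) that by auto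
  have \<xi>eq: "\<xi> i = \<xi> j \<longleftrightarrow> i = j" if "i \<le> n" "j \<le> n" for i j using inj that by (auto simp: inj_on_def)
  have lam_sum: "(\<Sum>i\<le>n. lam i) = 1"
  proof -
    have "coord_int d 1 = 1"
      using coord_measure_integral(1)[OF d] coord_measure_integral(3)[OF d, of 1] by (simp add: coord_int_def)
    then show ?thesis using weight(1)[of 1] by simp
  qed
  have main: "(wasserstein1 (sum_dirac X (\<lambda>y. 1 / real (card X)) (\<lambda>y. U x \<bullet> y)) (quad_measure t d) \<le> ennreal (C * sqrt \<delta>) \<and>
        (1 / real (card X)) * (\<Sum>y\<in>X. (infdist (U x \<bullet> y) (quad_nodes t d))\<^sup>2) \<le> C * \<delta>) \<and>
      (\<forall>\<pi>. nearest_node_projection t d \<alpha> \<pi> \<longrightarrow>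
            (\<forall>k\<le>n. \<bar>real (card {y \<in> X. U x \<bullet> y \<in> moving_cell t d \<alpha> \<pi> k}) / real (card X) - quad_weight t d k\<bar> \<le> C * sqrt \<delta>)) \<and>
      \<bar>(1 / real (card X)) * real (card {y \<in> X. \<alpha> - U x \<bullet> y \<le> C * sqrt \<delta>}) - quad_weight t d n\<bar> \<le> C * sqrt \<delta> \<and>
      (\<forall>k\<le>n. (infdist (real (card X) * quad_weight t d k) \<int>)\<^sup>2 \<le> (real (card X))\<^sup>2 * C\<^sup>2 * \<delta>)"
    if X: "spherical_design t X" "node_transitive X" and P: "steiner_minkowski_polytope X P"
      and c: "c > 0" and U: "orthogonal_transformation U" "polar P = (\<lambda>y. c *\<^sub>R U y) ` P"
      and \<alpha>: "\<alpha> = centered_inradius P / centered_circumradius P"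
      and \<delta>: "\<delta> = \<alpha> - quad_eta t d" "0 \<le> \<delta>" "\<delta> \<le> \<epsilon>0" and x: "x \<in> X"
    for X P :: "(real ^ 'd) set" and c U \<alpha> \<delta> x
  proof -
    have finX: "finite X" "X \<noteq> {}" and sph: "X \<subseteq> sphere 0 1" using X by (auto simp: spherical_design_def)
    let ?b = "\<lambda>y. U x \<bullet> y"
    have nU: "norm (U x) = 1" using orthogonal_transformation_norm[OF U(1), of x] x sph by auto
    have b: "-1 \<le> ?b y \<and> ?b y \<le> \<alpha>" if y: "y \<in> X" for y
    proof
      have "\<bar>?b y\<bar> \<le> norm (U x) * norm y" by (rule Cauchy_Schwarz_ineq2)
      then have "\<bar>?b y\<bar> \<le> 1" using nU y sph by auto
      then show "-1 \<le> ?b y" by linarith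
      show "?b y \<le> \<alpha>" unfolding \<alpha> by (rule self_polar_inner_le[OF X(1) t X(2) P c U x y])
    qed
    have \<delta>1: "\<delta> \<le> 1" "\<delta> \<le> (h / (2 * C))\<^sup>2" using \<delta>(3) by (auto simp: \<epsilon>0_def)
    have eta: "quad_eta t d = \<xi> n" using order(3) by simp
    have avg: "(1 / real (card X)) * (\<Sum>y\<in>X. poly q (?b y)) = (\<Sum>i\<le>n. lam i * poly q (\<xi> i))" if q: "degree q \<le> t" for q
    proof -
      have "(1 / real (card X)) * (\<Sum>y\<in>X. poly q (?b y)) = (LINT y|sphere_measure. poly q (U x \<bullet> y))"
        using X(1) poly_total_degree_le_poly_inner[OF q, of "U x"] unfolding spherical_design_def by blast
      also have "\<dots> = coord_int d q"
        unfolding coord_int_def d_def by (rule sphere_measure_zonal[OF assms(1) nU])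
      finally show ?thesis using weight(1)[OF q] by simp
    qed
    have near: "near_quadrature t n \<xi> lam h \<Lambda> l X ?b \<alpha> \<kappa>"
      if \<kappa>: "\<And>y. y \<in> X \<Longrightarrow> \<kappa> y \<le> n" "\<And>y j. y \<in> X \<Longrightarrow> j \<le> n \<Longrightarrow>
        \<bar>?b y - (if \<kappa> y < n then \<xi> (\<kappa> y) else \<alpha>)\<bar> \<le> \<bar>?b y - (if j < n then \<xi> j else \<alpha>)\<bar>" for \<kappa>
    proof
      show "n = t div 2" by (simp add: n_def)
      show "1 \<le> n" by (rule n1)
      show "0 < h" "h \<le> 1" by fact+
      show "2 * h \<le> \<bar>\<xi> i - \<xi> j\<bar>" if "i \<le> n" "j \<le> n" "i \<noteq> j" for i j using h(3) that .
      show "\<xi> i \<le> \<xi> n" if "i \<le> n" for i using order(1)[of i n] that by (cases "i = n") auto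
      show "-1 \<le> \<xi> i \<and> \<xi> i \<le> 1" if "i \<le> n" for i using \<xi>X[OF that] nodes(3) by auto
      show "\<xi> 0 = -1" if "even t" using order(4) that .
      show "0 \<le> lam i" if "i \<le> n" for i using weight(2)[OF that] by simp
      show "(\<Sum>i\<le>n. lam i) = 1" by (rule lam_sum)
      show "degree (l i) \<le> t" if "i \<le> n" for i
        using degree_lagrange[OF nodes(1) \<xi>X[OF that]] nodes(2) t unfolding l_def by (auto simp: n_def)
      show "poly (l i) (\<xi> j) = (if i = j then 1 else 0)" if "i \<le> n" "j \<le> n" for i j
        unfolding l_def poly_lagrange[OF nodes(1) \<xi>X[OF that(1)] \<xi>X[OF that(2)]] \<xi>eq[OF that] ..
      show "\<bar>poly (l i) s - poly (l i) s'\<bar> \<le> \<Lambda> * \<bar>s - s'\<bar>" if "i \<le> n" "s \<in> {-1..2}" "s' \<in> {-1..2}" for i s s'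
        using \<Lambda>(2) that .
      show "0 \<le> \<Lambda>" by fact
      show "finite X" "X \<noteq> {}" by fact+
      show "\<xi> n \<le> \<alpha>" "\<alpha> \<le> \<xi> n + 1" using \<delta>(1,2) \<delta>1 eta by auto
    qed (use b avg \<kappa> in blast)+
    \<comment> \<open>for all claims but the one on moving cells any nearest node serves\<close>
    define \<kappa> where "\<kappa> y = arg_min_on (\<lambda>j. \<bar>?b y - (if j < n then \<xi> j else \<alpha>)\<bar>) {..n}" for y
    have \<kappa>: "\<kappa> y \<le> n" "j \<le> n \<Longrightarrow> \<bar>?b y - (if \<kappa> y < n then \<xi> (\<kappa> y) else \<alpha>)\<bar> \<le> \<bar>?b y - (if j < n then \<xi> j else \<alpha>)\<bar>" for y j
    proof -
      let ?f = "\<lambda>j. \<bar>?b y - (if j < n then \<xi> j else \<alpha>)\<bar>"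
      have "\<kappa> y \<in> {..n}" "\<not> (\<exists>j\<in>{..n}. ?f j < ?f (\<kappa> y))"
        unfolding \<kappa>_def by (rule arg_min_if_finite; simp)+
      then show "\<kappa> y \<le> n" "j \<le> n \<Longrightarrow> ?f (\<kappa> y) \<le> ?f j" by (auto simp: not_less)
    qed
    interpret Q: near_quadrature t n \<xi> lam h \<Lambda> l X ?b \<alpha> \<kappa> by (rule near) (use \<kappa> in auto)
    have Qc: "Q.K = K" "Q.K1 = K1" "Q.N = real (card X)" "Q.\<delta> = \<delta>"
      by (simp_all add: Q.K_def K_def Q.K1_def K1_def Q.N_def Q.\<delta>_def \<delta>(1) eta)
    have s0: "sqrt \<delta> \<ge> 0" using \<delta>(2) by simp
    have up: "a * sqrt \<delta> \<le> C * sqrt \<delta>" if "a \<le> C" for a using that s0 by (rule mult_right_mono)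
    have W: "wasserstein1 (sum_dirac X (\<lambda>y. 1 / real (card X)) ?b) (quad_measure t d) \<le> ennreal (C * sqrt \<delta>)"
      using Q.wasserstein up[OF C(3)] unfolding Qc quad_measure_def n_def[symmetric] \<xi>_def[symmetric] lam_def[symmetric]
      by (meson ennreal_leI order_trans)
    have I: "(1 / real (card X)) * (\<Sum>y\<in>X. (infdist (?b y) (quad_nodes t d))\<^sup>2) \<le> C * \<delta>"
    proof -
      have "(1 / real (card X)) * (\<Sum>y\<in>X. (infdist (?b y) (quad_nodes t d))\<^sup>2) \<le> (2 * K + 2) * \<delta>"
        using Q.infdist_average[of "quad_nodes t d"] order(2) unfolding Qc by simp
      also have "\<dots> \<le> C * \<delta>" using C(2) \<delta>(2) by (rule mult_right_mono)
      finally show ?thesis .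
    qed
    have V: "\<bar>real (card {y \<in> X. ?b y \<in> moving_cell t d \<alpha> \<pi> k}) / real (card X) - quad_weight t d k\<bar> \<le> C * sqrt \<delta>"
      if \<pi>: "nearest_node_projection t d \<alpha> \<pi>" and k: "k \<le> n" for \<pi> k
    proof -
      let ?m = "moving_node t d \<alpha>"
      have m: "?m j = (if j < n then \<xi> j else \<alpha>)" for j by (simp add: moving_node_def n_def \<xi>_def)
      have m_inj: "i = j" if "i \<le> n" "j \<le> n" "?m i = ?m j" for i j
      proof (rule ccontr)
        assume "i \<noteq> j"
        from Q.gap_mv[OF that(1,2) this] show False using that(3) h(1) by (simp add: Q.mv_def m)
      qed
      \<comment> \<open>the cells of the given projection \<open>\<pi>\<close>\<close>
      define \<kappa>' where "\<kappa>' y = (SOME j. j \<le> n \<and> \<pi> (?b y) = ?m j)" for y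
      have \<kappa>': "\<kappa>' y \<le> n \<and> \<pi> (?b y) = ?m (\<kappa>' y)" if y: "y \<in> X" for y
        unfolding \<kappa>'_def
      proof (rule someI_ex)
        have "?b y \<in> {-1..\<alpha>}" using b[OF y] by auto
        then have "\<pi> (?b y) \<in> ?m ` {..n}" using \<pi> unfolding nearest_node_projection_def n_def by blast
        then show "\<exists>j. j \<le> n \<and> \<pi> (?b y) = ?m j" by auto
      qed
      interpret R: near_quadrature t n \<xi> lam h \<Lambda> l X ?b \<alpha> \<kappa>'
      proof (rule near)
        fix y assume y: "y \<in> X"
        show "\<kappa>' y \<le> n" using \<kappa>'[OF y] by simp
        fix j assume j: "j \<le> n"
        have "?b y \<in> {-1..\<alpha>}" using b[OF y] by auto
        then have "\<bar>?b y - \<pi> (?b y)\<bar> \<le> \<bar>?b y - ?m j\<bar>"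
          using \<pi> j unfolding nearest_node_projection_def n_def by blast
        then show "\<bar>?b y - (if \<kappa>' y < n then \<xi> (\<kappa>' y) else \<alpha>)\<bar> \<le> \<bar>?b y - (if j < n then \<xi> j else \<alpha>)\<bar>"
          using \<kappa>'[OF y] by (simp add: m)
      qed
      have Rc: "R.K1 = K1" "R.N = real (card X)" "R.\<delta> = \<delta>"
        by (simp_all add: R.K_def K_def R.K1_def K1_def R.N_def R.\<delta>_def \<delta>(1) eta)
      have "{y \<in> X. ?b y \<in> moving_cell t d \<alpha> \<pi> k} = {y \<in> X. \<kappa>' y = k}"
      proof (intro Collect_cong conj_cong refl)
        fix y assume y: "y \<in> X"
        have "?b y \<in> {-1..\<alpha>}" using b[OF y] by auto
        then show "?b y \<in> moving_cell t d \<alpha> \<pi> k \<longleftrightarrow> \<kappa>' y = k"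
          using \<kappa>'[OF y] m_inj[OF _ k] by (auto simp: moving_cell_def)
      qed
      then show ?thesis using R.mass[OF k] up[OF C(4)] unfolding Rc lam_def by simp
    qed
    have T: "\<bar>(1 / real (card X)) * real (card {y \<in> X. \<alpha> - ?b y \<le> C * sqrt \<delta>}) - quad_weight t d n\<bar> \<le> C * sqrt \<delta>"
    proof -
      have "sqrt \<delta> \<le> h / (2 * C)"
        using \<delta>1(2) h(1) C0 by (intro real_le_lsqrt) (auto intro: less_imp_le)
      then have "C * sqrt \<delta> \<le> C * (h / (2 * C))" using C0 by (intro mult_left_mono) auto
      also have "\<dots> = h / 2" using C0 by simp
      also have "\<dots> < h" using h(1) by simp
      finally have "C * sqrt \<delta> < h" .
      then show ?thesis
        using Q.top_count[OF C(1)] up[OF C(5)] unfolding Qc lam_def by simp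
    qed
    \<comment> \<open>the size of a cell is an integer, so the error in its mass bounds the distance of \<open>N * \<lambda>\<^sub>k\<close> to \<open>\<int>\<close>\<close>
    have D: "(infdist (real (card X) * quad_weight t d k) \<int>)\<^sup>2 \<le> (real (card X))\<^sup>2 * C\<^sup>2 * \<delta>" if k: "k \<le> n" for k
    proof -
      let ?N = "real (card X)" and ?m = "real (card {y \<in> X. \<kappa> y = k})"
      have N: "?N > 0" using Q.N Qc by simp
      have "infdist (?N * lam k) \<int> \<le> dist (?N * lam k) ?m" by (intro infdist_le) auto
      also have "\<dots> = \<bar>?N * (?m / ?N - lam k)\<bar>"
        using N by (simp add: dist_real_def right_diff_distrib abs_minus_commute)
      also have "\<dots> = ?N * \<bar>?m / ?N - lam k\<bar>"
        using N by (simp add: abs_mult)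
      also have "\<dots> \<le> ?N * (C * sqrt \<delta>)"
        using Q.mass[OF k] up[OF C(4)] N unfolding Qc by (intro mult_left_mono) auto
      finally have "(infdist (?N * lam k) \<int>)\<^sup>2 \<le> (?N * (C * sqrt \<delta>))\<^sup>2"
        by (intro power_mono infdist_nonneg)
      also have "\<dots> = ?N\<^sup>2 * C\<^sup>2 * \<delta>" using \<delta>(2) by (simp add: power_mult_distrib)
      finally show ?thesis by (simp add: lam_def)
    qed
    show ?thesis using W I V T D by blast
  qed
  have last: "\<delta> \<ge> (1 / C\<^sup>2) / (real (card X))\<^sup>2 * (MAX k\<in>{..n}. (infdist (real (card X) * quad_weight t d k) \<int>)\<^sup>2)"
    if le: "\<forall>k\<le>n. (infdist (real (card X) * quad_weight t d k) \<int>)\<^sup>2 \<le> (real (card X))\<^sup>2 * C\<^sup>2 * \<delta>"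
      and N: "real (card X) > 0" for X :: "(real ^ 'd) set" and \<delta>
  proof -
    let ?M = "MAX k\<in>{..n}. (infdist (real (card X) * quad_weight t d k) \<int>)\<^sup>2"
    have "?M \<le> (real (card X))\<^sup>2 * C\<^sup>2 * \<delta>" using le by (subst Max_le_iff) auto
    then have "(1 / C\<^sup>2) / (real (card X))\<^sup>2 * ?M \<le> (1 / C\<^sup>2) / (real (card X))\<^sup>2 * ((real (card X))\<^sup>2 * C\<^sup>2 * \<delta>)"
      by (intro mult_left_mono) auto
    also have "\<dots> = \<delta>" using N C0 by simp
    finally show ?thesis .
  qed
  show ?thesis
    unfolding Let_def d_def[symmetric] n_def[symmetric]
  proof (rule exI[of _ \<epsilon>0], rule exI[of _ C], rule exI[of _ "1 / C\<^sup>2"], intro conjI allI impI)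
    show "\<epsilon>0 > 0" "C > 0" "1 / C\<^sup>2 > 0" using \<epsilon>0 C0 by auto
    fix X P :: "(real ^ 'd) set" and c :: real and U :: "real ^ 'd \<Rightarrow> real ^ 'd"
    assume as: "spherical_design t X" "node_transitive X" "steiner_minkowski_polytope X P" "c > 0"
      "orthogonal_transformation U" "polar P = (\<lambda>y. c *\<^sub>R U y) ` P"
      "0 \<le> centered_inradius P / centered_circumradius P - quad_eta t d"
      "centered_inradius P / centered_circumradius P - quad_eta t d \<le> \<epsilon>0"
    note m = main[OF as(1-6) refl refl as(7,8)]
    have X: "finite X" "X \<noteq> {}" using as(1) by (auto simp: spherical_design_def)
    then obtain x where x: "x \<in> X" by auto
    have N: "real (card X) > 0" using X by (simp add: card_gt_0_iff)
    show "1 / C\<^sup>2 / (real (card X))\<^sup>2 * (MAX k\<in>{..n}. (infdist (real (card X) * quad_weight t d k) \<int>)\<^sup>2)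
        \<le> centered_inradius P / centered_circumradius P - quad_eta t d"
      by (rule last[OF _ N]) (use m[OF x] in blast)
    show "\<forall>x\<in>X.
          (wasserstein1 (sum_dirac X (\<lambda>y. 1 / real (card X)) (\<lambda>y. U x \<bullet> y)) (quad_measure t d)
              \<le> ennreal (C * sqrt (centered_inradius P / centered_circumradius P - quad_eta t d)) \<and>
           (1 / real (card X)) * (\<Sum>y\<in>X. (infdist (U x \<bullet> y) (quad_nodes t d))\<^sup>2)
              \<le> C * (centered_inradius P / centered_circumradius P - quad_eta t d)) \<and>
          (\<forall>\<pi>. nearest_node_projection t d (centered_inradius P / centered_circumradius P) \<pi> \<longrightarrow>
            (\<forall>k\<le>n. \<bar>real (card {y \<in> X. U x \<bullet> y \<in> moving_cell t d (centered_inradius P / centered_circumradius P) \<pi> k}) / real (card X)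
                     - quad_weight t d k\<bar> \<le> C * sqrt (centered_inradius P / centered_circumradius P - quad_eta t d))) \<and>
          \<bar>(1 / real (card X)) * real (card {y \<in> X. centered_inradius P / centered_circumradius P - U x \<bullet> y
                \<le> C * sqrt (centered_inradius P / centered_circumradius P - quad_eta t d)})
             - quad_weight t d n\<bar> \<le> C * sqrt (centered_inradius P / centered_circumradius P - quad_eta t d)"
      using m by (intro ballI) blast
  qed
qed

end
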